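(* Let $d\ge1$, $X=\mathbb R^d$, $\alpha>1$ and $\psi\in\Psi$. The Fourier operators $S_M[\cdot]$ are uniformly bounded from the Orlicz space $L(N^{(\alpha)}[\psi])$ into the Orlicz space $L(N^{(\alpha)}_d[\psi])$: there is a finite constant $C=C(\alpha,d,\psi)$ such that for all $f\in L(N^{(\alpha)}[\psi])$ $$\sup_{M\ge 1}\|S_M[f]\|_{L(N^{(\alpha)}_d[\psi])}\le C(\alpha,d,\psi)\,\|f\|_{L(N^{(\alpha)}[\psi])}.$$
   Context: On $\mathbb R^d$ Lebesgue measure is used. $F[f](t)=\lim_{M\to\infty}\int_{|x|\le M}e^{i(t,x)}f(x)\,dx$, $(t,x)=\sum_j t_jx_j$, $|t|=\max_j|t_j|$, and $S_M[f](x)=(2\pi)^{-d}\int_{|t|\le M}e^{-i(t,x)}F[f](t)\,dt$; equivalently, $S_M[f]$ is the convolution of $f$ with the kernel $\prod_{j=1}^d\frac{\sin(My_j)}{\pi y_j}$, which is how $S_M$ is understood on $L_p(\mathbb R^d)$, $1<p<\infty$. Class $\Psi$: the set of continuous, finite, strictly increasing functions $\psi:[\alpha,\infty)\to(0,\infty)$ such that $p\mapsto p\log\psi(p)$ is convex and $\lim_{p\to\infty}\psi(p)=\infty$. For $\psi\in\Psi$, $$N([\psi],u)=\exp\Big(\sup_{p\ge\alpha}\big(p\log|u|-p\log\psi(p)\big)\Big),\qquad |u|\ge e^2,$$ and on $[-e^2,e^2]$ it is defined arbitrarily, but so that $N([\psi],\cdot)$ is even, continuous, convex, strictly increasing on $[0,\infty)$,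 and vanishes only at $0$. Further $\psi_d(p)=p^d\psi(p)$ (again in $\Psi$) and $N_d[\psi]=N[\psi_d]$. For such a function $N$ and $\alpha\ge1$, $N^{(\alpha)}$ denotes an even, continuous, convex function, strictly increasing on $[0,\infty)$, of the form $N^{(\alpha)}(u)=C_1|u|^\alpha$ for $|u|\in[0,C_2]$, $N^{(\alpha)}(u)=C_3+C_4|u|$ for $|u|\in(C_2,C_5]$, $N^{(\alpha)}(u)=N(u)$ for $|u|>C_5$, where $0<C_2<C_5<\infty$ and the constants $C_1,\dots,C_5$ depend on $\alpha$ and $N$ (such a choice exists; fix one). $N^{(\alpha)}[\psi]$ and $N^{(\alpha)}_d[\psi]$ are obtained in this way from $N[\psi]$ and $N_d[\psi]$. Orlicz norm: $\|f\|_{L(N)}=\inf_{v>0}\{v^{-1}(1+\int_X N(v|f(x)|)\,dx)\}$; $L(N)$ is the space of measurable complex $f$ with finite norm. *)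

theory Defs
  imports "HOL-Analysis.Analysis"
begin

text \<open>The left end point \<open>a\<close> of the domain of \<open>\<psi>\<close> is an explicit parameter; only the values of
  \<open>\<psi>\<close> on \<open>[a, \<infinity>)\<close> are used. The condition \<open>0 < a\<close> makes the class closed under
  \<open>\<psi>(p) \<mapsto> p\<^sup>d \<psi>(p)\<close>.\<close>

definition Psi_class :: "real \<Rightarrow> (real \<Rightarrow> real) \<Rightarrow> bool" where
  "Psi_class a \<psi> \<longleftrightarrow>
     0 < a \<and>
     continuous_on {a..} \<psi> \<and>
     (\<forall>p\<ge>a. 0 < \<psi> p) \<and>
     strict_mono_on {a..} \<psi> \<and>
     convex_on {a..} (\<lambda>p. p * ln (\<psi> p)) \<and>
     filterlim \<psi> at_top at_top"

definition psi_pow :: "nat \<Rightarrow> (real \<Rightarrow> real) \<Rightarrow> real \<Rightarrow> real" where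
  "psi_pow d \<psi> p = p ^ d * \<psi> p"

text \<open>\<open>N\<close> is one of the admissible versions of \<open>N[\<psi>]\<close>: its values are prescribed for
  \<open>\<bar>u\<bar> \<ge> e\<^sup>2\<close> only. The supremum is over a set that is bounded above,
  because \<open>\<psi>\<close> tends to infinity.\<close>

definition is_N :: "real \<Rightarrow> (real \<Rightarrow> real) \<Rightarrow> (real \<Rightarrow> real) \<Rightarrow> bool" where
  "is_N a \<psi> N \<longleftrightarrow>
     (\<forall>u. exp 2 \<le> \<bar>u\<bar> \<longrightarrow> N u = exp (SUP p\<in>{a..}. p * ln \<bar>u\<bar> - p * ln (\<psi> p))) \<and>
     (\<forall>u. N (- u) = N u) \<and>
     continuous_on UNIV N \<and>
     convex_on UNIV N \<and>
     strict_mono_on {0..} N \<and>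
     (\<forall>u. N u = 0 \<longleftrightarrow> u = 0)"

text \<open>\<open>N'\<close> is one of the admissible versions of \<open>N\<^sup>(\<^sup>\<alpha>\<^sup>)\<close>.\<close>

definition is_N_mod :: "real \<Rightarrow> (real \<Rightarrow> real) \<Rightarrow> (real \<Rightarrow> real) \<Rightarrow> bool" where
  "is_N_mod \<alpha> N N' \<longleftrightarrow>
     (\<forall>u. N' (- u) = N' u) \<and>
     continuous_on UNIV N' \<and>
     convex_on UNIV N' \<and>
     strict_mono_on {0..} N' \<and>
     (\<exists>C1 C2 C3 C4 C5. 0 < C2 \<and> C2 < C5 \<and>
        (\<forall>u. \<bar>u\<bar> \<le> C2 \<longrightarrow> N' u = C1 * \<bar>u\<bar> powr \<alpha>) \<and>
        (\<forall>u. C2 < \<bar>u\<bar> \<and> \<bar>u\<bar> \<le> C5 \<longrightarrow> N' u = C3 + C4 * \<bar>u\<bar>) \<and>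
        (\<forall>u. C5 < \<bar>u\<bar> \<longrightarrow> N' u = N u))"

definition orlicz_norm :: "'a measure \<Rightarrow> (real \<Rightarrow> real) \<Rightarrow> ('a \<Rightarrow> complex) \<Rightarrow> ennreal" where
  "orlicz_norm X N f =
     (INF v\<in>{0<..}. ennreal (1 / v) * (1 + (\<integral>\<^sup>+ x. ennreal (N (v * cmod (f x))) \<partial>X)))"

definition orlicz_space :: "'a measure \<Rightarrow> (real \<Rightarrow> real) \<Rightarrow> ('a \<Rightarrow> complex) set" where
  "orlicz_space X N = {f \<in> borel_measurable X. orlicz_norm X N f < \<infinity>}"

definition dirichlet_kernel :: "real \<Rightarrow> real ^ 'n \<Rightarrow> real" where
  "dirichlet_kernel M y =
     (\<Prod>j\<in>UNIV. if y $ j = 0 then M / pi else sin (M * y $ j) / (pi * y $ j))"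

text \<open>The partial Fourier integral over the cube \<open>max\<^sub>j \<bar>t\<^sub>j\<bar> \<le> M\<close>, in its
  convolution form. The kernel belongs to every \<open>L\<^sub>q\<close> with \<open>1 < q\<close>, so the integral
  converges absolutely for \<open>f\<close> in \<open>L\<^sub>p\<close>, \<open>1 < p < \<infinity>\<close>.\<close>

definition fourier_partial :: "real \<Rightarrow> (real ^ 'n \<Rightarrow> complex) \<Rightarrow> real ^ 'n \<Rightarrow> complex" where
  "fourier_partial M f x =
     (LINT y|lebesgue. complex_of_real (dirichlet_kernel M y) * f (x - y))"

end

theory Submission
  imports Defs "HOL-Complex_Analysis.Cauchy_Integral_Theorem"
begin

text \<open>On \<open>\<real>\<^sup>d\<close> the operator \<open>S\<^sub>M\<close> is convolution with a product of \<open>d\<close> copies of the kernel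
\<open>sin (M y) / (\<pi> y)\<close>. Two facts about it carry the proof: it is bounded on \<open>L\<^sub>q\<close>, uniformly in
\<open>M\<close>, with norm at most \<open>B q\<^sup>d\<close> for even integers \<open>q\<close>, and it is bounded on \<open>L\<^sub>r\<close> for exponents \<open>r\<close>
arbitrarily close to \<open>1\<close>. The factor \<open>q\<^sup>d\<close> is exactly what the passage from \<open>\<psi>(p)\<close> to
\<open>p\<^sup>d \<psi>(p)\<close> pays for.

The \<open>L\<^sub>q\<close> bounds. In dimension one M. Riesz's argument applies. Let \<open>u\<close> and \<open>v\<close> be the Poisson and
conjugate Poisson integrals of a real \<open>f\<close>. Then \<open>(u + iv)\<^sup>n\<close> is holomorphic in the upper half-plane
and decays, so its integral over a horizontal line vanishes (\<open>cauchy_transform_power\<close>), while for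
even \<open>n\<close> the number \<open>v\<^sup>n\<close> is dominated pointwise by a multiple of \<open>(3n)\<^sup>n u\<^sup>n\<close> plus a multiple of
\<open>\<plusminus>Re (u + iv)\<^sup>n\<close> (\<open>riesz_pointwise_inequality\<close>). Modulating by \<open>sin (M t)\<close> and \<open>cos (M t)\<close> and letting the height
of the line tend to zero turns this into a bound for the sinc kernel with constant linear in
\<open>n\<close> (\<open>strong_type_sinc_even\<close>). Duality (\<open>strong_type_dual\<close>) gives the exponents \<open>n / (n - 1)\<close>, and
integrating out one coordinate at a time gives dimension \<open>d\<close> (\<open>strong_type_dirichlet\<close>).

From \<open>L\<^sub>q\<close> to Orlicz spaces. For large \<open>u\<close> the function \<open>N\<^sub>d(u)\<close> is the supremum over \<open>p\<close> of
\<open>(u / (p\<^sup>d \<psi>(p)))\<^sup>p\<close>. Split the range of \<open>\<bar>S\<^sub>M f\<bar>\<close> into the levels \<open>e\<^sup>m < \<bar>S\<^sub>M f\<bar> \<le> e\<^sup>m\<^sup>+\<^sup>1\<close>, and let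
\<open>p\<^sub>m\<close> be the exponent that nearly attains the supremum at level \<open>m\<close>. Estimating the measure of the
level set by the \<open>L\<^sub>q\<close> bound with \<open>q = p\<^sub>m\<close> alone would give terms of size \<open>exp (- p\<^sub>m)\<close>, and
these need not be summable, since \<open>p\<^sub>m\<close> may grow arbitrarily slowly. As in Marcinkiewicz
interpolation, \<open>f\<close> is therefore cut at height \<open>e\<^sup>m\<close>, and the part above is estimated with an even
exponent slightly below \<open>p\<^sub>m\<close>, the part below with one slightly above. This gains a factor
\<open>exp (- \<bar>m - ln \<bar>f(x)\<bar>\<bar>)\<close>, summable over \<open>m\<close> for each \<open>x\<close>; the factors \<open>q\<^sup>d\<close> are absorbed by
replacing \<open>S\<^sub>M f\<close> by \<open>S\<^sub>M f / K\<close> (\<open>high_level_exponent_bound\<close>). At low levels, where both Young functions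
behave like \<open>u\<^sup>\<alpha>\<close>, two fixed exponents on either side of \<open>\<alpha>\<close> do the same. The outcome is the
modular inequality \<open>\<integral> N\<^sub>d\<^sup>(\<^sup>\<alpha>\<^sup>)(\<bar>S\<^sub>M f\<bar> / K) \<le> C \<integral> N\<^sup>(\<^sup>\<alpha>\<^sup>)(\<bar>f\<bar>)\<close> (\<open>modular_inequality\<close>). Applied to all multiples of
\<open>f\<close>, it gives the inequality of norms.\<close>

section \<open>A pointwise inequality of M. Riesz\<close>

lemma norm_one_plus_power_minus_one:
  fixes w :: complex
  shows "cmod ((1 + w) ^ n - 1) \<le> (1 + cmod w) ^ n - 1"
proof (induction n)
  case (Suc n)
  have "(1 + w) ^ Suc n - 1 = (1 + w) * ((1 + w) ^ n - 1) + w"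
    by (simp add: algebra_simps)
  also have "cmod \<dots> \<le> (1 + cmod w) * ((1 + cmod w) ^ n - 1) + cmod w"
    using Suc norm_triangle_ineq[of 1 w]
    by (intro norm_triangle_mono) (auto simp: norm_mult intro!: mult_mono)
  also have "\<dots> = (1 + cmod w) ^ Suc n - 1"
    by (simp add: algebra_simps)
  finally show ?case .
qed simp

text \<open>If \<open>\<bar>v\<bar>\<close> exceeds \<open>2 n \<bar>u\<bar>\<close>, then \<open>(u + iv)\<^sup>n\<close> is so close to \<open>(iv)\<^sup>n = (- 1)\<^bsup>n/2\<^esup> v\<^sup>n\<close> that its signed real
part is at least \<open>v\<^sup>n / 3\<close>; otherwise \<open>v\<^sup>n\<close> and \<open>\<bar>u + iv\<bar>\<^sup>n\<close> are both controlled by \<open>(3n)\<^sup>n u\<^sup>n\<close>. The point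
is that the last summand integrates to zero when \<open>u + iv\<close> is a Cauchy transform, which leaves
an \<open>L\<^sub>n\<close> bound of \<open>v\<close> by \<open>u\<close> with a constant linear in \<open>n\<close>.\<close>

lemma riesz_pointwise_inequality:
  fixes u v :: real
  assumes "even n" "0 < n"
  shows "v ^ n \<le> 4 * (3 * real n) ^ n * u ^ n + 3 * ((- 1) ^ (n div 2) * Re (Complex u v ^ n))"
proof (cases "\<bar>v\<bar> \<le> 2 * real n * \<bar>u\<bar>")
  case True
  let ?b = "(3 * real n * \<bar>u\<bar>) ^ n"
  have un: "1 * \<bar>u\<bar> \<le> real n * \<bar>u\<bar>"
    using assms by (intro mult_right_mono) auto
  have "cmod (Complex u v) \<le> \<bar>u\<bar> + \<bar>v\<bar>"
    by (metis cmod_le complex.sel)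
  also have "\<dots> \<le> 3 * real n * \<bar>u\<bar>"
    using True un by linarith
  finally have "cmod (Complex u v) ^ n \<le> ?b"
    by (intro power_mono) auto
  moreover have "\<bar>(- 1) ^ (n div 2) * Re (Complex u v ^ n)\<bar> \<le> cmod (Complex u v ^ n)"
    by (simp add: abs_mult power_abs abs_Re_le_cmod)
  ultimately have a: "- ((- 1) ^ (n div 2) * Re (Complex u v ^ n)) \<le> ?b"
    by (simp add: norm_power)
  have "\<bar>v\<bar> ^ n \<le> ?b"
    using True un by (intro power_mono) auto
  hence b: "v ^ n \<le> ?b"
    using assms by (simp add: power_even_abs)
  have c: "?b = (3 * real n) ^ n * u ^ n"
    using assms by (simp add: power_mult_distrib power_even_abs)
  show ?thesis
    using a b unfolding c by linarith
next
  case False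
  hence v: "v \<noteq> 0"
    by auto
  have uv: "\<bar>u\<bar> / \<bar>v\<bar> * real n \<le> 1 / 2"
    using False v by (simp add: divide_le_eq mult.commute mult.left_commute)
  define w where "w = - \<i> * complex_of_real (u / v)"
  have z: "Complex u v = \<i> * complex_of_real v * (1 + w)"
    using v by (simp add: w_def complex_eq_iff field_simps)
  have "\<i> ^ n = (- 1) ^ (n div 2)"
    using assms by (metis dvd_mult_div_cancel i_squared power_mult power2_i)
  hence zn: "(- 1) ^ (n div 2) * Re (Complex u v ^ n) = v ^ n * Re ((1 + w) ^ n)"
    unfolding z power_mult_distrib
    by (auto simp flip: of_real_power power_add power_mult_distrib mult.assoc
             simp: minus_one_power_iff)
  have nw: "cmod w * real n \<le> 1 / 2"
    using uv by (simp add: w_def norm_mult norm_divide)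
  have "(1 + cmod w) ^ n \<le> exp (cmod w) ^ n"
    by (intro power_mono) auto
  also have "\<dots> = exp (cmod w * real n)"
    by (simp add: exp_of_nat_mult mult.commute)
  also have "\<dots> \<le> exp (1 / 2)"
    using nw by simp
  also have "\<dots> \<le> 5 / 3"
  proof -
    have "exp (1 / 2 :: real) ^ 2 = exp 1"
      by (simp flip: exp_of_nat_mult)
    also have "\<dots> \<le> (5 / 3) ^ 2"
      using e_less_272 by (simp add: power2_eq_square)
    finally show ?thesis
      by (rule power2_le_imp_le) simp
  qed
  finally have "cmod ((1 + w) ^ n - 1) \<le> 2 / 3"
    using norm_one_plus_power_minus_one[of w n] by linarith
  moreover have "\<bar>Re ((1 + w) ^ n - 1)\<bar> \<le> cmod ((1 + w) ^ n - 1)"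
    by (rule abs_Re_le_cmod)
  ultimately have "1 \<le> 3 * Re ((1 + w) ^ n)"
    by (simp add: abs_le_iff)
  moreover have vn: "0 \<le> v ^ n" "0 \<le> u ^ n"
    using assms by (auto intro: zero_le_even_power)
  ultimately have "v ^ n * 1 \<le> v ^ n * (3 * Re ((1 + w) ^ n))"
    by (intro mult_left_mono)
  moreover have "0 \<le> 4 * (3 * real n) ^ n * u ^ n"
    using vn by simp
  moreover have "v ^ n * (3 * Re ((1 + w) ^ n)) = 3 * (v ^ n * Re ((1 + w) ^ n))"
    by simp
  ultimately show ?thesis
    unfolding zn by linarith
qed

section \<open>Bounded functions of bounded support\<close>

text \<open>On these functions every convolution integral below converges, whatever the decay of the
kernel, and Fubini's theorem applies without further hypotheses.\<close>

definition test_fun :: "('a::euclidean_space \<Rightarrow> real) \<Rightarrow> bool" where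
  "test_fun f \<longleftrightarrow> f \<in> borel_measurable borel \<and>
     (\<exists>B R. 0 < B \<and> 0 < R \<and> (\<forall>x. \<bar>f x\<bar> \<le> B) \<and> (\<forall>x. R < norm x \<longrightarrow> f x = 0))"

lemma test_fun_measurable [measurable_dest]: "test_fun f \<Longrightarrow> f \<in> borel_measurable borel"
  by (simp add: test_fun_def)

lemma test_funE:
  assumes "test_fun f"
  obtains B R where "0 < B" "0 < R" "\<And>x. \<bar>f x\<bar> \<le> B" "\<And>x. R < norm x \<Longrightarrow> f x = 0"
  using assms by (auto simp: test_fun_def)

lemma norm_integral_le:
  fixes f :: "'a \<Rightarrow> 'b::{banach, second_countable_topology}"
  assumes "integrable M f" "integrable M g" "\<And>x. norm (f x) \<le> g x"
  shows "norm (\<integral>x. f x \<partial>M) \<le> (\<integral>x. g x \<partial>M)"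
  using assms by (intro order_trans[OF integral_norm_bound] integral_mono integrable_norm)

lemma integrable_bounded_support:
  fixes f :: "'a::euclidean_space \<Rightarrow> 'b::{banach, second_countable_topology}"
  assumes "f \<in> borel_measurable borel" "\<And>x. norm (f x) \<le> B" "\<And>x. R < norm x \<Longrightarrow> f x = 0"
  shows "integrable lborel f"
proof (rule Bochner_Integration.integrable_bound)
  show "integrable lborel (\<lambda>x::'a. B * indicator (cball 0 R) x)"
    by (intro integrable_mult_right integrable_real_indicator emeasure_lborel_cball_finite) auto
  show "AE x in lborel. norm (f x) \<le> norm (B * indicator (cball 0 R) x)"
    using assms order_trans[OF norm_ge_zero assms(2)] by (auto split: split_indicator simp: not_le)
qed (use assms in simp)

lemma test_fun_mult:
  assumes "test_fun f" "g \<in> borel_measurable borel" "\<And>x. \<bar>g x\<bar> \<le> B"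
  shows "test_fun (\<lambda>x. f x * g x)"
proof -
  obtain A R where *: "0 < A" "0 < R" "\<And>x. \<bar>f x\<bar> \<le> A" "\<And>x. R < norm x \<Longrightarrow> f x = 0"
    using assms(1) by (rule test_funE) blast
  have "\<bar>f x * g x\<bar> \<le> A * (\<bar>B\<bar> + 1)" for x
    unfolding abs_mult using * assms(3)[of x] by (intro mult_mono) auto
  moreover have "(\<lambda>x. f x * g x) \<in> borel_measurable borel"
    using assms by measurable
  ultimately show ?thesis
    using * unfolding test_fun_def by (intro conjI exI[of _ "A * (\<bar>B\<bar> + 1)"] exI[of _ R]) auto
qed

lemma integrable_test_fun_mult:
  fixes g :: "'a::euclidean_space \<Rightarrow> 'b::{banach, second_countable_topology}"
  assumes "test_fun f" "g \<in> borel_measurable borel" "\<And>x. norm (g x) \<le> B"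
  shows "integrable lborel (\<lambda>x. f x *\<^sub>R g x)"
proof -
  obtain A R where *: "0 < A" "0 < R" "\<And>x. \<bar>f x\<bar> \<le> A" "\<And>x. R < norm x \<Longrightarrow> f x = 0"
    using assms(1) by (rule test_funE) blast
  show ?thesis
  proof (rule integrable_bounded_support)
    show "norm (f x *\<^sub>R g x) \<le> A * B" for x
      using * assms(3)[of x] order_trans[OF norm_ge_zero assms(3)] by (auto intro!: mult_mono)
    show "f x *\<^sub>R g x = 0" if "R < norm x" for x
      using * that by simp
    show "(\<lambda>x. f x *\<^sub>R g x) \<in> borel_measurable borel"
      using assms by measurable
  qed
qed

section \<open>The Cauchy transform in the upper half-plane\<close>

text \<open>On the line \<open>Im z = \<epsilon>\<close> the real and imaginary parts are the Poisson and the conjugate Poisson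
integral of \<open>f\<close>.\<close>

definition cauchy_transform :: "(real \<Rightarrow> real) \<Rightarrow> complex \<Rightarrow> complex" where
  "cauchy_transform f z = (\<integral>t. f t *\<^sub>R (\<i> / (complex_of_real pi * (z - complex_of_real t))) \<partial>lborel)"

lemma Im_le_norm_diff_real: "0 < Im z \<Longrightarrow> Im z \<le> cmod (z - complex_of_real t)"
  using abs_Im_le_cmod[of "z - complex_of_real t"] by simp

lemma integrable_cauchy:
  assumes "test_fun f" "0 < Im z"
  shows "integrable lborel (\<lambda>t. f t *\<^sub>R (\<i> / (complex_of_real pi * (z - complex_of_real t))))"
proof (rule integrable_test_fun_mult[OF assms(1)])
  show "norm (\<i> / (pi * (z - complex_of_real t))) \<le> 1 / (pi * Im z)" for t
    using Im_le_norm_diff_real[OF assms(2), of t] assms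
    by (auto simp: norm_divide norm_mult intro!: divide_left_mono mult_left_mono mult_pos_pos)
qed measurable

text \<open>The decay \<open>1 / \<bar>z\<bar>\<close> comes from the bounded support of \<open>f\<close>; it makes the powers \<open>F\<^sup>n\<close> with \<open>n \<ge> 2\<close>
integrable on horizontal lines and negligible on large half circles.\<close>

lemma cauchy_transform_bound:
  assumes "test_fun f" "0 < \<epsilon>"
  obtains A where "0 < A" "\<And>z. \<epsilon> \<le> Im z \<Longrightarrow> cmod (cauchy_transform f z) \<le> A / cmod z"
proof -
  obtain B R where *: "0 < B" "0 < R" "\<And>x. \<bar>f x\<bar> \<le> B" "\<And>x. R < norm x \<Longrightarrow> f x = 0"
    using assms(1) by (rule test_funE) blast
  define A where "A = max (2 * R / \<epsilon>) 2"
  have A: "0 < A" "2 \<le> A" "2 * R / \<epsilon> \<le> A"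
    by (auto simp: A_def)
  have int: "integrable lborel (\<lambda>t. \<bar>f t\<bar>)"
    using integrable_test_fun_mult[OF assms(1), of "\<lambda>_. 1::real" 1] by (auto intro: integrable_abs)
  have "cmod (cauchy_transform f z) \<le> (A / pi * ((\<integral>t. \<bar>f t\<bar> \<partial>lborel) + 1)) / cmod z"
    if z: "\<epsilon> \<le> Im z" for z
  proof -
    have z0: "0 < Im z" "0 < cmod z"
      using z assms abs_Im_le_cmod[of z] by auto
    have pt: "cmod (f t *\<^sub>R (\<i> / (complex_of_real pi * (z - complex_of_real t)))) \<le> \<bar>f t\<bar> * (A / (pi * cmod z))" for t
    proof (cases "\<bar>t\<bar> \<le> R")
      case True
      have "cmod z \<le> A * cmod (z - complex_of_real t)"
      proof (cases "cmod z \<le> 2 * R")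
        case True
        have "cmod z * \<epsilon> \<le> (2 * R / \<epsilon> * \<epsilon>) * \<epsilon>"
          using True assms by simp
        hence "cmod z \<le> (2 * R / \<epsilon>) * \<epsilon>"
          using assms True by simp
        also have "\<dots> \<le> A * cmod (z - complex_of_real t)"
          using A z Im_le_norm_diff_real[OF z0(1), of t] assms by (intro mult_mono) auto
        finally show ?thesis .
      next
        case False
        have "cmod z \<le> cmod (z - complex_of_real t) + \<bar>t\<bar>"
          using norm_triangle_ineq[of "z - t" t] by simp
        hence "cmod z \<le> 2 * cmod (z - complex_of_real t)"
          using True False by linarith
        also have "\<dots> \<le> A * cmod (z - complex_of_real t)"
          using A by (intro mult_right_mono) auto
        finally show ?thesis .
      qed
      moreover have "0 < cmod (z - complex_of_real t)"
        using Im_le_norm_diff_real[OF z0(1), of t] z0 by linarith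
      ultimately have "1 / cmod (z - complex_of_real t) \<le> A / cmod z"
        using z0 by (simp add: divide_simps mult.commute)
      from mult_left_mono[OF this, of "\<bar>f t\<bar> / pi"] show ?thesis
        by (simp add: norm_divide norm_mult)
    qed (use * in auto)
    have "cmod (cauchy_transform f z) \<le> (\<integral>t. \<bar>f t\<bar> * (A / (pi * cmod z)) \<partial>lborel)"
      unfolding cauchy_transform_def
      using integrable_cauchy[OF assms(1) z0(1)] int pt
      by (intro norm_integral_le) auto
    also have "\<dots> = (A / pi * (\<integral>t. \<bar>f t\<bar> \<partial>lborel)) / cmod z"
      by simp
    also have "\<dots> \<le> (A / pi * ((\<integral>t. \<bar>f t\<bar> \<partial>lborel) + 1)) / cmod z"
      using A z0 by (intro divide_right_mono mult_left_mono) auto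
    finally show ?thesis .
  qed
  moreover have "0 < A / pi * ((\<integral>t. \<bar>f t\<bar> \<partial>lborel) + 1)"
    using A by (intro mult_pos_pos add_nonneg_pos) auto
  ultimately show ?thesis
    using that by blast
qed

text \<open>As \<open>\<bar>z - t\<bar> \<ge> Im z\<close> for real \<open>t\<close>, the difference quotient of \<open>1 / (z - t)\<close> differs from its
derivative by \<open>O(\<bar>w - z\<bar>)\<close> uniformly in \<open>t\<close>, so one may differentiate under the integral.\<close>

lemma holomorphic_cauchy_transform:
  assumes "test_fun f"
  shows "cauchy_transform f holomorphic_on {z. 0 < Im z}"
proof -
  have "\<exists>D. (cauchy_transform f has_field_derivative D) (at z)" if z: "0 < Im z" for z
  proof -
    define D where "D = (\<integral>t. f t *\<^sub>R (- \<i> / (complex_of_real pi * (z - complex_of_real t)\<^sup>2)) \<partial>lborel)"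
    define C where "C = (\<integral>t. \<bar>f t\<bar> \<partial>lborel) * (1 / (pi * (Im z / 2) * (Im z)\<^sup>2))"
    have int: "integrable lborel (\<lambda>t. \<bar>f t\<bar>)"
      using integrable_test_fun_mult[OF assms(1), of "\<lambda>_. 1::real" 1] by (auto intro: integrable_abs)
    have nz: "z - complex_of_real t \<noteq> 0" "Im z \<le> cmod (z - complex_of_real t)" for t
      using Im_le_norm_diff_real[OF z, of t] z by auto
    have intD: "integrable lborel (\<lambda>t. f t *\<^sub>R (- \<i> / (complex_of_real pi * (z - complex_of_real t)\<^sup>2)))"
    proof (rule integrable_test_fun_mult[OF assms])
      show "norm (- \<i> / (pi * (z - complex_of_real t)\<^sup>2)) \<le> 1 / (pi * (Im z)\<^sup>2)" for t
        using nz z by (auto simp: norm_divide norm_mult norm_power intro!: divide_left_mono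
          mult_left_mono mult_pos_pos power_mono)
    qed measurable
    have bound: "cmod ((cauchy_transform f w - cauchy_transform f z) / (w - z) - D) \<le> cmod (w - z) * C"
      if w: "w \<in> ball z (Im z / 2)" "w \<noteq> z" for w
    proof -
      have "\<bar>Im z - Im w\<bar> \<le> cmod (z - w)"
        using abs_Im_le_cmod[of "z - w"] by simp
      hence iw: "Im z / 2 \<le> Im w" "0 < Im w"
        using w z by (auto simp: dist_norm)
      have nw: "w - complex_of_real t \<noteq> 0" "Im z / 2 \<le> cmod (w - complex_of_real t)" for t
        using Im_le_norm_diff_real[OF iw(2), of t] iw by auto
      have iz: "integrable lborel (\<lambda>t. f t *\<^sub>R (\<i> / (complex_of_real pi * (z - complex_of_real t))))"
        and iwt: "integrable lborel (\<lambda>t. f t *\<^sub>R (\<i> / (complex_of_real pi * (w - complex_of_real t))))"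
        using integrable_cauchy[OF assms] z iw by auto
      have pt: "(f t *\<^sub>R (\<i> / (complex_of_real pi * (w - complex_of_real t))) - f t *\<^sub>R (\<i> / (complex_of_real pi * (z - complex_of_real t)))) / (w - z)
          - f t *\<^sub>R (- \<i> / (complex_of_real pi * (z - complex_of_real t)\<^sup>2))
          = f t *\<^sub>R (\<i> * (w - z) / (complex_of_real pi * (w - complex_of_real t) * (z - complex_of_real t)\<^sup>2))" for t
      proof -
        have "(\<i> / (pi * W) - \<i> / (pi * Z)) / (W - Z) + \<i> / (pi * Z\<^sup>2)
          = \<i> * (W - Z) / (pi * W * Z\<^sup>2)" if "W \<noteq> 0" "Z \<noteq> 0" "W \<noteq> Z" for W Z :: complex
          using that by (simp add: divide_simps) (simp add: algebra_simps power2_eq_square)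
        from this[OF nw(1)[of t] nz(1)[of t]] w(2) have
          e: "(\<i> / (complex_of_real pi * (w - complex_of_real t)) - \<i> / (complex_of_real pi * (z - complex_of_real t))) / (w - z) + \<i> / (complex_of_real pi * (z - complex_of_real t)\<^sup>2)
          = \<i> * (w - z) / (complex_of_real pi * (w - complex_of_real t) * (z - complex_of_real t)\<^sup>2)" by simp
        show ?thesis
          unfolding e[symmetric] by (simp add: scaleR_conv_of_real algebra_simps diff_divide_distrib)
      qed
      have "(cauchy_transform f w - cauchy_transform f z) / (w - z) - D
          = (\<integral>t. (f t *\<^sub>R (\<i> / (complex_of_real pi * (w - complex_of_real t))) - f t *\<^sub>R (\<i> / (complex_of_real pi * (z - complex_of_real t)))) / (w - z)
          - f t *\<^sub>R (- \<i> / (complex_of_real pi * (z - complex_of_real t)\<^sup>2)) \<partial>lborel)"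
        unfolding cauchy_transform_def D_def
        using iz iwt intD by (subst Bochner_Integration.integral_diff) auto
      also have "\<dots> = (\<integral>t. f t *\<^sub>R (\<i> * (w - z) / (complex_of_real pi * (w - complex_of_real t) * (z - complex_of_real t)\<^sup>2)) \<partial>lborel)"
        unfolding pt ..
      also have "cmod \<dots> \<le> (\<integral>t. \<bar>f t\<bar> * (1 / (pi * (Im z / 2) * (Im z)\<^sup>2)) * cmod (w - z) \<partial>lborel)"
      proof (rule norm_integral_le)
        have "integrable lborel (\<lambda>t. (f t *\<^sub>R (\<i> / (complex_of_real pi * (w - complex_of_real t))) - f t *\<^sub>R (\<i> / (complex_of_real pi * (z - complex_of_real t)))) / (w - z)
          - f t *\<^sub>R (- \<i> / (complex_of_real pi * (z - complex_of_real t)\<^sup>2)))"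
          using iz iwt intD by auto
        thus "integrable lborel (\<lambda>t. f t *\<^sub>R (\<i> * (w - z) / (complex_of_real pi * (w - complex_of_real t) * (z - complex_of_real t)\<^sup>2)))"
          unfolding pt .
        show "cmod (f t *\<^sub>R (\<i> * (w - z) / (complex_of_real pi * (w - complex_of_real t) * (z - complex_of_real t)\<^sup>2)))
           \<le> \<bar>f t\<bar> * (1 / (pi * (Im z / 2) * (Im z)\<^sup>2)) * cmod (w - z)" for t
        proof -
          have "pi * (Im z / 2) * (Im z)\<^sup>2 \<le> pi * cmod (w - complex_of_real t) * (cmod (z - complex_of_real t))\<^sup>2"
            using nz[of t] nw[of t] z by (intro mult_mono power_mono) auto
          hence "1 / (pi * cmod (w - complex_of_real t) * (cmod (z - complex_of_real t))\<^sup>2) \<le> 1 / (pi * (Im z / 2) * (Im z)\<^sup>2)"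
            using z nz[of t] nw[of t] by (intro divide_left_mono mult_pos_pos zero_less_power) auto
          from mult_left_mono[OF this, of "\<bar>f t\<bar> * cmod (w - z)"] show ?thesis
            by (simp add: norm_divide norm_mult norm_power mult_ac)
        qed
      qed (use int in auto)
      also have "\<dots> = cmod (w - z) * C"
        by (simp add: C_def)
      finally show ?thesis .
    qed
    have "((\<lambda>w. (cauchy_transform f w - cauchy_transform f z) / (w - z) - D) \<longlongrightarrow> 0) (at z)"
    proof (rule Lim_null_comparison)
      show "\<forall>\<^sub>F w in at z. cmod ((cauchy_transform f w - cauchy_transform f z) / (w - z) - D)
          \<le> cmod (w - z) * C"
        using bound z unfolding eventually_at_topological
        by (intro exI[of _ "ball z (Im z / 2)"]) auto
      show "((\<lambda>w. cmod (w - z) * C) \<longlongrightarrow> 0) (at z)"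
        by (rule tendsto_eq_intros refl | simp)+
    qed
    hence "(cauchy_transform f has_field_derivative D) (at z)"
      by (simp add: has_field_derivative_iff Lim_null[of _ D])
    thus ?thesis ..
  qed
  thus ?thesis
    unfolding holomorphic_on_def field_differentiable_def
    by (blast intro: has_field_derivative_at_within)
qed


lemma poisson_kernel_integral:
  assumes "0 < \<epsilon>"
  shows "integrable lborel (\<lambda>x. \<epsilon> / (pi * (x\<^sup>2 + \<epsilon>\<^sup>2)))"
    and "(\<integral>x. \<epsilon> / (pi * (x\<^sup>2 + \<epsilon>\<^sup>2)) \<partial>lborel) = 1"
proof -
  let ?F = "\<lambda>x. arctan (x / \<epsilon>) / pi" and ?f = "\<lambda>x. \<epsilon> / (pi * (x\<^sup>2 + \<epsilon>\<^sup>2))"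
  have pos: "x\<^sup>2 + \<epsilon>\<^sup>2 \<noteq> 0" for x
    using assms by (simp add: add_nonneg_eq_0_iff)
  have F: "(?F has_real_derivative ?f x) (at x)" for x
    using assms pos[of x]
    by (auto intro!: derivative_eq_intros simp: divide_simps power2_eq_square)
  have f: "isCont ?f x" for x
    using pos[of x] by (auto intro!: continuous_intros)
  have top: "((?F \<circ> real_of_ereal) \<longlongrightarrow> 1 / 2) (at_left \<infinity>)"
  proof -
    have "((\<lambda>x. arctan (x / \<epsilon>)) \<longlongrightarrow> pi / 2) at_top"
      using assms filterlim_tendsto_pos_mult_at_top[OF tendsto_const[of "1 / \<epsilon>"] _ filterlim_ident]
      by (intro filterlim_compose[OF tendsto_arctan_at_top]) simp
    from tendsto_divide[OF this tendsto_const[of pi]] show ?thesis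
      by (simp add: ereal_tendsto_simps)
  qed
  have bot: "((?F \<circ> real_of_ereal) \<longlongrightarrow> - 1 / 2) (at_right (- \<infinity>))"
  proof -
    have "((\<lambda>x. arctan (x / \<epsilon>)) \<longlongrightarrow> - (pi / 2)) at_bot"
      using assms filterlim_tendsto_pos_mult_at_bot[OF tendsto_const[of "1 / \<epsilon>"] _ filterlim_ident]
      by (intro filterlim_compose[OF tendsto_arctan_at_bot]) simp
    from tendsto_divide[OF this tendsto_const[of pi]] show ?thesis
      by (simp add: ereal_tendsto_simps)
  qed
  have nn: "AE x in lborel. - \<infinity> < ereal x \<longrightarrow> ereal x < \<infinity> \<longrightarrow> 0 \<le> ?f x"
    using assms by simp
  note * = interval_integral_FTC_nonneg[where a="- \<infinity>" and b="\<infinity>" and F="?F" and f="?f",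
      OF _ F f nn bot top]
  show "integrable lborel ?f"
    using *(1) by (simp add: set_integrable_def)
  show "(\<integral>x. ?f x \<partial>lborel) = 1"
    using *(2) by (simp add: interval_lebesgue_integral_def set_lebesgue_integral_def)
qed

lemma norm_Complex_sqr: "(cmod (Complex x y))\<^sup>2 = x\<^sup>2 + y\<^sup>2"
  by (simp add: cmod_def)

text \<open>Close the segment from \<open>-k + i\<epsilon>\<close> to \<open>k + i\<epsilon>\<close> by a half circle and apply Cauchy's theorem. On the
half circle \<open>F\<^sup>n\<close> is \<open>O(k\<^sup>-\<^sup>n)\<close>, so for \<open>n \<ge> 2\<close> its contribution tends to zero.\<close>

lemma cauchy_transform_power:
  assumes f: "test_fun f" and \<epsilon>: "0 < \<epsilon>" and n: "2 \<le> n"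
  shows "integrable lborel (\<lambda>x. cauchy_transform f (Complex x \<epsilon>) ^ n)"
    and "(\<integral>x. cauchy_transform f (Complex x \<epsilon>) ^ n \<partial>lborel) = 0"
proof -
  obtain A where A: "0 < A" "\<And>z. \<epsilon> \<le> Im z \<Longrightarrow> cmod (cauchy_transform f z) \<le> A / cmod z"
    using cauchy_transform_bound[OF f \<epsilon>] by blast
  define g where "g z = cauchy_transform f (z + \<i> * \<epsilon>) ^ n" for z
  define S where "S = {z. - \<epsilon> < Im z}"
  have Sx: "complex_of_real x + \<i> * \<epsilon> = Complex x \<epsilon>" for x
    by (simp add: complex_eq_iff)
  have holo: "g holomorphic_on S"
  proof -
    have "(\<lambda>z. z + \<i> * \<epsilon>) holomorphic_on S"
      by (intro holomorphic_intros)
    hence "(cauchy_transform f \<circ> (\<lambda>z. z + \<i> * \<epsilon>)) holomorphic_on S"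
      by (rule holomorphic_on_compose_gen[OF _ holomorphic_cauchy_transform[OF f]]) (auto simp: S_def)
    hence "(\<lambda>z. ((cauchy_transform f \<circ> (\<lambda>z. z + \<i> * \<epsilon>)) z) ^ n) holomorphic_on S"
      by (rule holomorphic_on_power)
    thus ?thesis
      by (simp add: g_def[abs_def])
  qed
  have conv: "convex S"
    unfolding S_def by (rule convex_halfspace_Im_gt)
  have cont: "continuous_on UNIV (\<lambda>x::real. g (of_real x))"
    using \<epsilon>
    by (intro continuous_on_compose2[OF holomorphic_on_imp_continuous_on[OF holo], of UNIV complex_of_real]
        continuous_on_of_real continuous_on_id) (auto simp: S_def)
  have bound: "cmod (g z) \<le> (A / cmod (z + \<i> * \<epsilon>)) ^ n" if "0 \<le> Im z" for z
    unfolding g_def norm_power using A(2)[of "z + \<i> * \<epsilon>"] that by (intro power_mono) auto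
  have int: "integrable lborel (\<lambda>x::real. g (of_real x))"
  proof (rule Bochner_Integration.integrable_bound)
    let ?w = "\<lambda>x. (A ^ n * \<epsilon> * pi / \<epsilon> ^ n) * (\<epsilon> / (pi * (x\<^sup>2 + \<epsilon>\<^sup>2)))"
    show "integrable lborel ?w"
      using poisson_kernel_integral(1)[OF \<epsilon>] by (rule integrable_mult_right)
    show "(\<lambda>x::real. g (of_real x)) \<in> borel_measurable lborel"
      using cont by (simp add: borel_measurable_continuous_onI)
    have "cmod (g (of_real x)) \<le> ?w x" for x
    proof -
      let ?c = "cmod (Complex x \<epsilon>)"
      have c: "\<epsilon> \<le> ?c" "0 < ?c"
        using abs_Im_le_cmod[of "Complex x \<epsilon>"] \<epsilon> by auto
      have "\<epsilon> ^ (n - 2) * ?c\<^sup>2 \<le> ?c ^ (n - 2) * ?c\<^sup>2"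
        using c \<epsilon> by (intro mult_right_mono power_mono) auto
      also have "\<dots> = ?c ^ n"
        using n by (metis le_add_diff_inverse2 power_add)
      finally have "\<epsilon> ^ n * (x\<^sup>2 + \<epsilon>\<^sup>2) \<le> \<epsilon>\<^sup>2 * ?c ^ n"
        using n \<epsilon> by (simp add: norm_Complex_sqr power_diff field_simps)
      hence "A ^ n / ?c ^ n \<le> A ^ n * \<epsilon>\<^sup>2 / (\<epsilon> ^ n * (x\<^sup>2 + \<epsilon>\<^sup>2))"
      proof -
        assume *: "\<epsilon> ^ n * (x\<^sup>2 + \<epsilon>\<^sup>2) \<le> \<epsilon>\<^sup>2 * ?c ^ n"
        have "a / b \<le> p / q" if "a * q \<le> p * b" "0 < b" "0 < q" for a b p q :: real
          using that by (simp add: field_simps)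
        moreover have "A ^ n * (\<epsilon> ^ n * (x\<^sup>2 + \<epsilon>\<^sup>2)) \<le> A ^ n * \<epsilon>\<^sup>2 * ?c ^ n"
          using mult_left_mono[OF *, of "A ^ n"] A(1) by (simp add: mult.assoc)
        moreover have "0 < ?c ^ n" "0 < \<epsilon> ^ n * (x\<^sup>2 + \<epsilon>\<^sup>2)"
          using c \<epsilon> by (auto intro!: mult_pos_pos add_nonneg_pos)
        ultimately show ?thesis
          by blast
      qed
      also have "\<dots> = ?w x"
        using \<epsilon> by (simp add: power2_eq_square)
      finally show ?thesis
        using bound[of "of_real x"] by (simp add: Sx power_divide)
    qed
    thus "AE x in lborel. cmod (g (of_real x)) \<le> norm (?w x)"
      unfolding real_norm_def by (intro AE_I2 order_trans[OF _ abs_ge_self])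
  qed
  have seg: "cmod (integral {- real k..real k} (\<lambda>x. g (of_real x))) \<le> (A / k) ^ n * k * \<bar>pi - 0\<bar>"
    if k: "0 < k" for k :: nat
  proof -
    let ?arc = "part_circlepath 0 (real k) 0 pi" and ?l = "linepath (- of_nat k) (of_nat k)"
    have arc: "cmod z = k \<and> 0 \<le> Im z" if "z \<in> path_image ?arc" for z
    proof -
      obtain t where t: "t \<in> closed_segment 0 pi" "z = real k * cis t"
        using \<open>z \<in> path_image ?arc\<close> unfolding path_image_part_circlepath' by auto
      hence "0 \<le> sin t"
        by (auto simp: closed_segment_eq_real_ivl intro!: sin_ge_zero)
      thus ?thesis
        using t by (simp add: norm_mult)
    qed
    have line: "Im z = 0" if "z \<in> path_image ?l" for z
      using that by (auto simp: closed_segment_def)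
    have arcS: "path_image ?arc \<subseteq> S" and lineS: "path_image ?l \<subseteq> S"
      using arc line \<epsilon> by (force simp: S_def)+
    have contS: "continuous_on T g" if "T \<subseteq> S" for T
      using holo that by (meson continuous_on_subset holomorphic_on_imp_continuous_on)
    have ia: "g contour_integrable_on ?arc"
      by (rule contour_integrable_continuous_part_circlepath[OF contS[OF arcS]])
    have il: "g contour_integrable_on ?l"
      using contS[OF lineS] by (intro contour_integrable_continuous_linepath) auto
    have "(g has_contour_integral 0) (?arc +++ ?l)"
      using arcS lineS k
      by (intro Cauchy_theorem_convex_simple[OF holo conv])
         (auto simp: path_image_join intro!: valid_path_join)
    moreover have "(g has_contour_integral (contour_integral ?arc g + contour_integral ?l g)) (?arc +++ ?l)"
      using ia il by (intro has_contour_integral_join has_contour_integral_integral) auto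
    ultimately have "contour_integral ?arc g + contour_integral ?l g = 0"
      by (metis has_contour_integral_unique)
    hence "contour_integral ?l g = - contour_integral ?arc g"
      by (simp add: eq_neg_iff_add_eq_0 add.commute)
    moreover have "contour_integral ?l g = integral {- real k..real k} (\<lambda>x. g (of_real x))"
      using k by (subst contour_integral_linepath_Reals_eq) auto
    moreover have "cmod (contour_integral ?arc g) \<le> (A / k) ^ n * k * \<bar>pi - 0\<bar>"
    proof (rule contour_integral_bound_part_circlepath[OF ia])
      fix z assume "z \<in> path_image ?arc"
      hence z: "cmod z = k" "0 \<le> Im z"
        using arc by auto
      have "(cmod z)\<^sup>2 \<le> (cmod (z + \<i> * \<epsilon>))\<^sup>2"
        using z(2) \<epsilon> by (simp add: cmod_power2 power_mono)
      hence "real k \<le> cmod (z + \<i> * \<epsilon>)"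
        using z by (simp add: power2_le_iff_abs_le)
      hence "(A / cmod (z + \<i> * \<epsilon>)) ^ n \<le> (A / k) ^ n"
        using k A(1) by (intro power_mono divide_left_mono mult_pos_pos) auto
      thus "cmod (g z) \<le> (A / k) ^ n"
        using bound[OF z(2)] by linarith
    qed (use A(1) in auto)
    ultimately show ?thesis
      by simp
  qed
  have lim: "(\<lambda>k. integral {- real k..real k} (\<lambda>x. g (of_real x))) \<longlonglongrightarrow> (\<integral>x. g (of_real x) \<partial>lborel)"
  proof -
    have "(\<lambda>k. \<integral>x. indicat_real {- real k..real k} x *\<^sub>R g (of_real x) \<partial>lborel)
        \<longlonglongrightarrow> (\<integral>x. g (of_real x) \<partial>lborel)"
    proof (rule integral_dominated_convergence)
      show "integrable lborel (\<lambda>x. cmod (g (of_real x)))"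
        using int by (rule integrable_norm)
      have "(\<lambda>k. indicat_real {- real k..real k} x *\<^sub>R g (of_real x)) \<longlonglongrightarrow> g (of_real x)" for x
      proof (rule tendsto_eventually)
        have "\<bar>x\<bar> \<le> real k" if "nat \<lceil>\<bar>x\<bar>\<rceil> \<le> k" for k
          using that by linarith
        thus "\<forall>\<^sub>F k in sequentially. indicat_real {- real k..real k} x *\<^sub>R g (of_real x) = g (of_real x)"
          unfolding eventually_sequentially
          by (intro exI[of _ "nat \<lceil>\<bar>x\<bar>\<rceil>"]) (auto simp: indicator_def abs_le_iff)
      qed
      thus "AE x in lborel. (\<lambda>k. indicat_real {- real k..real k} x *\<^sub>R g (of_real x)) \<longlonglongrightarrow> g (of_real x)"
        by simp
    qed (use int in \<open>auto split: split_indicator\<close>)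
    moreover have "(\<integral>x. indicat_real {- real k..real k} x *\<^sub>R g (of_real x) \<partial>lborel)
        = integral {- real k..real k} (\<lambda>x. g (of_real x))" for k
    proof -
      have "set_integrable lborel {- real k..real k} (\<lambda>x. g (of_real x))"
        unfolding set_integrable_def by (rule integrable_mult_indicator[OF _ int]) simp
      from set_borel_integral_eq_integral(2)[OF this] show ?thesis
        by (simp add: set_lebesgue_integral_def)
    qed
    ultimately show ?thesis
      by simp
  qed
  have "(\<lambda>k. integral {- real k..real k} (\<lambda>x. g (of_real x))) \<longlonglongrightarrow> 0"
  proof (rule Lim_null_comparison)
    show "\<forall>\<^sub>F k in sequentially. cmod (integral {- real k..real k} (\<lambda>x. g (of_real x)))
        \<le> (A / real k) ^ n * real k * \<bar>pi - 0\<bar>"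
      using seg by (intro eventually_sequentiallyI[of 1]) auto
    have eq: "(A / real k) ^ n * real k * \<bar>pi - 0\<bar> = A ^ n * pi * (1 / real k) ^ (n - 1)" for k
    proof (cases "k = 0")
      case False
      have "(A / real k) ^ n = A ^ n * (1 / real k) ^ (Suc (n - 1))"
        using n by (simp add: power_divide)
      thus ?thesis
        using False by simp
    qed (use n in \<open>auto simp: zero_power\<close>)
    have "(\<lambda>k. A ^ n * pi * (1 / real k) ^ (n - 1)) \<longlonglongrightarrow> A ^ n * pi * 0 ^ (n - 1)"
      by (intro tendsto_intros lim_1_over_n)
    thus "(\<lambda>k. (A / real k) ^ n * real k * \<bar>pi - 0\<bar>) \<longlonglongrightarrow> 0"
      unfolding eq using n by (simp add: zero_power)
  qed
  with lim have "(\<integral>x. g (of_real x) \<partial>lborel) = 0"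
    using LIMSEQ_unique by blast
  thus "integrable lborel (\<lambda>x. cauchy_transform f (Complex x \<epsilon>) ^ n)"
    and "(\<integral>x. cauchy_transform f (Complex x \<epsilon>) ^ n \<partial>lborel) = 0"
    using int by (simp_all add: g_def Sx)
qed

section \<open>Convolution operators of strong type\<close>

definition conv :: "('a::euclidean_space \<Rightarrow> real) \<Rightarrow> ('a \<Rightarrow> real) \<Rightarrow> 'a \<Rightarrow> real" where
  "conv k f x = (\<integral>y. k y * f (x - y) \<partial>lborel)"

text \<open>The constant \<open>W\<close> bounds the \<open>q\<close>-th power of the operator norm on \<open>L\<^sub>q\<close>, so that no roots are
needed. The test functions keep all integrals finite; \<open>strong_type_extend\<close> removes this
restriction.\<close>

definition strong_type :: "('a::euclidean_space \<Rightarrow> real) \<Rightarrow> real \<Rightarrow> real \<Rightarrow> bool" where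
  "strong_type k q W \<longleftrightarrow> (\<forall>f. test_fun f \<longrightarrow>
     (\<integral>\<^sup>+x. ennreal (\<bar>conv k f x\<bar> powr q) \<partial>lborel) \<le> ennreal W * (\<integral>\<^sup>+x. ennreal (\<bar>f x\<bar> powr q) \<partial>lborel))"

lemma lborel_distr_reflect:
  "distr lborel borel (\<lambda>y. x - y) = (lborel :: 'a::euclidean_space measure)"
  by (subst (2) lborel_affine[of "-1" x]) (auto simp: density_1 one_ennreal_def[symmetric])

lemma integral_lborel_reflect:
  fixes g :: "'a::euclidean_space \<Rightarrow> 'b::{banach, second_countable_topology}"
  assumes [measurable]: "g \<in> borel_measurable borel"
  shows "(\<integral>y. g (x - y) \<partial>lborel) = (\<integral>y. g y \<partial>lborel)"
  by (subst (2) lborel_distr_reflect[of x, symmetric]) (simp add: integral_distr)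

lemma nn_integral_lborel_reflect:
  fixes g :: "'a::euclidean_space \<Rightarrow> ennreal"
  assumes [measurable]: "g \<in> borel_measurable borel"
  shows "(\<integral>\<^sup>+y. g (x - y) \<partial>lborel) = (\<integral>\<^sup>+y. g y \<partial>lborel)"
  by (subst (2) lborel_distr_reflect[of x, symmetric]) (simp add: nn_integral_distr)

lemma integrable_lborel_reflect:
  fixes g :: "'a::euclidean_space \<Rightarrow> 'b::{banach, second_countable_topology}"
  assumes [measurable]: "g \<in> borel_measurable borel"
  shows "integrable lborel (\<lambda>y. g (x - y)) \<longleftrightarrow> integrable lborel g"
  by (subst (2) lborel_distr_reflect[of x, symmetric]) (simp add: integrable_distr_eq)

lemma conv_commute:
  assumes [measurable]: "k \<in> borel_measurable borel" "f \<in> borel_measurable borel"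
  shows "conv k f x = (\<integral>t. f t * k (x - t) \<partial>lborel)"
  unfolding conv_def
  by (subst integral_lborel_reflect[of "\<lambda>y. k y * f (x - y)" x, symmetric]) (simp_all add: mult.commute)

lemma borel_measurable_conv [measurable]:
  assumes [measurable]: "k \<in> borel_measurable borel" "f \<in> borel_measurable borel"
  shows "conv k f \<in> borel_measurable borel"
  unfolding conv_def[abs_def] by measurable

lemma nn_integral_le_of_tendsto:
  fixes s :: "nat \<Rightarrow> 'a \<Rightarrow> ennreal"
  assumes "\<And>i. s i \<in> borel_measurable M" "\<And>x. (\<lambda>i. s i x) \<longlonglongrightarrow> g x"
    and "\<And>i. (\<integral>\<^sup>+x. s i x \<partial>M) \<le> C"
  shows "(\<integral>\<^sup>+x. g x \<partial>M) \<le> C"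
proof -
  have "(\<integral>\<^sup>+x. g x \<partial>M) = (\<integral>\<^sup>+x. liminf (\<lambda>i. s i x) \<partial>M)"
    by (intro nn_integral_cong lim_imp_Liminf[symmetric] assms(2)) simp
  also have "\<dots> \<le> liminf (\<lambda>i. \<integral>\<^sup>+x. s i x \<partial>M)"
    by (rule nn_integral_liminf[OF assms(1)])
  also have "\<dots> \<le> liminf (\<lambda>_::nat. C)"
    using assms(3) by (intro Liminf_mono) auto
  also have "\<dots> = C"
    by (simp add: Liminf_const)
  finally show ?thesis .
qed

section \<open>Bounds for even exponents in dimension one\<close>

definition poisson_kernel :: "real \<Rightarrow> real \<Rightarrow> real" where
  "poisson_kernel \<epsilon> x = \<epsilon> / (pi * (x\<^sup>2 + \<epsilon>\<^sup>2))"

definition conj_poisson_kernel :: "real \<Rightarrow> real \<Rightarrow> real" where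
  "conj_poisson_kernel \<epsilon> x = x / (pi * (x\<^sup>2 + \<epsilon>\<^sup>2))"

lemma borel_measurable_poisson [measurable]:
  "poisson_kernel \<epsilon> \<in> borel_measurable borel" "conj_poisson_kernel \<epsilon> \<in> borel_measurable borel"
  unfolding poisson_kernel_def[abs_def] conj_poisson_kernel_def[abs_def] by measurable

lemma poisson_kernel_nonneg: "0 < \<epsilon> \<Longrightarrow> 0 \<le> poisson_kernel \<epsilon> x"
  by (simp add: poisson_kernel_def)

lemma poisson_kernel_le:
  assumes "0 < \<epsilon>" shows "\<bar>poisson_kernel \<epsilon> x\<bar> \<le> 1 / (pi * \<epsilon>)"
proof -
  have "\<epsilon> * (pi * \<epsilon>) \<le> 1 * (pi * (x\<^sup>2 + \<epsilon>\<^sup>2))"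
    by (simp add: power2_eq_square algebra_simps)
  thus ?thesis
    using assms by (simp add: poisson_kernel_def divide_simps abs_of_pos add_nonneg_pos)
qed

lemma nn_integral_poisson_kernel:
  assumes "0 < \<epsilon>"
  shows "(\<integral>\<^sup>+x. ennreal (poisson_kernel \<epsilon> (x - t)) \<partial>lborel) = 1"
proof -
  have "(\<integral>\<^sup>+x. ennreal (poisson_kernel \<epsilon> (x - t)) \<partial>lborel) = (\<integral>\<^sup>+x. ennreal (poisson_kernel \<epsilon> (t - x)) \<partial>lborel)"
    by (simp add: poisson_kernel_def power2_commute)
  also have "\<dots> = (\<integral>\<^sup>+x. ennreal (poisson_kernel \<epsilon> x) \<partial>lborel)"
    by (rule nn_integral_lborel_reflect) measurable
  also have "\<dots> = ennreal (\<integral>x. poisson_kernel \<epsilon> x \<partial>lborel)"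
    using poisson_kernel_integral(1)[OF assms] poisson_kernel_nonneg[OF assms]
    by (intro nn_integral_eq_integral) (auto simp: poisson_kernel_def[abs_def])
  finally show ?thesis
    using poisson_kernel_integral(2)[OF assms] by (simp add: poisson_kernel_def)
qed

lemma power_even_above_tangent:
  fixes a b :: real
  assumes "even n"
  shows "a ^ n + n * a ^ (n - 1) * (b - a) \<le> b ^ n"
proof -
  have "((\<lambda>x. x ^ n) has_real_derivative n * a ^ (n - 1)) (at a within UNIV)"
    by (auto intro!: derivative_eq_intros)
  from convex_on_imp_above_tangent[OF convex_power_even[OF assms] _ _ _ this, of b]
  show ?thesis
    by simp
qed

lemma integrable_test_fun_power:
  assumes "test_fun f" "0 < n"
  shows "integrable lborel (\<lambda>t. f t ^ n)"
proof -
  obtain B R where *: "0 < B" "0 < R" "\<And>x. \<bar>f x\<bar> \<le> B" "\<And>x. R < norm x \<Longrightarrow> f x = 0"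
    using assms(1) by (rule test_funE) blast
  show ?thesis
  proof (rule integrable_bounded_support)
    show "norm (f x ^ n) \<le> B ^ n" for x
      using * by (simp add: power_abs power_mono)
    show "f x ^ n = 0" if "R < norm x" for x
      using * that assms by simp
    show "(\<lambda>t. f t ^ n) \<in> borel_measurable borel"
      using assms by measurable
  qed
qed

text \<open>M. Riesz's theorem for the conjugate Poisson integral, uniformly in \<open>\<epsilon>\<close>: the pointwise
inequality is integrated along the line, where the term \<open>Re (u + iv)\<^sup>n\<close> vanishes, and the Poisson
integral \<open>u\<close> is an average of \<open>f\<close>, hence no larger than \<open>f\<close> in \<open>L\<^sub>n\<close>.\<close>

lemma conj_poisson_bound:
  assumes f: "test_fun f" and \<epsilon>: "0 < \<epsilon>" and n: "even n" "0 < n"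
  defines "v \<equiv> \<lambda>x. \<integral>t. f t * conj_poisson_kernel \<epsilon> (x - t) \<partial>lborel"
  shows "integrable lborel (\<lambda>x. v x ^ n)"
    and "(\<integral>x. v x ^ n \<partial>lborel) \<le> 4 * (3 * real n) ^ n * (\<integral>t. f t ^ n \<partial>lborel)"
proof -
  note [measurable] = test_fun_measurable[OF f]
  define u where "u x = (\<integral>t. f t * poisson_kernel \<epsilon> (x - t) \<partial>lborel)" for x
  \<comment> \<open>the majorant of \<open>u\<^sup>n\<close> given by Jensen's inequality\<close>
  define U where "U x = (\<integral>t. poisson_kernel \<epsilon> (x - t) * f t ^ n \<partial>lborel)" for x
  have n2: "2 \<le> n"
    using n by (cases "n = 1") auto
  have [measurable]: "v \<in> borel_measurable borel" "u \<in> borel_measurable borel" "U \<in> borel_measurable borel"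
    unfolding v_def u_def U_def by measurable
  have intF: "integrable lborel (\<lambda>t. f t *\<^sub>R (\<i> / (complex_of_real pi * (Complex x \<epsilon> - complex_of_real t))))" for x
    using integrable_cauchy[OF f, of "Complex x \<epsilon>"] \<epsilon> by simp
  have parts: "\<i> / (complex_of_real pi * (Complex x \<epsilon> - complex_of_real t))
      = Complex (poisson_kernel \<epsilon> (x - t)) (conj_poisson_kernel \<epsilon> (x - t))" for x t
    using \<epsilon> by (simp add: complex_eq_iff poisson_kernel_def conj_poisson_kernel_def Re_divide Im_divide
        power2_eq_square add_nonneg_eq_0_iff divide_simps) (auto simp: algebra_simps)
  have F: "cauchy_transform f (Complex x \<epsilon>) = Complex (u x) (v x)" for x
  proof -
    have "Re (cauchy_transform f (Complex x \<epsilon>)) = u x" "Im (cauchy_transform f (Complex x \<epsilon>)) = v x"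
      unfolding cauchy_transform_def u_def v_def
      using integral_Re[OF intF[of x]] integral_Im[OF intF[of x]] by (simp_all add: parts)
    thus ?thesis
      by (simp add: complex_eq_iff)
  qed
  have intF': "integrable lborel (\<lambda>x. Re (cauchy_transform f (Complex x \<epsilon>) ^ n))"
    and F0: "(\<integral>x. Re (cauchy_transform f (Complex x \<epsilon>) ^ n) \<partial>lborel) = 0"
    using cauchy_transform_power[OF f \<epsilon> n2] by (simp_all add: integral_Re integrable_Re)
  have fn: "integrable lborel (\<lambda>t. f t ^ n)" and fn0: "0 \<le> f t ^ n" for t
    using integrable_test_fun_power[OF f n(2)] n by (auto intro: zero_le_even_power)
  have intP: "integrable lborel (\<lambda>t. poisson_kernel \<epsilon> (x - t))" for x
    using poisson_kernel_integral(1)[OF \<epsilon>] integrable_lborel_reflect[of "poisson_kernel \<epsilon>" x]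
    by (simp add: poisson_kernel_def[abs_def])
  have P1: "(\<integral>t. poisson_kernel \<epsilon> (x - t) \<partial>lborel) = 1" for x
    using poisson_kernel_integral(2)[OF \<epsilon>] integral_lborel_reflect[of "poisson_kernel \<epsilon>" x]
    by (simp add: poisson_kernel_def[abs_def])
  have intPf: "integrable lborel (\<lambda>t. poisson_kernel \<epsilon> (x - t) * f t)" for x
    using integrable_test_fun_mult[OF f, of "\<lambda>t. poisson_kernel \<epsilon> (x - t)"] poisson_kernel_le[OF \<epsilon>]
    by (auto simp: mult.commute)
  have intPfn: "integrable lborel (\<lambda>t. poisson_kernel \<epsilon> (x - t) * f t ^ n)" for x
  proof (rule Bochner_Integration.integrable_bound)
    show "integrable lborel (\<lambda>t. 1 / (pi * \<epsilon>) * f t ^ n)"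
      using fn by (rule integrable_mult_right)
    show "AE t in lborel. norm (poisson_kernel \<epsilon> (x - t) * f t ^ n) \<le> norm (1 / (pi * \<epsilon>) * f t ^ n)"
      unfolding real_norm_def abs_mult
      by (intro AE_I2 mult_right_mono order_trans[OF poisson_kernel_le[OF \<epsilon>] abs_ge_self]) auto
  qed measurable
  have jensen: "u x ^ n \<le> U x" for x
  proof -
    have "u x ^ n = (\<integral>t. poisson_kernel \<epsilon> (x - t) * u x ^ n
        + n * u x ^ (n - 1) * (poisson_kernel \<epsilon> (x - t) * f t - poisson_kernel \<epsilon> (x - t) * u x) \<partial>lborel)"
      using intP[of x] intPf[of x] P1[of x] by (simp add: u_def mult.commute)
    also have "\<dots> = (\<integral>t. poisson_kernel \<epsilon> (x - t) * (u x ^ n + n * u x ^ (n - 1) * (f t - u x)) \<partial>lborel)"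
      by (simp add: algebra_simps)
    also have "\<dots> \<le> U x"
      unfolding U_def
    proof (rule integral_mono[OF _ intPfn])
      have "integrable lborel (\<lambda>t. poisson_kernel \<epsilon> (x - t) * (u x ^ n - n * u x ^ (n - 1) * u x)
          + n * u x ^ (n - 1) * (poisson_kernel \<epsilon> (x - t) * f t))"
        using intP[of x] intPf[of x] by simp
      thus "integrable lborel (\<lambda>t. poisson_kernel \<epsilon> (x - t) * (u x ^ n + n * u x ^ (n - 1) * (f t - u x)))"
        by (simp add: algebra_simps)
      show "poisson_kernel \<epsilon> (x - t) * (u x ^ n + n * u x ^ (n - 1) * (f t - u x))
          \<le> poisson_kernel \<epsilon> (x - t) * f t ^ n" for t
        by (intro mult_left_mono power_even_above_tangent n poisson_kernel_nonneg \<epsilon>)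
    qed
    finally show ?thesis .
  qed
  have U0: "0 \<le> U x" for x
    unfolding U_def using fn0 poisson_kernel_nonneg[OF \<epsilon>] by (intro Bochner_Integration.integral_nonneg) auto
  have nnU: "(\<integral>\<^sup>+x. ennreal (U x) \<partial>lborel) = ennreal (\<integral>t. f t ^ n \<partial>lborel)"
  proof -
    have "(\<integral>\<^sup>+x. ennreal (U x) \<partial>lborel)
        = (\<integral>\<^sup>+x. \<integral>\<^sup>+t. ennreal (poisson_kernel \<epsilon> (x - t) * f t ^ n) \<partial>lborel \<partial>lborel)"
      unfolding U_def using fn0 poisson_kernel_nonneg[OF \<epsilon>] intPfn
      by (intro nn_integral_cong nn_integral_eq_integral[symmetric]) auto
    also have "\<dots> = (\<integral>\<^sup>+t. \<integral>\<^sup>+x. ennreal (poisson_kernel \<epsilon> (x - t) * f t ^ n) \<partial>lborel \<partial>lborel)"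
      by (rule lborel_pair.Fubini') measurable
    also have "\<dots> = (\<integral>\<^sup>+t. ennreal (f t ^ n) \<partial>lborel)"
    proof (rule nn_integral_cong)
      fix t
      have "(\<integral>\<^sup>+x. ennreal (poisson_kernel \<epsilon> (x - t) * f t ^ n) \<partial>lborel)
        = (\<integral>\<^sup>+x. ennreal (poisson_kernel \<epsilon> (x - t)) * ennreal (f t ^ n) \<partial>lborel)"
        using fn0 poisson_kernel_nonneg[OF \<epsilon>] by (simp add: ennreal_mult)
      also have "\<dots> = ennreal (f t ^ n)"
        by (subst nn_integral_multc) (simp_all add: nn_integral_poisson_kernel[OF \<epsilon>])
      finally show "(\<integral>\<^sup>+x. ennreal (poisson_kernel \<epsilon> (x - t) * f t ^ n) \<partial>lborel) = ennreal (f t ^ n)" .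
    qed
    also have "\<dots> = ennreal (\<integral>t. f t ^ n \<partial>lborel)"
      using fn fn0 by (intro nn_integral_eq_integral) auto
    finally show ?thesis .
  qed
  have intU: "integrable lborel U"
    using U0 nnU by (intro integrableI_nonneg) auto
  have intU': "(\<integral>x. U x \<partial>lborel) = (\<integral>t. f t ^ n \<partial>lborel)"
    using nnU U0 fn0 by (simp add: integral_eq_nn_integral)
  let ?R = "\<lambda>x. 4 * (3 * real n) ^ n * U x + 3 * ((- 1) ^ (n div 2) * Re (cauchy_transform f (Complex x \<epsilon>) ^ n))"
  have pt: "v x ^ n \<le> ?R x" for x
  proof -
    have "4 * (3 * real n) ^ n * u x ^ n \<le> 4 * (3 * real n) ^ n * U x"
      by (intro mult_left_mono jensen) auto
    thus ?thesis
      using riesz_pointwise_inequality[OF n, of "v x" "u x"] unfolding F by linarith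
  qed
  have intR: "integrable lborel ?R"
    using intU intF' by simp
  have v0: "0 \<le> v x ^ n" for x
    using n by (auto intro: zero_le_even_power)
  show int: "integrable lborel (\<lambda>x. v x ^ n)"
  proof (rule Bochner_Integration.integrable_bound[OF intR])
    show "AE x in lborel. norm (v x ^ n) \<le> norm (?R x)"
      using pt v0 by (intro AE_I2) (smt (verit) real_norm_def)
  qed measurable
  have "(\<integral>x. v x ^ n \<partial>lborel) \<le> (\<integral>x. ?R x \<partial>lborel)"
    by (intro integral_mono int intR pt)
  also have "\<dots> = 4 * (3 * real n) ^ n * (\<integral>t. f t ^ n \<partial>lborel)"
    using intU intF' F0 intU' by simp
  finally show "(\<integral>x. v x ^ n \<partial>lborel) \<le> 4 * (3 * real n) ^ n * (\<integral>t. f t ^ n \<partial>lborel)" .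
qed

text \<open>Convolution with this kernel restricts the Fourier transform to \<open>[-M, M]\<close>; the value at zero is
the one that makes the kernel continuous.\<close>

definition sinc_kernel :: "real \<Rightarrow> real \<Rightarrow> real" where
  "sinc_kernel M y = (if y = 0 then M / pi else sin (M * y) / (pi * y))"

lemma borel_measurable_sinc [measurable]: "sinc_kernel M \<in> borel_measurable borel"
  unfolding sinc_kernel_def[abs_def] by measurable

lemma sinc_kernel_even: "sinc_kernel M (- y) = sinc_kernel M y"
  by (simp add: sinc_kernel_def)

lemma sinc_kernel_le:
  assumes "0 < M"
  shows "\<bar>sinc_kernel M y\<bar> \<le> M / pi" "y \<noteq> 0 \<Longrightarrow> \<bar>sinc_kernel M y\<bar> \<le> 1 / \<bar>y\<bar>"
proof -
  have "\<bar>sin (M * y)\<bar> \<le> M * \<bar>y\<bar>"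
    using abs_sin_x_le_abs_x[of "M * y"] assms by (simp add: abs_mult)
  thus "\<bar>sinc_kernel M y\<bar> \<le> M / pi"
    using assms by (auto simp: sinc_kernel_def abs_mult divide_simps)
  assume "y \<noteq> 0"
  have "\<bar>sin (M * y)\<bar> \<le> 1 * 1" by simp
  also have "\<dots> \<le> 1 * pi"
    using pi_gt3 by simp
  finally show "\<bar>sinc_kernel M y\<bar> \<le> 1 / \<bar>y\<bar>"
    using \<open>y \<noteq> 0\<close> by (auto simp: sinc_kernel_def abs_mult divide_simps)
qed

text \<open>By the addition theorem for \<open>sin (M (x - t))\<close>, convolution of \<open>f\<close> with \<open>sin (M y)\<close> times the
conjugate Poisson kernel is a combination, with coefficients of modulus at most one, of the
conjugate Poisson integrals of \<open>f(t) cos (M t)\<close> and \<open>f(t) sin (M t)\<close>. Multiplication by \<open>sin (M y)\<close>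
removes the singularity that arises as \<open>\<epsilon>\<close> tends to zero, so the limit is the convolution with
the sinc kernel, and Fatou's lemma preserves the bound, which does not depend on \<open>M\<close>.\<close>

lemma strong_type_sinc_even:
  assumes M: "0 < M" and n: "even n" "0 < n"
  shows "strong_type (sinc_kernel M) (real n) ((18 * real n) ^ n)"
  unfolding strong_type_def
proof (intro allI impI)
  fix f :: "real \<Rightarrow> real" assume f: "test_fun f"
  note [measurable] = test_fun_measurable[OF f]
  define \<epsilon> where "\<epsilon> i = 1 / real (Suc i)" for i
  have \<epsilon>: "0 < \<epsilon> i" for i
    by (simp add: \<epsilon>_def)
  define fc where "fc = (\<lambda>t. f t * cos (M * t))"
  define fs where "fs = (\<lambda>t. f t * sin (M * t))"
  have fc: "test_fun fc" and fs: "test_fun fs"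
    unfolding fc_def fs_def by (rule test_fun_mult[OF f, of _ 1]; simp)+
  note [measurable] = test_fun_measurable[OF fc] test_fun_measurable[OF fs]
  define v where "v g i x = (\<integral>t. g t * conj_poisson_kernel (\<epsilon> i) (x - t) \<partial>lborel)" for g i x
  define w where "w i x = (\<integral>t. f t * (sin (M * (x - t)) * conj_poisson_kernel (\<epsilon> i) (x - t)) \<partial>lborel)" for i x
  have n2: "2 \<le> n"
    using n by (cases "n = 1") auto
  have even_pow: "\<bar>x\<bar> powr real n = x ^ n" for x :: real
    using n by (simp add: powr_realpow' power_even_abs)
  have fn: "integrable lborel (\<lambda>t. f t ^ n)" and fn0: "0 \<le> f t ^ n" for t
    using integrable_test_fun_power[OF f n(2)] n by (auto intro: zero_le_even_power)
  define J where "J = (\<integral>t. f t ^ n \<partial>lborel)"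
  have vJ: "integrable lborel (\<lambda>x. v g i x ^ n) \<and> (\<integral>x. v g i x ^ n \<partial>lborel) \<le> 4 * (3 * real n) ^ n * J"
    if g: "test_fun g" "\<And>t. \<bar>g t\<bar> \<le> \<bar>f t\<bar>" for g i
  proof -
    have "g t ^ n \<le> f t ^ n" for t
      using power_mono[OF g(2), of t n] n by (simp add: power_even_abs)
    hence "(\<integral>t. g t ^ n \<partial>lborel) \<le> J"
      unfolding J_def by (intro integral_mono integrable_test_fun_power g n f)
    hence "4 * (3 * real n) ^ n * (\<integral>t. g t ^ n \<partial>lborel) \<le> 4 * (3 * real n) ^ n * J"
      by (intro mult_left_mono) auto
    from order_trans[OF conj_poisson_bound(2)[OF g(1) \<epsilon>[of i] n] this] show ?thesis
      using conj_poisson_bound(1)[OF g(1) \<epsilon>[of i] n] unfolding v_def by blast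
  qed
  have le: "\<bar>fc t\<bar> \<le> \<bar>f t\<bar>" "\<bar>fs t\<bar> \<le> \<bar>f t\<bar>" for t
    by (auto simp: fc_def fs_def abs_mult intro!: mult_left_le)
  have kb: "\<bar>conj_poisson_kernel (\<epsilon> i) y\<bar> \<le> 1 / \<epsilon> i" for i y
  proof -
    have "0 \<le> (\<bar>y\<bar> - \<epsilon> i)\<^sup>2"
      by simp
    hence "2 * \<bar>y\<bar> * \<epsilon> i \<le> 1 * (y\<^sup>2 + (\<epsilon> i)\<^sup>2)"
      by (simp add: power2_eq_square algebra_simps)
    hence "\<bar>y\<bar> * \<epsilon> i \<le> 1 * (y\<^sup>2 + (\<epsilon> i)\<^sup>2)"
      using \<epsilon>[of i] mult_nonneg_nonneg[of "\<bar>y\<bar>" "\<epsilon> i"] by linarith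
    also have "\<dots> \<le> pi * (y\<^sup>2 + (\<epsilon> i)\<^sup>2)"
      using pi_gt3 by (intro mult_right_mono) auto
    finally show ?thesis
      using \<epsilon>[of i] by (simp add: conj_poisson_kernel_def abs_mult abs_of_pos add_nonneg_pos divide_simps)
  qed
  have w: "w i x = sin (M * x) * v fc i x - cos (M * x) * v fs i x" for i x
  proof -
    have int: "integrable lborel (\<lambda>t. g t * conj_poisson_kernel (\<epsilon> i) (x - t))" if "test_fun g" for g
      using integrable_test_fun_mult[OF that, of "\<lambda>t. conj_poisson_kernel (\<epsilon> i) (x - t)"] kb by auto
    have "w i x = (\<integral>t. sin (M * x) * (fc t * conj_poisson_kernel (\<epsilon> i) (x - t))
        - cos (M * x) * (fs t * conj_poisson_kernel (\<epsilon> i) (x - t)) \<partial>lborel)"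
      unfolding w_def fc_def fs_def by (simp add: right_diff_distrib sin_diff algebra_simps)
    also have "\<dots> = sin (M * x) * v fc i x - cos (M * x) * v fs i x"
      using int[OF fc] int[OF fs] by (simp add: v_def)
    finally show ?thesis .
  qed
  have wn: "w i x ^ n \<le> 2 ^ n * (v fc i x ^ n + v fs i x ^ n)" for i x
  proof -
    let ?m = "max \<bar>v fc i x\<bar> \<bar>v fs i x\<bar>"
    have "\<bar>sin (M * x) * v fc i x\<bar> \<le> \<bar>v fc i x\<bar>" "\<bar>cos (M * x) * v fs i x\<bar> \<le> \<bar>v fs i x\<bar>"
      by (auto simp: abs_mult intro!: mult_left_le_one_le)
    hence "\<bar>w i x\<bar> \<le> 2 * ?m"
      unfolding w by linarith
    hence "\<bar>w i x\<bar> ^ n \<le> 2 ^ n * ?m ^ n"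
      by (metis power_mono power_mult_distrib abs_ge_zero)
    also have "?m ^ n \<le> \<bar>v fc i x\<bar> ^ n + \<bar>v fs i x\<bar> ^ n"
      by (simp add: max_def)
    finally show ?thesis
      using n by (simp add: power_even_abs)
  qed
  have J0: "0 \<le> J"
    unfolding J_def using fn0 by (intro Bochner_Integration.integral_nonneg) auto
  have bound: "(\<integral>\<^sup>+x. ennreal (\<bar>w i x\<bar> powr real n) \<partial>lborel) \<le> ennreal ((18 * real n) ^ n * J)" for i
  proof -
    have "(\<integral>\<^sup>+x. ennreal (\<bar>w i x\<bar> powr real n) \<partial>lborel)
        \<le> (\<integral>\<^sup>+x. ennreal (2 ^ n * (v fc i x ^ n + v fs i x ^ n)) \<partial>lborel)"
      unfolding even_pow by (intro nn_integral_mono ennreal_leI wn)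
    also have "\<dots> = ennreal (2 ^ n * ((\<integral>x. v fc i x ^ n \<partial>lborel) + (\<integral>x. v fs i x ^ n \<partial>lborel)))"
      using vJ[OF fc le(1)] vJ[OF fs le(2)] n
      by (subst nn_integral_eq_integral) (auto intro!: add_nonneg_nonneg zero_le_even_power)
    also have "\<dots> \<le> ennreal ((18 * real n) ^ n * J)"
    proof (rule ennreal_leI)
      have "6 * real n = 2 * (3 * real n)" "18 * real n = 3 * (6 * real n)"
        by simp_all
      hence pw: "(6 * real n) ^ n = 2 ^ n * (3 * real n) ^ n" "(18 * real n) ^ n = 3 ^ n * (6 * real n) ^ n"
        by (metis power_mult_distrib)+
      have "(8::real) \<le> 3 ^ 2" by simp
      also have "\<dots> \<le> 3 ^ n"
        using n2 by (intro power_increasing) auto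
      finally have "8 * ((6 * real n) ^ n * J) \<le> 3 ^ n * ((6 * real n) ^ n * J)"
        using J0 by (intro mult_right_mono) auto
      moreover have "2 ^ n * ((\<integral>x. v fc i x ^ n \<partial>lborel) + (\<integral>x. v fs i x ^ n \<partial>lborel))
          \<le> 2 ^ n * (4 * (3 * real n) ^ n * J + 4 * (3 * real n) ^ n * J)"
        using vJ[OF fc le(1)] vJ[OF fs le(2)] by (intro mult_left_mono add_mono) auto
      moreover have "2 ^ n * (4 * (3 * real n) ^ n * J + 4 * (3 * real n) ^ n * J) = 8 * ((6 * real n) ^ n * J)"
        unfolding pw by simp
      moreover have "3 ^ n * ((6 * real n) ^ n * J) = (18 * real n) ^ n * J"
        unfolding pw by simp
      ultimately show "2 ^ n * ((\<integral>x. v fc i x ^ n \<partial>lborel) + (\<integral>x. v fs i x ^ n \<partial>lborel)) \<le> (18 * real n) ^ n * J"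
        by linarith
    qed
    finally show ?thesis .
  qed
  have \<epsilon>0: "\<epsilon> \<longlonglongrightarrow> 0"
    unfolding \<epsilon>_def using LIMSEQ_inverse_real_of_nat by (simp add: inverse_eq_divide)
  have lim: "(\<lambda>i. w i x) \<longlonglongrightarrow> conv (sinc_kernel M) f x" for x
    unfolding conv_commute[OF borel_measurable_sinc test_fun_measurable[OF f]] w_def
  proof (rule integral_dominated_convergence)
    show "integrable lborel (\<lambda>t. \<bar>f t\<bar> * M)"
      using integrable_test_fun_mult[OF f, of "\<lambda>_. 1::real" 1] by auto
    show "AE t in lborel. norm (f t * (sin (M * (x - t)) * conj_poisson_kernel (\<epsilon> i) (x - t))) \<le> \<bar>f t\<bar> * M" for i
    proof (rule AE_I2)
      fix t
      have "\<bar>sin (M * (x - t)) * conj_poisson_kernel (\<epsilon> i) (x - t)\<bar>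
          \<le> (M * \<bar>x - t\<bar>) * (\<bar>x - t\<bar> / (pi * ((x - t)\<^sup>2 + (\<epsilon> i)\<^sup>2)))"
        unfolding abs_mult
        using abs_sin_x_le_abs_x[of "M * (x - t)"] M
        by (intro mult_mono) (auto simp: conj_poisson_kernel_def abs_mult abs_of_nonneg)
      also have "\<dots> = M * ((x - t)\<^sup>2 / ((x - t)\<^sup>2 + (\<epsilon> i)\<^sup>2)) / pi"
        by (simp add: power2_eq_square mult_ac)
      also have "\<dots> \<le> M * 1 / 1"
        using M pi_gt3 \<epsilon>[of i] by (intro frac_le mult_left_mono) (auto simp: divide_le_eq_1 add_nonneg_pos)
      finally show "norm (f t * (sin (M * (x - t)) * conj_poisson_kernel (\<epsilon> i) (x - t))) \<le> \<bar>f t\<bar> * M"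
        by (auto simp: abs_mult intro: mult_left_mono)
    qed
    have "AE t in lborel. t \<noteq> x"
      by (rule AE_lborel_singleton)
    thus "AE t in lborel. (\<lambda>i. f t * (sin (M * (x - t)) * conj_poisson_kernel (\<epsilon> i) (x - t)))
        \<longlonglongrightarrow> f t * sinc_kernel M (x - t)"
    proof eventually_elim
      case (elim t)
      have "(\<lambda>i. f t * (sin (M * (x - t)) * ((x - t) / (pi * ((x - t)\<^sup>2 + (\<epsilon> i)\<^sup>2)))))
          \<longlonglongrightarrow> f t * (sin (M * (x - t)) * ((x - t) / (pi * ((x - t)\<^sup>2 + 0\<^sup>2))))"
        using elim by (intro tendsto_intros \<epsilon>0) auto
      thus ?case
        using elim by (simp add: conj_poisson_kernel_def sinc_kernel_def power2_eq_square)
    qed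
  qed measurable
  have [measurable]: "w i \<in> borel_measurable borel" for i
    unfolding w_def by measurable
  have "(\<integral>\<^sup>+x. ennreal (\<bar>conv (sinc_kernel M) f x\<bar> powr real n) \<partial>lborel) \<le> ennreal ((18 * real n) ^ n * J)"
  proof (rule nn_integral_le_of_tendsto[where s = "\<lambda>i x. ennreal (\<bar>w i x\<bar> powr real n)"])
    show "(\<lambda>i. ennreal (\<bar>w i x\<bar> powr real n)) \<longlonglongrightarrow> ennreal (\<bar>conv (sinc_kernel M) f x\<bar> powr real n)" for x
      unfolding even_pow by (intro tendsto_ennrealI tendsto_power lim)
  qed (use bound in auto)
  also have "\<dots> = ennreal ((18 * real n) ^ n) * (\<integral>\<^sup>+x. ennreal (\<bar>f x\<bar> powr real n) \<partial>lborel)"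
    unfolding even_pow using fn fn0 J0 by (simp add: nn_integral_eq_integral J_def ennreal_mult)
  finally show "(\<integral>\<^sup>+x. ennreal (\<bar>conv (sinc_kernel M) f x\<bar> powr real n) \<partial>lborel)
      \<le> ennreal ((18 * real n) ^ n) * (\<integral>\<^sup>+x. ennreal (\<bar>f x\<bar> powr real n) \<partial>lborel)" .
qed

section \<open>Extension to unbounded functions, and duality\<close>

text \<open>Truncate \<open>f\<close> in height and in support. The convolutions converge pointwise by dominated
convergence, and Fatou's lemma passes the bound to the limit.\<close>

lemma strong_type_extend:
  fixes k f :: "'a::euclidean_space \<Rightarrow> real"
  assumes st: "strong_type k q W" and q: "0 < q"
    and [measurable]: "k \<in> borel_measurable borel" "f \<in> borel_measurable borel"
    and int: "\<And>x. integrable lborel (\<lambda>y. k y * f (x - y))"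
  shows "(\<integral>\<^sup>+x. ennreal (\<bar>conv k f x\<bar> powr q) \<partial>lborel) \<le> ennreal W * (\<integral>\<^sup>+x. ennreal (\<bar>f x\<bar> powr q) \<partial>lborel)"
proof -
  define S where "S i = {x. \<bar>f x\<bar> \<le> real i \<and> norm x \<le> real i}" for i
  have [measurable]: "S i \<in> sets borel" for i
    unfolding S_def by measurable
  define s where "s i x = f x * indicat_real (S i) x" for i x
  have [measurable]: "s i \<in> borel_measurable borel" for i
    unfolding s_def by measurable
  have s_le: "\<bar>s i x\<bar> \<le> \<bar>f x\<bar>" for i x
    by (auto simp: s_def split: split_indicator)
  have s_eq: "s i x = f x" if "nat \<lceil>max \<bar>f x\<bar> (norm x)\<rceil> \<le> i" for i x
  proof -
    have "max \<bar>f x\<bar> (norm x) \<le> real i"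
      using that by linarith
    thus ?thesis
      by (simp add: s_def S_def)
  qed
  hence ev: "\<forall>\<^sub>F i in sequentially. s i x = f x" for x
    unfolding eventually_sequentially by blast
  have test: "test_fun (s i)" for i
    unfolding test_fun_def
    by (intro conjI exI[of _ "real i + 1"]) (auto simp: s_def S_def split: split_indicator)
  have bound: "(\<integral>\<^sup>+x. ennreal (\<bar>conv k (s i) x\<bar> powr q) \<partial>lborel)
      \<le> ennreal W * (\<integral>\<^sup>+x. ennreal (\<bar>f x\<bar> powr q) \<partial>lborel)" for i
  proof -
    have "(\<integral>\<^sup>+x. ennreal (\<bar>conv k (s i) x\<bar> powr q) \<partial>lborel)
      \<le> ennreal W * (\<integral>\<^sup>+x. ennreal (\<bar>s i x\<bar> powr q) \<partial>lborel)"
      using st test by (simp add: strong_type_def)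
    also have "\<dots> \<le> ennreal W * (\<integral>\<^sup>+x. ennreal (\<bar>f x\<bar> powr q) \<partial>lborel)"
      using q by (intro mult_left_mono nn_integral_mono ennreal_leI powr_mono2 s_le) auto
    finally show ?thesis .
  qed
  have lim: "(\<lambda>i. conv k (s i) x) \<longlonglongrightarrow> conv k f x" for x
    unfolding conv_def
  proof (rule integral_dominated_convergence)
    show "integrable lborel (\<lambda>y. \<bar>k y * f (x - y)\<bar>)"
      using int by (rule integrable_abs)
    show "AE y in lborel. (\<lambda>i. k y * s i (x - y)) \<longlonglongrightarrow> k y * f (x - y)"
      by (intro AE_I2 tendsto_mult tendsto_const tendsto_eventually ev)
    show "AE y in lborel. norm (k y * s i (x - y)) \<le> \<bar>k y * f (x - y)\<bar>" for i
      by (intro AE_I2) (auto simp: abs_mult intro!: mult_left_mono s_le)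
  qed measurable
  show ?thesis
  proof (rule nn_integral_le_of_tendsto[OF _ _ bound])
    show "(\<lambda>i. ennreal (\<bar>conv k (s i) x\<bar> powr q)) \<longlonglongrightarrow> ennreal (\<bar>conv k f x\<bar> powr q)" for x
      using q by (intro tendsto_ennrealI tendsto_powr' tendsto_rabs lim tendsto_const) auto
  qed measurable
qed

text \<open>Young's inequality in place of the one of Hoelder: only the convergence of the integral matters,
and no norm estimate.\<close>

lemma integrable_kernel_mult:
  fixes k :: "'a::euclidean_space \<Rightarrow> real" and f :: "'a \<Rightarrow> 'b::{banach, second_countable_topology}"
  assumes [measurable]: "k \<in> borel_measurable borel" "f \<in> borel_measurable borel"
    and pq: "1 < p" "1 < q" "1 / p + 1 / q = 1"
    and k: "(\<integral>\<^sup>+y. ennreal (\<bar>k y\<bar> powr p) \<partial>lborel) < \<infinity>"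
    and f: "(\<integral>\<^sup>+y. ennreal (norm (f y) powr q) \<partial>lborel) < \<infinity>"
  shows "integrable lborel (\<lambda>y. k y *\<^sub>R f (x - y))"
proof (rule Bochner_Integration.integrable_bound)
  have "integrable lborel (\<lambda>y. \<bar>k y\<bar> powr p)"
    using k by (intro integrableI_bounded) auto
  moreover have "integrable lborel (\<lambda>y. norm (f y) powr q)"
    using f by (intro integrableI_bounded) auto
  hence "integrable lborel (\<lambda>y. norm (f (x - y)) powr q)"
    by (subst integrable_lborel_reflect[of "\<lambda>y. norm (f y) powr q"]) auto
  ultimately show "integrable lborel (\<lambda>y. \<bar>k y\<bar> powr p / p + norm (f (x - y)) powr q / q)"
    by simp
  show "AE y in lborel. norm (k y *\<^sub>R f (x - y)) \<le> norm (\<bar>k y\<bar> powr p / p + norm (f (x - y)) powr q / q)"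
  proof (rule AE_I2)
    fix y
    have "norm (k y *\<^sub>R f (x - y)) = \<bar>k y\<bar> * norm (f (x - y))"
      by simp
    also have "\<dots> \<le> \<bar>k y\<bar> powr p / p + norm (f (x - y)) powr q / q"
      using pq by (intro Youngs_inequality) auto
    finally show "norm (k y *\<^sub>R f (x - y)) \<le> norm (\<bar>k y\<bar> powr p / p + norm (f (x - y)) powr q / q)"
      by simp
  qed
qed measurable

text \<open>For \<open>g = k * f\<close>, test \<open>g\<close> against \<open>\<phi> = sgn g \<bar>g\<bar>\<^bsup>r-1\<^esup>\<close>, cut off to a ball. As \<open>k\<close> is even, the convolution moves
over to \<open>\<phi>\<close>, and \<open>\<bar>\<phi>\<bar>\<^sup>q = \<bar>g\<bar>\<^sup>r\<close> on the ball. Young's inequality, weighted so that the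
bound on \<open>L\<^sub>q\<close> costs the factor \<open>1 / q\<close>, produces a multiple of \<open>\<integral> \<bar>f\<bar>\<^sup>r\<close> plus \<open>1 / q\<close> times the quantity
to be estimated. The cut-off makes that quantity finite, so that it can be absorbed.\<close>

lemma strong_type_dual:
  fixes k :: "'a::euclidean_space \<Rightarrow> real"
  assumes k [measurable]: "k \<in> borel_measurable borel"
    and kB: "\<And>y. \<bar>k y\<bar> \<le> B" and even: "\<And>y. k (- y) = k y"
    and st: "strong_type k q W" and W: "0 < W"
    and q: "1 < q" and r: "1 < r" and qr: "1 / q + 1 / r = 1"
  shows "strong_type k r (W powr (r / q))"
  unfolding strong_type_def
proof (intro allI impI)
  fix f :: "'a \<Rightarrow> real" assume f: "test_fun f"
  note [measurable] = test_fun_measurable[OF f]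
  have rq: "(r - 1) * q = r"
    using q r qr by (simp add: field_simps)
  define g where "g = conv k f"
  have [measurable]: "g \<in> borel_measurable borel"
    unfolding g_def by measurable
  define G where "G = (\<integral>t. \<bar>f t\<bar> * B \<partial>lborel)"
  have intf: "integrable lborel (\<lambda>t. \<bar>f t\<bar>)"
    using integrable_test_fun_mult[OF f, of "\<lambda>_. 1::real" 1] by auto
  have gG: "\<bar>g x\<bar> \<le> G" for x
    unfolding g_def G_def conv_commute[OF k test_fun_measurable[OF f]] real_norm_def[symmetric]
  proof (rule norm_integral_le)
    show "integrable lborel (\<lambda>t. f t * k (x - t))"
      using integrable_test_fun_mult[OF f, of "\<lambda>t. k (x - t)" B] kB by simp
    show "norm (f t * k (x - t)) \<le> norm (f t) * B" for t
      using kB by (auto simp: abs_mult intro: mult_left_mono)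
  qed (use intf in simp)
  have [measurable]: "cball (0::'a) c \<in> sets borel" for c
    by simp
  define A where "A m = (\<integral>x. \<bar>g x\<bar> powr r * indicator (cball 0 (real m)) x \<partial>lborel)" for m :: nat
  define F where "F = (\<integral>x. \<bar>f x\<bar> powr r \<partial>lborel)"
  have intg: "integrable lborel (\<lambda>x. \<bar>g x\<bar> powr r * indicator (cball 0 (real m)) x)" for m :: nat
  proof (rule integrable_bounded_support)
    show "norm (\<bar>g x\<bar> powr r * indicator (cball 0 (real m)) x) \<le> G powr r" for x
      using gG[of x] r by (auto intro!: powr_mono2 split: split_indicator)
    show "\<bar>g x\<bar> powr r * indicator (cball 0 (real m)) x = 0" if "real m < norm x" for x
      using that by simp
  qed measurable
  have intF: "integrable lborel (\<lambda>x. \<bar>f x\<bar> powr r)"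
  proof -
    obtain B' R where *: "0 < B'" "0 < R" "\<And>x. \<bar>f x\<bar> \<le> B'" "\<And>x. R < norm x \<Longrightarrow> f x = 0"
      using f by (rule test_funE) blast
    show ?thesis
      using * r by (intro integrable_bounded_support[where B = "B' powr r" and R = R]) (auto intro!: powr_mono2)
  qed
  have AF: "A m \<le> W powr (r / q) * F" for m
  proof -
    define \<phi> where "\<phi> x = sgn (g x) * \<bar>g x\<bar> powr (r - 1) * indicator (cball 0 (real m)) x" for x
    have [measurable]: "\<phi> \<in> borel_measurable borel"
      unfolding \<phi>_def by measurable
    have "\<bar>\<phi> x\<bar> \<le> G powr (r - 1) + 1" for x
    proof -
      have "\<bar>\<phi> x\<bar> \<le> \<bar>g x\<bar> powr (r - 1)"
        by (auto simp: \<phi>_def abs_mult abs_sgn_eq split: split_indicator)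
      also have "\<dots> \<le> G powr (r - 1)"
        using gG[of x] r by (intro powr_mono2) auto
      finally show ?thesis by simp
    qed
    moreover have "\<phi> x = 0" if "real m + 1 < norm x" for x
      using that by (simp add: \<phi>_def)
    moreover have "0 < G powr (r - 1) + 1" "0 < real m + 1"
      by (auto intro: add_nonneg_pos)
    ultimately have "\<exists>B R. 0 < B \<and> 0 < R \<and> (\<forall>x. \<bar>\<phi> x\<bar> \<le> B) \<and> (\<forall>x. R < norm x \<longrightarrow> \<phi> x = 0)"
      by blast
    hence test: "test_fun \<phi>"
      by (simp add: test_fun_def)
    define h where "h = conv k \<phi>"
    have [measurable]: "h \<in> borel_measurable borel"
      unfolding h_def by measurable
    have \<phi>q: "\<bar>\<phi> x\<bar> powr q = \<bar>g x\<bar> powr r * indicator (cball 0 (real m)) x" for x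
      using rq q by (auto simp: \<phi>_def abs_mult abs_sgn_eq powr_powr split: split_indicator)
    have g\<phi>: "\<phi> x * g x = \<bar>g x\<bar> powr r * indicator (cball 0 (real m)) x" for x
    proof -
      have "\<bar>g x\<bar> powr (r - 1) * \<bar>g x\<bar> = \<bar>g x\<bar> powr r"
        using r powr_add[of "\<bar>g x\<bar>" "r - 1" 1] by simp
      thus ?thesis
        by (auto simp: \<phi>_def sgn_if split: split_indicator)
    qed
    have A_nn: "(\<integral>\<^sup>+x. ennreal (\<bar>\<phi> x\<bar> powr q) \<partial>lborel) = ennreal (A m)"
      unfolding \<phi>q A_def by (intro nn_integral_eq_integral intg) auto
    have A0: "0 \<le> A m"
      unfolding A_def by (intro Bochner_Integration.integral_nonneg) auto
    have hW: "(\<integral>\<^sup>+x. ennreal (\<bar>h x\<bar> powr q) \<partial>lborel) \<le> ennreal (W * A m)"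
      using st[unfolded strong_type_def, rule_format, OF test] W A0
      unfolding h_def A_nn by (simp add: ennreal_mult)
    have inth: "integrable lborel (\<lambda>x. \<bar>h x\<bar> powr q)"
      by (intro integrableI_bounded) (use order_le_less_trans[OF hW] in auto)
    have hW': "(\<integral>x. \<bar>h x\<bar> powr q \<partial>lborel) \<le> W * A m"
      using hW W A0 inth by (simp add: nn_integral_eq_integral)
    have swap: "A m = (\<integral>t. f t * h t \<partial>lborel)"
    proof -
      have intp: "integrable (lborel \<Otimes>\<^sub>M lborel) (\<lambda>(x, t). \<phi> x * (f t * k (x - t)))"
        unfolding lborel_prod
      proof -
        obtain B1 R1 where 1: "0 < B1" "0 < R1" "\<And>x. \<bar>f x\<bar> \<le> B1" "\<And>x. R1 < norm x \<Longrightarrow> f x = 0"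
          using f by (rule test_funE) blast
        obtain B2 R2 where 2: "0 < B2" "0 < R2" "\<And>x. \<bar>\<phi> x\<bar> \<le> B2" "\<And>x. R2 < norm x \<Longrightarrow> \<phi> x = 0"
          using test by (rule test_funE) blast
        show "integrable lborel (\<lambda>(x, t). \<phi> x * (f t * k (x - t)))"
        proof (rule integrable_bounded_support)
          have "(\<lambda>(x, t). \<phi> x * (f t * k (x - t))) \<in> borel_measurable (borel \<Otimes>\<^sub>M borel)"
            by measurable
          thus "(\<lambda>(x, t). \<phi> x * (f t * k (x - t))) \<in> borel_measurable borel"
            by (simp add: borel_prod)
          show "norm (case z of (x, t) \<Rightarrow> \<phi> x * (f t * k (x - t))) \<le> B2 * (B1 * B)" for z
            using 1 2 kB by (auto simp: abs_mult split: prod.splits intro!: mult_mono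
              order_trans[OF abs_ge_zero kB])
          show "(case z of (x, t) \<Rightarrow> \<phi> x * (f t * k (x - t))) = 0" if "R2 + R1 < norm z" for z
          proof -
            obtain x t where z: "z = (x, t)" by force
            have "R2 < norm x \<or> R1 < norm t"
              using that norm_Pair_le[of x t] z by force
            thus ?thesis
              using 1 2 z by auto
          qed
        qed
      qed
      have "A m = (\<integral>x. \<phi> x * g x \<partial>lborel)"
        unfolding g\<phi> A_def ..
      also have "\<dots> = (\<integral>x. \<integral>t. \<phi> x * (f t * k (x - t)) \<partial>lborel \<partial>lborel)"
        unfolding g_def conv_commute[OF k test_fun_measurable[OF f]] by simp
      also have "\<dots> = (\<integral>t. \<integral>x. \<phi> x * (f t * k (x - t)) \<partial>lborel \<partial>lborel)"
        using lborel_pair.Fubini_integral[OF intp] by simp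
      also have "\<dots> = (\<integral>t. \<integral>x. f t * (\<phi> x * k (t - x)) \<partial>lborel \<partial>lborel)"
        by (subst even[symmetric]) (simp add: mult_ac)
      also have "\<dots> = (\<integral>t. f t * h t \<partial>lborel)"
        unfolding h_def conv_commute[OF k test_fun_measurable[OF test]] by simp
      finally show ?thesis .
    qed
    \<comment> \<open>with this weight the factor \<open>W\<close> in the bound for \<open>h\<close> cancels\<close>
    define lam where "lam = W powr (1 / q)"
    have lam: "0 < lam" "lam powr q = W" "lam powr r = W powr (r / q)"
      using W q by (auto simp: lam_def powr_powr)
    have pt: "f t * h t \<le> W powr (r / q) / r * \<bar>f t\<bar> powr r + 1 / (q * W) * \<bar>h t\<bar> powr q" for t
    proof -
      have "f t * h t \<le> (lam * \<bar>f t\<bar>) * (\<bar>h t\<bar> / lam)"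
        using lam abs_ge_self[of "f t * h t"] by (simp add: abs_mult)
      also have "\<dots> \<le> (lam * \<bar>f t\<bar>) powr r / r + (\<bar>h t\<bar> / lam) powr q / q"
        using q r qr lam by (intro Youngs_inequality) auto
      also have "\<dots> = W powr (r / q) / r * \<bar>f t\<bar> powr r + 1 / (q * W) * \<bar>h t\<bar> powr q"
        using lam by (simp add: powr_mult powr_divide)
      finally show ?thesis .
    qed
    have "A m \<le> (\<integral>t. W powr (r / q) / r * \<bar>f t\<bar> powr r + 1 / (q * W) * \<bar>h t\<bar> powr q \<partial>lborel)"
      unfolding swap
    proof (rule integral_mono[OF _ _ pt])
      have hB: "norm (h t) \<le> (\<integral>x. norm (\<phi> x) * B \<partial>lborel)" for t
        unfolding h_def conv_commute[OF k test_fun_measurable[OF test]]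
      proof (rule norm_integral_le)
        show "integrable lborel (\<lambda>s. \<phi> s * k (t - s))"
          using integrable_test_fun_mult[OF test, of "\<lambda>s. k (t - s)" B] kB by simp
        show "integrable lborel (\<lambda>x. norm (\<phi> x) * B)"
          using integrable_test_fun_mult[OF test, of "\<lambda>_. 1::real" 1] by auto
        show "norm (\<phi> s * k (t - s)) \<le> norm (\<phi> s) * B" for s
          using kB by (auto simp: abs_mult intro: mult_left_mono)
      qed
      show "integrable lborel (\<lambda>t. f t * h t)"
        using integrable_test_fun_mult[OF f _ hB] by simp
    qed (use intF inth in auto)
    also have "\<dots> = W powr (r / q) / r * F + 1 / (q * W) * (\<integral>t. \<bar>h t\<bar> powr q \<partial>lborel)"
      using intF inth by (simp add: F_def)
    also have "\<dots> \<le> W powr (r / q) / r * F + 1 / (q * W) * (W * A m)"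
      using hW' q W by (intro add_left_mono mult_left_mono) auto
    also have "\<dots> = W powr (r / q) / r * F + A m / q"
      using W by simp
    finally have "A m * (1 - 1 / q) \<le> W powr (r / q) * F / r"
      by (simp add: algebra_simps)
    moreover have "1 - 1 / q = 1 / r"
      using qr by simp
    ultimately show ?thesis
      using r by (simp add: divide_le_cancel)
  qed
  have F0: "0 \<le> F"
    unfolding F_def by (intro Bochner_Integration.integral_nonneg) auto
  have "(\<integral>\<^sup>+x. ennreal (\<bar>g x\<bar> powr r) \<partial>lborel) \<le> ennreal (W powr (r / q) * F)"
  proof (rule nn_integral_le_of_tendsto[where
        s = "\<lambda>i x. ennreal (\<bar>g x\<bar> powr r * indicator (cball 0 (real i)) x)"])
    fix i :: nat
    show "(\<integral>\<^sup>+x. ennreal (\<bar>g x\<bar> powr r * indicator (cball 0 (real i)) x) \<partial>lborel) \<le> ennreal (W powr (r / q) * F)"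
      using AF[of i] intg[of i] by (subst nn_integral_eq_integral) (auto simp: A_def intro: ennreal_leI)
  next
    fix x :: 'a
    have "\<bar>g x\<bar> powr r * indicator (cball 0 (real i)) x = \<bar>g x\<bar> powr r" if "nat \<lceil>norm x\<rceil> \<le> i" for i
      using that by (auto split: split_indicator)
    thus "(\<lambda>i. ennreal (\<bar>g x\<bar> powr r * indicator (cball 0 (real i)) x)) \<longlonglongrightarrow> ennreal (\<bar>g x\<bar> powr r)"
      by (intro tendsto_eventually eventually_sequentiallyI[of "nat \<lceil>norm x\<rceil>"]) simp
  qed measurable
  also have "\<dots> = ennreal (W powr (r / q)) * (\<integral>\<^sup>+x. ennreal (\<bar>f x\<bar> powr r) \<partial>lborel)"
    using intF F0 W by (simp add: nn_integral_eq_integral F_def ennreal_mult)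
  finally show "(\<integral>\<^sup>+x. ennreal (\<bar>conv k f x\<bar> powr r) \<partial>lborel)
      \<le> ennreal (W powr (r / q)) * (\<integral>\<^sup>+x. ennreal (\<bar>f x\<bar> powr r) \<partial>lborel)"
    by (simp add: g_def)
qed

section \<open>The sinc kernel on all measurable functions\<close>

lemma nn_integral_sinc_powr:
  assumes M: "0 < M" and s: "1 < s"
  shows "(\<integral>\<^sup>+y. ennreal (\<bar>sinc_kernel M y\<bar> powr s) \<partial>lborel) < \<infinity>"
proof -
  define T where "T = (\<lambda>y::real. ennreal (y powr (- s)) * indicator {1..} y)"
  have [measurable]: "T \<in> borel_measurable borel"
    unfolding T_def by measurable
  have T: "(\<integral>\<^sup>+y. T y \<partial>lborel) = ennreal (0 - 1 powr (1 - s) / (1 - s))"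
    unfolding T_def
  proof (rule nn_integral_FTC_atLeast[where F = "\<lambda>y. y powr (1 - s) / (1 - s)"])
    show "((\<lambda>y. y powr (1 - s) / (1 - s)) has_real_derivative x powr (- s)) (at x)" if "1 \<le> x" for x
      using that s by (auto intro!: derivative_eq_intros)
    have "((\<lambda>y. y powr (1 - s)) \<longlongrightarrow> 0) at_top"
      using s by (intro tendsto_neg_powr filterlim_ident) auto
    from tendsto_divide[OF this tendsto_const[of "1 - s"]] s
    show "((\<lambda>y. y powr (1 - s) / (1 - s)) \<longlongrightarrow> 0) at_top"
      by simp
  qed (use s in auto)
  have "(\<integral>\<^sup>+y. ennreal (\<bar>sinc_kernel M y\<bar> powr s) \<partial>lborel)
      \<le> (\<integral>\<^sup>+y. (ennreal ((M / pi) powr s) * indicator {-1..1} y + T y) + T (0 - y) \<partial>lborel)"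
  proof (rule nn_integral_mono)
    fix y :: real
    consider "y \<in> {-1..1}" | "1 < y" | "y < -1" by fastforce
    thus "ennreal (\<bar>sinc_kernel M y\<bar> powr s) \<le> (ennreal ((M / pi) powr s) * indicator {-1..1} y + T y) + T (0 - y)"
    proof cases
      case 1
      have "ennreal (\<bar>sinc_kernel M y\<bar> powr s) \<le> ennreal ((M / pi) powr s)"
        using sinc_kernel_le(1)[OF M] s by (intro ennreal_leI powr_mono2) auto
      also have "\<dots> \<le> (ennreal ((M / pi) powr s) * indicator {-1..1} y + T y) + T (0 - y)"
        using 1 by (simp add: add.assoc)
      finally show ?thesis .
    next
      case 2
      have "ennreal (\<bar>sinc_kernel M y\<bar> powr s) \<le> ennreal ((1 / \<bar>y\<bar>) powr s)"
        using sinc_kernel_le(2)[OF M, of y] s 2 by (intro ennreal_leI powr_mono2) auto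
      also have "\<dots> = T y"
        by (subst powr_divide) (use 2 in \<open>auto simp: T_def powr_minus_divide\<close>)
      finally show ?thesis
        using 2 by (simp add: T_def)
    next
      case 3
      have "ennreal (\<bar>sinc_kernel M y\<bar> powr s) \<le> ennreal ((1 / \<bar>y\<bar>) powr s)"
        using sinc_kernel_le(2)[OF M, of y] s 3 by (intro ennreal_leI powr_mono2) auto
      also have "\<dots> = T (0 - y)"
        by (subst powr_divide) (use 3 in \<open>auto simp: T_def powr_minus_divide\<close>)
      finally show ?thesis
        using 3 by (simp add: T_def)
    qed
  qed
  also have "\<dots> = (ennreal ((M / pi) powr s) * emeasure lborel {-1..1::real} + (\<integral>\<^sup>+y. T y \<partial>lborel)) + (\<integral>\<^sup>+y. T y \<partial>lborel)"
    using nn_integral_lborel_reflect[of T 0]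
    by (simp add: nn_integral_add nn_integral_cmult_indicator)
  also have "\<dots> < \<infinity>"
    unfolding T by (simp add: ennreal_mult_less_top)
  finally show ?thesis .
qed

text \<open>The bound for arbitrary measurable \<open>f\<close> is what the iteration over coordinates requires, because
a convolution in one coordinate no longer has bounded support. If \<open>f\<close> lies in \<open>L\<^sub>q\<close>, the integrals
converge, because the kernel lies in the dual space.\<close>

lemma sinc_conv_bound:
  assumes M: "0 < M" and q: "1 < q" and W: "0 < W"
    and st: "strong_type (sinc_kernel M) q W" and [measurable]: "f \<in> borel_measurable borel"
  shows "(\<integral>\<^sup>+x. ennreal (\<bar>conv (sinc_kernel M) f x\<bar> powr q) \<partial>lborel)
    \<le> ennreal W * (\<integral>\<^sup>+x. ennreal (\<bar>f x\<bar> powr q) \<partial>lborel)"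
proof (cases "(\<integral>\<^sup>+x. ennreal (\<bar>f x\<bar> powr q) \<partial>lborel) = \<infinity>")
  case True
  thus ?thesis
    using W by (simp add: ennreal_mult_top)
next
  case False
  have "1 < q / (q - 1)" "1 / (q / (q - 1)) + 1 / q = 1"
    using q by (auto simp: field_simps)
  hence "integrable lborel (\<lambda>y. sinc_kernel M y *\<^sub>R f (x - y))" for x
    using False q nn_integral_sinc_powr[OF M, of "q / (q - 1)"]
    by (intro integrable_kernel_mult[of _ _ "q / (q - 1)" q]) (auto simp: top.not_eq_extremum)
  thus ?thesis
    using q by (intro strong_type_extend[OF st]) auto
qed

section \<open>Products of one-dimensional kernels\<close>

lemma borel_measurable_vec_lambda [measurable (raw)]:
  fixes f :: "'a \<Rightarrow> 'n::finite \<Rightarrow> real"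
  assumes "\<And>i. (\<lambda>x. f x i) \<in> borel_measurable M"
  shows "(\<lambda>x. \<chi> i. f x i) \<in> borel_measurable M"
proof (subst borel_measurable_euclidean_space, rule ballI)
  fix b :: "real ^ 'n" assume "b \<in> Basis"
  then obtain i where b: "b = axis i 1"
    by (auto simp: Basis_vec_def)
  show "(\<lambda>x. (\<chi> i. f x i) \<bullet> b) \<in> borel_measurable M"
    using assms[of i] by (simp add: b inner_axis)
qed

lemma borel_measurable_vec_nth [measurable]: "(\<lambda>x::real ^ 'n. x $ i) \<in> borel_measurable borel"
  by (intro borel_measurable_continuous_onI continuous_intros)

interpretation lborel_family: product_sigma_finite "\<lambda>_. lborel :: real measure"
  by standard

text \<open>Lebesgue measure on \<open>\<real>\<^sup>n\<close> in the form in which single coordinates can be integrated out.\<close>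

lemma lborel_vec_eq_distr:
  "(lborel :: (real ^ 'n) measure) = distr (\<Pi>\<^sub>M i\<in>UNIV. lborel) borel (\<lambda>g. \<chi> i. g i)" (is "_ = ?D")
proof (rule lborel_eqI)
  fix l u :: "real ^ 'n" assume le: "\<And>b. b \<in> Basis \<Longrightarrow> l \<bullet> b \<le> u \<bullet> b"
  have le': "l $ i \<le> u $ i" for i
    using le[of "axis i 1"] by (simp add: inner_axis)
  have "emeasure ?D (box l u) = emeasure (\<Pi>\<^sub>M i\<in>UNIV. lborel) (\<Pi>\<^sub>E i\<in>UNIV. {l $ i<..<u $ i})"
    by (subst emeasure_distr)
       (auto intro!: arg_cong2[where f = emeasure] simp: space_PiM PiE_def extensional_def Pi_def mem_box_cart)
  also have "\<dots> = (\<Prod>i\<in>UNIV. emeasure lborel {l $ i<..<u $ i})"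
    by (intro lborel_family.emeasure_PiM) auto
  also have "\<dots> = ennreal (\<Prod>i\<in>UNIV. u $ i - l $ i)"
    using le' by (simp add: prod_ennreal)
  also have "(\<Prod>i\<in>UNIV. u $ i - l $ i) = (\<Prod>b\<in>Basis. (u - l) \<bullet> b)"
  proof -
    have B: "(Basis :: (real ^ 'n) set) = (\<lambda>i. axis i 1) ` UNIV"
      by (auto simp: Basis_vec_def)
    have inj: "inj (\<lambda>i::'n. axis i (1::real))"
      by (auto simp: inj_on_def axis_eq_axis)
    show ?thesis
      unfolding B prod.reindex[OF inj] by (simp add: inner_axis)
  qed
  finally show "emeasure ?D (box l u) = ennreal (\<Prod>b\<in>Basis. (u - l) \<bullet> b)" .
qed simp

lemma nn_integral_lborel_vec:
  assumes [measurable]: "g \<in> borel_measurable (borel :: (real ^ 'n) measure)"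
  shows "(\<integral>\<^sup>+x. g x \<partial>lborel) = (\<integral>\<^sup>+w. g (\<chi> i. w i) \<partial>(\<Pi>\<^sub>M i\<in>UNIV. lborel))"
  by (subst lborel_vec_eq_distr, subst nn_integral_distr) auto

definition directional_conv :: "(real \<Rightarrow> real) \<Rightarrow> 'n \<Rightarrow> (real ^ 'n \<Rightarrow> real) \<Rightarrow> real ^ 'n \<Rightarrow> real" where
  "directional_conv k j g x = (\<integral>s. k s * g (x - axis j s) \<partial>lborel)"

lemma borel_measurable_axis [measurable]: "axis j \<in> borel_measurable (borel :: real measure)"
proof -
  have "(\<lambda>s::real. \<chi> i. if i = j then s else 0) \<in> borel_measurable borel"
    by measurable
  thus ?thesis
    by (simp add: axis_def[abs_def])
qed

lemma borel_measurable_directional_conv [measurable]: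
  assumes [measurable]: "k \<in> borel_measurable borel" "g \<in> borel_measurable borel"
  shows "directional_conv k j g \<in> borel_measurable borel"
  unfolding directional_conv_def[abs_def] by measurable

text \<open>On every line parallel to the \<open>j\<close>-th axis the operator is a one-dimensional convolution, so the
bound follows by integrating the one-dimensional bound over these lines.\<close>

lemma directional_conv_bound:
  fixes g :: "real ^ 'n \<Rightarrow> real"
  assumes [measurable]: "k \<in> borel_measurable borel" "g \<in> borel_measurable borel"
    and H: "\<And>\<phi>. \<phi> \<in> borel_measurable borel \<Longrightarrow>
      (\<integral>\<^sup>+t. ennreal (\<bar>conv k \<phi> t\<bar> powr q) \<partial>lborel) \<le> ennreal W * (\<integral>\<^sup>+t. ennreal (\<bar>\<phi> t\<bar> powr q) \<partial>lborel)"
  shows "(\<integral>\<^sup>+x. ennreal (\<bar>directional_conv k j g x\<bar> powr q) \<partial>lborel)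
    \<le> ennreal W * (\<integral>\<^sup>+x. ennreal (\<bar>g x\<bar> powr q) \<partial>lborel)"
proof -
  define V where "V w t = (\<chi> i. (w(j := t)) i)" for w :: "'n \<Rightarrow> real" and t :: real
  let ?I = "UNIV - {j}"
  have split: "(\<integral>\<^sup>+x. h x \<partial>lborel) = (\<integral>\<^sup>+w. \<integral>\<^sup>+t. h (V w t) \<partial>lborel \<partial>(\<Pi>\<^sub>M i\<in>?I. lborel))"
    if [measurable]: "h \<in> borel_measurable borel" for h :: "real ^ 'n \<Rightarrow> ennreal"
  proof -
    have "insert j ?I = UNIV"
      by auto
    thus ?thesis
      unfolding nn_integral_lborel_vec[OF that] V_def
      using lborel_family.product_nn_integral_insert[of ?I j "\<lambda>w. h (\<chi> i. w i)"]
      by (simp del: fun_upd_apply)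
  qed
  have [measurable]: "V w \<in> borel_measurable borel" for w
    unfolding V_def fun_upd_def by measurable
  have dir: "directional_conv k j g (V w t) = conv k (\<lambda>t. g (V w t)) t" for w t
  proof -
    have "V w t - axis j s = V w (t - s)" for s
      by (auto simp: V_def axis_def vec_eq_iff)
    thus ?thesis
      by (simp add: directional_conv_def conv_def)
  qed
  have meas: "(\<lambda>w. \<integral>\<^sup>+t. ennreal (\<bar>g (V w t)\<bar> powr q) \<partial>lborel) \<in> borel_measurable (\<Pi>\<^sub>M i\<in>?I. lborel)"
  proof -
    have "(\<lambda>(w, t). (if i = j then t else w i)) \<in> borel_measurable ((\<Pi>\<^sub>M i\<in>?I. lborel) \<Otimes>\<^sub>M lborel)" for i
      by (cases "i = j") (auto simp: split_beta')
    hence "(\<lambda>(w, t). V w t) \<in> borel_measurable ((\<Pi>\<^sub>M i\<in>?I. lborel) \<Otimes>\<^sub>M lborel)"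
      unfolding V_def fun_upd_def split_beta' by (intro borel_measurable_vec_lambda) (auto simp: split_beta')
    from measurable_compose[OF this assms(2)] show ?thesis
      by (intro lborel.borel_measurable_nn_integral) (simp add: split_beta')
  qed
  have "(\<integral>\<^sup>+x. ennreal (\<bar>directional_conv k j g x\<bar> powr q) \<partial>lborel)
      = (\<integral>\<^sup>+w. \<integral>\<^sup>+t. ennreal (\<bar>conv k (\<lambda>t. g (V w t)) t\<bar> powr q) \<partial>lborel \<partial>(\<Pi>\<^sub>M i\<in>?I. lborel))"
    by (subst split) (simp_all add: dir)
  also have "\<dots> \<le> (\<integral>\<^sup>+w. ennreal W * (\<integral>\<^sup>+t. ennreal (\<bar>g (V w t)\<bar> powr q) \<partial>lborel) \<partial>(\<Pi>\<^sub>M i\<in>?I. lborel))"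
    by (intro nn_integral_mono H) measurable
  also have "\<dots> = ennreal W * (\<integral>\<^sup>+w. \<integral>\<^sup>+t. ennreal (\<bar>g (V w t)\<bar> powr q) \<partial>lborel \<partial>(\<Pi>\<^sub>M i\<in>?I. lborel))"
    by (rule nn_integral_cmult[OF meas])
  also have "\<dots> = ennreal W * (\<integral>\<^sup>+x. ennreal (\<bar>g x\<bar> powr q) \<partial>lborel)"
    by (subst split) simp_all
  finally show ?thesis .
qed

text \<open>Convolution in the coordinates of \<open>J\<close> only, with the product kernel: it interpolates between the
identity and the convolution with the full product kernel, one coordinate at a time.\<close>

definition partial_conv :: "(real \<Rightarrow> real) \<Rightarrow> 'n set \<Rightarrow> (real ^ 'n \<Rightarrow> real) \<Rightarrow> real ^ 'n \<Rightarrow> real" where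
  "partial_conv k J f x =
     (\<integral>y. (\<Prod>i\<in>J. k (y i)) * f (x - (\<chi> i. if i \<in> J then y i else 0)) \<partial>(\<Pi>\<^sub>M i\<in>J. lborel))"

lemma borel_measurable_component_if:
  "(\<lambda>y. if i \<in> J then y i else 0) \<in> borel_measurable (\<Pi>\<^sub>M i\<in>J. (lborel :: real measure))"
  by (cases "i \<in> J") auto

lemma measurable_partial_conv_integrand:
  fixes f :: "real ^ 'n \<Rightarrow> real"
  assumes [measurable]: "k \<in> borel_measurable borel" "f \<in> borel_measurable borel"
  shows "(\<lambda>y. (\<Prod>i\<in>J. k (y i)) * f (x - (\<chi> i. if i \<in> J then y i else 0))) \<in> borel_measurable (\<Pi>\<^sub>M i\<in>J. lborel)"
proof -
  have [measurable]: "(\<lambda>y. \<chi> i. if i \<in> J then y i else 0) \<in> borel_measurable (\<Pi>\<^sub>M i\<in>J. (lborel :: real measure))"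
    by (intro borel_measurable_vec_lambda borel_measurable_component_if)
  show ?thesis
    by measurable
qed

lemma borel_measurable_partial_conv:
  fixes f :: "real ^ 'n \<Rightarrow> real"
  assumes [measurable]: "k \<in> borel_measurable borel" "f \<in> borel_measurable borel"
  shows "partial_conv k J f \<in> borel_measurable borel"
proof -
  interpret finite_product_sigma_finite "\<lambda>_. lborel :: real measure" J
    by standard simp
  have [measurable]: "(\<lambda>y. \<chi> i. if i \<in> J then y i else 0) \<in> borel_measurable (\<Pi>\<^sub>M i\<in>J. (lborel :: real measure))"
    by (intro borel_measurable_vec_lambda borel_measurable_component_if)
  show ?thesis
    unfolding partial_conv_def[abs_def] by (intro borel_measurable_lebesgue_integral) measurable
qed

lemma integrable_partial_conv:
  fixes f :: "real ^ 'n \<Rightarrow> real"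
  assumes k [measurable]: "k \<in> borel_measurable borel" and kB: "\<And>s. \<bar>k s\<bar> \<le> B" and f: "test_fun f"
  shows "integrable (\<Pi>\<^sub>M i\<in>J. lborel) (\<lambda>y. (\<Prod>i\<in>J. k (y i)) * f (x - (\<chi> i. if i \<in> J then y i else 0)))"
proof -
  note [measurable] = test_fun_measurable[OF f]
  obtain A R where *: "0 < A" "0 < R" "\<And>x. \<bar>f x\<bar> \<le> A" "\<And>x. R < norm x \<Longrightarrow> f x = 0"
    using f by (rule test_funE) blast
  define R' where "R' = R + norm x"
  define S where "S = (\<Pi>\<^sub>E i\<in>J. {-R'..R'})"
  have S: "S \<in> sets (\<Pi>\<^sub>M i\<in>J. lborel)"
    unfolding S_def by (intro sets_PiM_I_finite) auto
  have "emeasure (\<Pi>\<^sub>M i\<in>J. lborel) S = (\<Prod>i\<in>J. emeasure lborel {-R'..R'})"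
    unfolding S_def by (intro lborel_family.emeasure_PiM) auto
  also have "\<dots> < \<infinity>"
    by (simp add: power_less_top_ennreal emeasure_lborel_Icc_eq)
  finally have fin: "emeasure (\<Pi>\<^sub>M i\<in>J. lborel) S < \<infinity>" .
  show ?thesis
  proof (rule Bochner_Integration.integrable_bound)
    show "integrable (\<Pi>\<^sub>M i\<in>J. lborel) (\<lambda>y. B ^ card J * A * indicator S y)"
      using S fin by (intro integrable_mult_right integrable_real_indicator)
    show "AE y in \<Pi>\<^sub>M i\<in>J. lborel. norm ((\<Prod>i\<in>J. k (y i)) * f (x - (\<chi> i. if i \<in> J then y i else 0)))
        \<le> norm (B ^ card J * A * indicator S y)"
    proof (rule AE_I2)
      fix y assume y: "y \<in> space (\<Pi>\<^sub>M i\<in>J. (lborel :: real measure))"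
      have B0: "0 \<le> B"
        using order_trans[OF abs_ge_zero kB] .
      have kp: "\<bar>\<Prod>i\<in>J. k (y i)\<bar> \<le> B ^ card J"
        using prod_mono[of J "\<lambda>i. \<bar>k (y i)\<bar>" "\<lambda>_. B"] kB by (simp add: abs_prod)
      show "norm ((\<Prod>i\<in>J. k (y i)) * f (x - (\<chi> i. if i \<in> J then y i else 0)))
        \<le> norm (B ^ card J * A * indicator S y)"
      proof (cases "y \<in> S")
        case True
        thus ?thesis
          using kp * B0 by (auto simp: abs_mult intro!: mult_mono)
      next
        case False
        then obtain i where i: "i \<in> J" "R' < \<bar>y i\<bar>"
          using y by (auto simp: S_def space_PiM PiE_def Pi_def abs_le_iff not_le)
        let ?z = "x - (\<chi> i. if i \<in> J then y i else 0)"
        have "\<bar>?z $ i\<bar> \<le> norm ?z" "\<bar>x $ i\<bar> \<le> norm x"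
          by (rule component_le_norm_cart)+
        hence "R < norm ?z"
          using i by (simp add: R'_def)
        thus ?thesis
          using * by simp
      qed
    qed
  qed (rule measurable_partial_conv_integrand; measurable)
qed

lemma partial_conv_empty:
  fixes f :: "real ^ 'n \<Rightarrow> real"
  shows "partial_conv k {} f x = f x"
proof -
  have "(\<chi> i. 0) = (0 :: real ^ 'n)"
    by (simp add: vec_eq_iff)
  thus ?thesis
    unfolding partial_conv_def by (simp add: PiM_empty lebesgue_integral_count_space_finite)
qed

lemma partial_conv_insert:
  fixes f :: "real ^ 'n \<Rightarrow> real"
  assumes k [measurable]: "k \<in> borel_measurable borel" and kB: "\<And>s. \<bar>k s\<bar> \<le> B" and f: "test_fun f"
    and j: "j \<notin> J"
  shows "partial_conv k (insert j J) f x = directional_conv k j (partial_conv k J f) x"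
proof -
  note [measurable] = test_fun_measurable[OF f]
  have [measurable]: "partial_conv k J f \<in> borel_measurable borel"
    by (rule borel_measurable_partial_conv) measurable
  let ?F = "\<lambda>y. (\<Prod>i\<in>insert j J. k (y i)) * f (x - (\<chi> i. if i \<in> insert j J then y i else 0))"
  have "partial_conv k (insert j J) f x = (\<integral>y. ?F y \<partial>(\<Pi>\<^sub>M i\<in>{j} \<union> J. lborel))"
    by (simp add: partial_conv_def)
  also have "\<dots> = (\<integral>s. \<integral>y. ?F (merge {j} J (s, y)) \<partial>(\<Pi>\<^sub>M i\<in>J. lborel) \<partial>(\<Pi>\<^sub>M i\<in>{j}. lborel))"
    using j integrable_partial_conv[OF k kB f, of "insert j J" x]
    by (intro lborel_family.product_integral_fold) auto
  also have "\<dots> = (\<integral>s. k (s j) * partial_conv k J f (x - axis j (s j)) \<partial>(\<Pi>\<^sub>M i\<in>{j}. lborel))"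
  proof (rule Bochner_Integration.integral_cong[OF refl])
    fix s
    have "?F (merge {j} J (s, y)) = k (s j) * ((\<Prod>i\<in>J. k (y i))
        * f (x - axis j (s j) - (\<chi> i. if i \<in> J then y i else 0)))" for y
    proof -
      have "(\<Prod>i\<in>J. k (merge {j} J (s, y) i)) = (\<Prod>i\<in>J. k (y i))"
        using j by (intro prod.cong) (auto simp: merge_def)
      moreover have "(\<chi> i. if i \<in> insert j J then merge {j} J (s, y) i else 0)
          = axis j (s j) + (\<chi> i. if i \<in> J then y i else 0)"
        using j by (auto simp: vec_eq_iff axis_def merge_def)
      ultimately show ?thesis
        using j by (simp add: diff_diff_eq merge_def[of "{j}"])
    qed
    thus "(\<integral>y. ?F (merge {j} J (s, y)) \<partial>(\<Pi>\<^sub>M i\<in>J. lborel)) = k (s j) * partial_conv k J f (x - axis j (s j))"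
      by (simp add: partial_conv_def)
  qed
  also have "\<dots> = directional_conv k j (partial_conv k J f) x"
    unfolding directional_conv_def
    by (rule lborel_family.product_integral_singleton[where f = "\<lambda>s. k s * partial_conv k J f (x - axis j s)"]) measurable
  finally show ?thesis .
qed

lemma partial_conv_bound:
  fixes f :: "real ^ 'n \<Rightarrow> real"
  assumes k [measurable]: "k \<in> borel_measurable borel" and kB: "\<And>s. \<bar>k s\<bar> \<le> B" and f: "test_fun f"
    and W: "0 \<le> W"
    and H: "\<And>\<phi>. \<phi> \<in> borel_measurable borel \<Longrightarrow>
      (\<integral>\<^sup>+t. ennreal (\<bar>conv k \<phi> t\<bar> powr q) \<partial>lborel) \<le> ennreal W * (\<integral>\<^sup>+t. ennreal (\<bar>\<phi> t\<bar> powr q) \<partial>lborel)"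
  shows "(\<integral>\<^sup>+x. ennreal (\<bar>partial_conv k J f x\<bar> powr q) \<partial>lborel)
    \<le> ennreal (W ^ card J) * (\<integral>\<^sup>+x. ennreal (\<bar>f x\<bar> powr q) \<partial>lborel)"
  using finite[of J]
proof (induction J)
  case (insert j J)
  have "(\<integral>\<^sup>+x. ennreal (\<bar>partial_conv k (insert j J) f x\<bar> powr q) \<partial>lborel)
      \<le> ennreal W * (\<integral>\<^sup>+x. ennreal (\<bar>partial_conv k J f x\<bar> powr q) \<partial>lborel)"
    unfolding partial_conv_insert[OF k kB f insert.hyps(2)]
    using test_fun_measurable[OF f]
    by (intro directional_conv_bound borel_measurable_partial_conv k H)
  also have "\<dots> \<le> ennreal W * (ennreal (W ^ card J) * (\<integral>\<^sup>+x. ennreal (\<bar>f x\<bar> powr q) \<partial>lborel))"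
    by (intro mult_left_mono insert.IH) auto
  also have "\<dots> = ennreal (W ^ card (insert j J)) * (\<integral>\<^sup>+x. ennreal (\<bar>f x\<bar> powr q) \<partial>lborel)"
    using W insert.hyps by (simp add: ennreal_mult mult.assoc)
  finally show ?case .
qed (simp add: partial_conv_empty)

lemma dirichlet_kernel_eq_prod_sinc: "dirichlet_kernel M y = (\<Prod>j\<in>UNIV. sinc_kernel M (y $ j))"
  by (simp add: dirichlet_kernel_def sinc_kernel_def)

lemma borel_measurable_dirichlet [measurable]: "dirichlet_kernel M \<in> borel_measurable borel"
  unfolding dirichlet_kernel_eq_prod_sinc[abs_def] by measurable

lemma strong_type_dirichlet:
  assumes M: "0 < M" and q: "1 < q" and W: "0 < W" and st: "strong_type (sinc_kernel M) q W"
  shows "strong_type (dirichlet_kernel M :: real ^ 'n \<Rightarrow> real) q (W ^ CARD('n))"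
  unfolding strong_type_def
proof (intro allI impI)
  fix f :: "real ^ 'n \<Rightarrow> real" assume f: "test_fun f"
  note [measurable] = test_fun_measurable[OF f]
  have "conv (dirichlet_kernel M) f x = partial_conv (sinc_kernel M) UNIV f x" for x
    unfolding conv_def partial_conv_def
    by (subst lborel_vec_eq_distr, subst integral_distr) (simp_all add: dirichlet_kernel_eq_prod_sinc)
  thus "(\<integral>\<^sup>+x. ennreal (\<bar>conv (dirichlet_kernel M) f x\<bar> powr q) \<partial>lborel)
      \<le> ennreal (W ^ CARD('n)) * (\<integral>\<^sup>+x. ennreal (\<bar>f x\<bar> powr q) \<partial>lborel)"
    using partial_conv_bound[OF borel_measurable_sinc sinc_kernel_le(1)[OF M] f _ sinc_conv_bound[OF M q W st], where J = UNIV]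
      W by simp
qed

lemma nn_integral_dirichlet_powr:
  assumes M: "0 < M" and s: "1 < s"
  shows "(\<integral>\<^sup>+y. ennreal (\<bar>dirichlet_kernel M (y :: real ^ 'n)\<bar> powr s) \<partial>lborel) < \<infinity>"
proof -
  have "(\<integral>\<^sup>+y. ennreal (\<bar>dirichlet_kernel M (y :: real ^ 'n)\<bar> powr s) \<partial>lborel)
      = (\<integral>\<^sup>+w. (\<Prod>i\<in>UNIV. ennreal (\<bar>sinc_kernel M (w i)\<bar> powr s)) \<partial>(\<Pi>\<^sub>M (i::'n)\<in>UNIV. lborel))"
    by (subst nn_integral_lborel_vec)
       (simp_all add: dirichlet_kernel_eq_prod_sinc abs_prod prod_powr_distrib prod_ennreal)
  also have "\<dots> = (\<Prod>i\<in>(UNIV :: 'n set). \<integral>\<^sup>+y. ennreal (\<bar>sinc_kernel M y\<bar> powr s) \<partial>lborel)"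
    by (rule lborel_family.product_nn_integral_prod) auto
  also have "\<dots> < \<infinity>"
    using nn_integral_sinc_powr[OF M s] by (simp add: power_less_top_ennreal)
  finally show ?thesis .
qed

text \<open>The two families of exponents that are used later. Even exponents \<open>n\<close> come with a constant
\<open>(18 n)\<^bsup>n d\<^esup>\<close>, whose dependence on \<open>n\<close> is essential; their duals only have to reach down to \<open>1\<close>.\<close>

lemma strong_type_dirichlet_exponents:
  assumes M: "0 < M"
  shows "\<And>n. even n \<Longrightarrow> 0 < n \<Longrightarrow>
      strong_type (dirichlet_kernel M :: real ^ 'n \<Rightarrow> real) (real n) (((18 * real n) ^ n) ^ CARD('n))"
    and "\<And>n. even n \<Longrightarrow> 0 < n \<Longrightarrow>
      strong_type (dirichlet_kernel M :: real ^ 'n \<Rightarrow> real) (real n / (real n - 1))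
        ((((18 * real n) ^ n) powr (1 / (real n - 1))) ^ CARD('n))"
proof -
  fix n :: nat assume n: "even n" "0 < n"
  have n2: "1 < n"
    using n by (cases "n = 1") auto
  have W: "0 < (18 * real n) ^ n"
    using n by simp
  show "strong_type (dirichlet_kernel M :: real ^ 'n \<Rightarrow> real) (real n) (((18 * real n) ^ n) ^ CARD('n))"
    using n2 by (intro strong_type_dirichlet M strong_type_sinc_even n W) auto
  have *: "1 < real n" "1 < real n / (real n - 1)" "1 / real n + 1 / (real n / (real n - 1)) = 1"
    using n2 by (auto simp: field_simps)
  have "strong_type (sinc_kernel M) (real n / (real n - 1))
      (((18 * real n) ^ n) powr ((real n / (real n - 1)) / real n))"
    by (rule strong_type_dual[OF borel_measurable_sinc sinc_kernel_le(1)[OF M] sinc_kernel_even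
          strong_type_sinc_even[OF M n] W *])
  hence "strong_type (sinc_kernel M) (real n / (real n - 1)) (((18 * real n) ^ n) powr (1 / (real n - 1)))"
    using n by simp
  thus "strong_type (dirichlet_kernel M :: real ^ 'n \<Rightarrow> real) (real n / (real n - 1))
        ((((18 * real n) ^ n) powr (1 / (real n - 1))) ^ CARD('n))"
    using W * by (intro strong_type_dirichlet M) auto
qed

section \<open>The Young functions\<close>

text \<open>The Legendre transform of \<open>p ln (\<phi> p)\<close>, in the variable \<open>s = ln u\<close>: for \<open>u \<ge> e\<^sup>2\<close> it is the
logarithm of \<open>N[\<phi>](u)\<close>.\<close>

definition legendre :: "real \<Rightarrow> (real \<Rightarrow> real) \<Rightarrow> real \<Rightarrow> real" where
  "legendre a \<phi> s = (SUP p\<in>{a..}. p * s - p * ln (\<phi> p))"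

text \<open>The finiteness of the Legendre transform and the existence of large near-optimal exponents rest
on these properties, which pass from \<open>\<psi>\<close> to \<open>p\<^sup>d \<psi>(p)\<close>.\<close>

definition growth_fun :: "real \<Rightarrow> (real \<Rightarrow> real) \<Rightarrow> bool" where
  "growth_fun a \<phi> \<longleftrightarrow> 0 < a \<and> (\<forall>p\<ge>a. 0 < \<phi> p) \<and> mono_on {a..} \<phi> \<and> filterlim \<phi> at_top at_top"

lemma growth_fun_Psi_class: "Psi_class a \<psi> \<Longrightarrow> growth_fun a \<psi>"
  by (auto simp: Psi_class_def growth_fun_def strict_mono_on_imp_mono_on)

lemma growth_fun_psi_pow:
  assumes "Psi_class a \<psi>"
  shows "growth_fun a (psi_pow d \<psi>)"
  unfolding growth_fun_def
proof (intro conjI allI impI mono_onI)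
  have \<psi>: "0 < a" "\<And>p. a \<le> p \<Longrightarrow> 0 < \<psi> p" "mono_on {a..} \<psi>" "filterlim \<psi> at_top at_top"
    using growth_fun_Psi_class[OF assms] by (auto simp: growth_fun_def)
  show "0 < a" by fact
  show "0 < psi_pow d \<psi> p" if "a \<le> p" for p
    using \<psi> that by (auto simp: psi_pow_def)
  show "psi_pow d \<psi> p \<le> psi_pow d \<psi> q" if "p \<in> {a..}" "q \<in> {a..}" "p \<le> q" for p q
    unfolding psi_pow_def using that \<psi> by (intro mult_mono power_mono mono_onD[OF \<psi>(3)]) (auto intro: less_imp_le)
  show "filterlim (psi_pow d \<psi>) at_top at_top"
  proof (rule filterlim_at_top_mono[OF \<psi>(4)])
    show "\<forall>\<^sub>F p in at_top. \<psi> p \<le> psi_pow d \<psi> p"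
      using eventually_ge_at_top[of "max 1 a"]
    proof eventually_elim
      case (elim p)
      hence "1 * \<psi> p \<le> p ^ d * \<psi> p"
        using \<psi>(2)[of p] by (intro mult_right_mono one_le_power) auto
      thus ?case
        by (simp add: psi_pow_def)
    qed
  qed
qed

lemma bdd_above_legendre:
  assumes "growth_fun a \<phi>"
  shows "bdd_above ((\<lambda>p. p * s - p * ln (\<phi> p)) ` {a..})"
proof -
  have \<phi>: "0 < a" "\<And>p. a \<le> p \<Longrightarrow> 0 < \<phi> p" "mono_on {a..} \<phi>" "filterlim \<phi> at_top at_top"
    using assms by (auto simp: growth_fun_def)
  have "\<forall>\<^sub>F p in at_top. exp s \<le> \<phi> p"
    using \<phi>(4) by (simp add: filterlim_at_top)
  then obtain P where P: "\<And>p. P \<le> p \<Longrightarrow> exp s \<le> \<phi> p"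
    by (auto simp: eventually_at_top_linorder)
  have "p * s - p * ln (\<phi> p) \<le> max 0 (P * \<bar>s - ln (\<phi> a)\<bar>)" if p: "a \<le> p" for p
  proof (cases "P \<le> p")
    case True
    hence "s \<le> ln (\<phi> p)"
      using P[OF True] \<phi>(2)[OF p] by (simp add: ln_ge_iff)
    hence "p * s \<le> p * ln (\<phi> p)"
      using p \<phi>(1) by (intro mult_left_mono) auto
    thus ?thesis by simp
  next
    case False
    have "\<phi> a \<le> \<phi> p"
      using p by (intro mono_onD[OF \<phi>(3)]) auto
    hence "ln (\<phi> a) \<le> ln (\<phi> p)"
      using \<phi>(2)[of a] \<phi>(2)[OF p] by simp
    hence "p * (s - ln (\<phi> p)) \<le> p * \<bar>s - ln (\<phi> a)\<bar>"
      using p \<phi>(1) by (intro mult_left_mono) auto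
    also have "\<dots> \<le> P * \<bar>s - ln (\<phi> a)\<bar>"
      using False by (intro mult_right_mono) auto
    finally show ?thesis
      by (simp add: algebra_simps)
  qed
  thus ?thesis
    by (intro bdd_aboveI2) auto
qed

lemma le_legendre:
  assumes "growth_fun a \<phi>" "a \<le> p"
  shows "p * (s - ln (\<phi> p)) \<le> legendre a \<phi> s"
  unfolding legendre_def using assms
  by (intro cSUP_upper2[OF bdd_above_legendre[OF assms(1)], of p]) (auto simp: algebra_simps)

text \<open>For large \<open>s\<close> the supremum is nearly attained at exponents beyond any given \<open>P0\<close>: as a function
of \<open>s\<close>, each exponent below \<open>P = max P0 a\<close> contributes at most a line of slope \<open>P\<close>, and all these
are overtaken by the line of the single exponent \<open>P + 1\<close>.\<close>

lemma legendre_near_optimal: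
  assumes gf: "growth_fun a \<phi>"
  shows "\<exists>s0. \<forall>s\<ge>s0. \<exists>p\<ge>P0. a \<le> p \<and> legendre a \<phi> s \<le> p * (s - ln (\<phi> p)) + 1"
proof -
  have \<phi>: "0 < a" "\<And>p. a \<le> p \<Longrightarrow> 0 < \<phi> p" "mono_on {a..} \<phi>"
    using gf by (auto simp: growth_fun_def)
  define P where "P = max P0 a"
  define s0 where "s0 = max (ln (\<phi> a)) ((P + 1) * ln (\<phi> (P + 1)) - P * ln (\<phi> a))"
  have "\<exists>p\<ge>P0. a \<le> p \<and> legendre a \<phi> s \<le> p * (s - ln (\<phi> p)) + 1" if s: "s0 \<le> s" for s
  proof -
    have "legendre a \<phi> s - 1 < (SUP p\<in>{a..}. p * s - p * ln (\<phi> p))"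
      by (simp add: legendre_def)
    then obtain p where p: "a \<le> p" "legendre a \<phi> s - 1 < p * s - p * ln (\<phi> p)"
      using less_cSUP_iff[OF _ bdd_above_legendre[OF gf, of s]] by auto
    show ?thesis
    proof (cases "P0 \<le> p")
      case True
      thus ?thesis
        using p by (intro exI[of _ p]) (auto simp: algebra_simps)
    next
      case False
      have "\<phi> a \<le> \<phi> p"
        using p by (intro mono_onD[OF \<phi>(3)]) auto
      hence "ln (\<phi> a) \<le> ln (\<phi> p)"
        using \<phi>(2)[of a] \<phi>(2)[OF p(1)] by simp
      hence "p * (s - ln (\<phi> p)) \<le> p * (s - ln (\<phi> a))"
        using p \<phi>(1) by (intro mult_left_mono) auto
      also have "\<dots> \<le> P * (s - ln (\<phi> a))"
        using False s by (intro mult_right_mono) (auto simp: P_def s0_def)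
      also have "\<dots> \<le> (P + 1) * (s - ln (\<phi> (P + 1)))"
        using s by (simp add: s0_def algebra_simps)
      finally show ?thesis
        using p(2) by (intro exI[of _ "P + 1"]) (auto simp: P_def algebra_simps)
    qed
  qed
  thus ?thesis by blast
qed

lemma is_N_eq_exp_legendre:
  assumes "is_N a \<phi> N" "exp 2 \<le> u"
  shows "N u = exp (legendre a \<phi> (ln u))"
  using assms order_trans[OF exp_ge_zero assms(2)] by (auto simp: is_N_def legendre_def)

text \<open>For the later estimates it suffices that \<open>N'\<close> is a power near zero, agrees with \<open>N\<close> far out and
increases; on the middle range monotonicity gives bounds above and below.\<close>

lemma is_N_modE:
  assumes "is_N_mod \<alpha> N N'"
  obtains c1 c2 c5 where "0 < c1" "0 < c2" "c2 < c5" "\<And>u. 0 \<le> u \<Longrightarrow> u \<le> c2 \<Longrightarrow> N' u = c1 * u powr \<alpha>"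
    "\<And>u. c5 < u \<Longrightarrow> N' u = N u" "N' 0 = 0" "\<And>u v. 0 \<le> u \<Longrightarrow> u \<le> v \<Longrightarrow> N' u \<le> N' v"
    "\<And>u. 0 < u \<Longrightarrow> 0 < N' u"
proof -
  obtain c1 c2 c5 where c: "0 < c2" "c2 < c5"
      "\<And>u. \<bar>u\<bar> \<le> c2 \<Longrightarrow> N' u = c1 * \<bar>u\<bar> powr \<alpha>" "\<And>u. c5 < \<bar>u\<bar> \<Longrightarrow> N' u = N u"
    and sm: "strict_mono_on {0..} N'"
    using assms unfolding is_N_mod_def by blast
  have N0: "N' 0 = 0"
    using c(1) c(3)[of 0] by simp
  have pos: "0 < N' u" if "0 < u" for u
    using strict_mono_onD[OF sm, of 0 u] that N0 by simp
  have "0 < c1"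
    using pos[OF c(1)] c(1) c(3)[of c2] by (simp add: zero_less_mult_iff)
  moreover have "N' u \<le> N' v" if "0 \<le> u" "u \<le> v" for u v
    using mono_onD[OF strict_mono_on_imp_mono_on[OF sm], of u v] that by simp
  ultimately show ?thesis
    using that[of c1 c2 c5] c N0 pos by simp
qed

text \<open>\<open>N'\<close> dominates \<open>t\<^sup>\<alpha>\<close>, and all functions \<open>(t / \<phi>(p))\<^sup>p\<close> with \<open>p \<ge> \<alpha>\<close>, uniformly in \<open>p\<close>. For large \<open>t\<close> the
second is the definition of \<open>N\<close>. For \<open>t\<close> below the threshold \<open>T\<close> it follows by comparison with
\<open>t = T\<close>: since \<open>p \<ge> \<alpha>\<close>, one has \<open>(t / T)\<^sup>p \<le> (t / T)\<^sup>\<alpha>\<close>.\<close>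

lemma N_mod_lower:
  assumes gf: "growth_fun a \<phi>" and N: "is_N a \<phi> N" and N': "is_N_mod \<alpha> N N'" and \<alpha>: "0 < \<alpha>"
  shows "\<exists>C>0. \<forall>t>0. t powr \<alpha> \<le> C * N' t \<and>
    (\<forall>p. \<alpha> \<le> p \<longrightarrow> a \<le> p \<longrightarrow> exp (p * (ln t - ln (\<phi> p))) \<le> C * N' t)"
proof -
  obtain c1 c2 c5 where c: "0 < c1" "0 < c2" "c2 < c5" "\<And>u. 0 \<le> u \<Longrightarrow> u \<le> c2 \<Longrightarrow> N' u = c1 * u powr \<alpha>"
    "\<And>u. c5 < u \<Longrightarrow> N' u = N u" "N' 0 = 0" "\<And>u v. 0 \<le> u \<Longrightarrow> u \<le> v \<Longrightarrow> N' u \<le> N' v"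
    "\<And>u. 0 < u \<Longrightarrow> 0 < N' u"
    using N' by (rule is_N_modE) blast
  define T where "T = max (c5 + 1) (exp 2)"
  have T: "c5 < T" "exp 2 \<le> T" "1 \<le> T" "c2 < T"
    using c by (auto simp: T_def intro: order_trans[OF _ max.cobounded2])
  have big: "N' t = exp (legendre a \<phi> (ln t))" if "T \<le> t" for t
    using that T c(5)[of t] is_N_eq_exp_legendre[OF N, of t] by simp
  \<comment> \<open>for \<open>t \<ge> 1\<close> any exponent \<open>p0 \<ge> \<alpha>\<close> in the range of the supremum dominates \<open>t\<^sup>\<alpha>\<close>\<close>
  define p0 where "p0 = max \<alpha> a"
  define C where "C = 1 / c1 + T powr \<alpha> / N' c2 + exp (p0 * ln (\<phi> p0))"
  have C: "0 < C" "1 / c1 \<le> C" "T powr \<alpha> / N' c2 \<le> C" "exp (p0 * ln (\<phi> p0)) \<le> C"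
    using c(1) c(8)[OF c(2)] by (auto simp: C_def intro!: add_nonneg_pos add_nonneg_nonneg)
  have 1: "t powr \<alpha> \<le> C * N' t" if t: "0 < t" for t
  proof -
    consider "t \<le> c2" | "c2 < t" "t \<le> T" | "T < t" by linarith
    thus ?thesis
    proof cases
      case 1
      hence "t powr \<alpha> = 1 / c1 * N' t"
        using c t by simp
      also have "\<dots> \<le> C * N' t"
        using C c(8)[OF t] by (intro mult_right_mono) auto
      finally show ?thesis .
    next
      case 2
      have "t powr \<alpha> \<le> T powr \<alpha> / N' c2 * N' c2"
        using 2 t \<alpha> c(8)[OF c(2)] by (simp add: powr_mono2)
      also have "\<dots> \<le> C * N' t"
        using C c(2) c(7)[of c2 t] c(8)[OF c(2)] 2 by (intro mult_mono) auto
      finally show ?thesis .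
    next
      case 3
      have "t powr \<alpha> \<le> t powr p0"
        using 3 T by (intro powr_mono) (auto simp: p0_def)
      also have "\<dots> = exp (p0 * ln (\<phi> p0)) * exp (p0 * (ln t - ln (\<phi> p0)))"
        using t by (simp add: powr_def mult_exp_exp algebra_simps)
      also have "\<dots> \<le> C * N' t"
        unfolding big[OF less_imp_le[OF 3]]
        using C le_legendre[OF gf, of p0 "ln t"] by (intro mult_mono) (auto simp: p0_def)
      finally show ?thesis .
    qed
  qed
  define C' where "C' = C + 1 + N' T * C"
  have "C \<le> C'" "1 \<le> C'" "N' T * C \<le> C'"
    using C c(8)[of T] T by (auto simp: C'_def)
  have 2: "exp (p * (ln t - ln (\<phi> p))) \<le> C' * N' t" if t: "0 < t" and p: "\<alpha> \<le> p" "a \<le> p" for t p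
  proof (cases "T \<le> t")
    case True
    have "exp (p * (ln t - ln (\<phi> p))) \<le> 1 * N' t"
      unfolding big[OF True] using le_legendre[OF gf p(2)] by simp
    also have "\<dots> \<le> C' * N' t"
      using \<open>1 \<le> C'\<close> c(8)[OF t] by (intro mult_right_mono) auto
    finally show ?thesis .
  next
    case False
    have "ln t \<le> ln T"
      using False t by simp
    hence "(p - \<alpha>) * (ln t - ln T) \<le> 0"
      using p by (intro mult_nonneg_nonpos) auto
    hence "p * (ln t - ln (\<phi> p)) \<le> \<alpha> * (ln t - ln T) + p * (ln T - ln (\<phi> p))"
      by (simp add: algebra_simps)
    also have "\<dots> \<le> \<alpha> * ln t + legendre a \<phi> (ln T)"
    proof -
      have "0 \<le> \<alpha> * ln T"
        using \<alpha> T by simp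
      thus ?thesis
        using le_legendre[OF gf p(2), of "ln T"] by (simp add: right_diff_distrib)
    qed
    finally have "exp (p * (ln t - ln (\<phi> p))) \<le> t powr \<alpha> * N' T"
      using t big[of T] by (simp add: powr_def mult_exp_exp)
    also have "\<dots> \<le> (C * N' t) * N' T"
      using 1[OF t] c(8)[of T] T by (intro mult_right_mono) auto
    also have "\<dots> \<le> C' * N' t"
      using \<open>N' T * C \<le> C'\<close> c(8)[OF t] mult_right_mono[of "N' T * C" C' "N' t"] by (simp add: mult_ac)
    finally show ?thesis .
  qed
  have "t powr \<alpha> \<le> C' * N' t" if "0 < t" for t
    using 1[OF that] \<open>C \<le> C'\<close> c(8)[OF that] mult_right_mono[of C C' "N' t"] by linarith
  thus ?thesis
    using 2 \<open>1 \<le> C'\<close> by (intro exI[of _ C']) auto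
qed

lemma N_mod_upper:
  assumes N': "is_N_mod \<alpha> N N'" and \<alpha>: "0 < \<alpha>"
  shows "\<exists>A>0. \<forall>u. 0 \<le> u \<longrightarrow> u \<le> U \<longrightarrow> N' u \<le> A * u powr \<alpha>"
proof -
  obtain c1 c2 c5 where c: "0 < c1" "0 < c2" "c2 < c5" "\<And>u. 0 \<le> u \<Longrightarrow> u \<le> c2 \<Longrightarrow> N' u = c1 * u powr \<alpha>"
    "\<And>u. c5 < u \<Longrightarrow> N' u = N u" "N' 0 = 0" "\<And>u v. 0 \<le> u \<Longrightarrow> u \<le> v \<Longrightarrow> N' u \<le> N' v"
    "\<And>u. 0 < u \<Longrightarrow> 0 < N' u"
    using N' by (rule is_N_modE) blast
  define V where "V = max U c2"
  define A where "A = c1 + N' V / c2 powr \<alpha>"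
  have V: "0 < N' V" "c2 \<le> V" "U \<le> V"
    using c(2) c(8)[of V] by (auto simp: V_def)
  have A: "0 < A" "c1 \<le> A" "N' V / c2 powr \<alpha> \<le> A"
    using c(1) less_imp_le[OF V(1)] by (auto simp: A_def intro!: add_pos_nonneg)
  have "N' u \<le> A * u powr \<alpha>" if u: "0 \<le> u" "u \<le> U" for u
  proof (cases "u \<le> c2")
    case True
    thus ?thesis
      using c(4)[OF u(1) True] A by (simp add: mult_right_mono)
  next
    case False
    have "N' u \<le> N' V / c2 powr \<alpha> * c2 powr \<alpha>"
      using c(2) c(7)[of u V] u V by simp
    also have "\<dots> \<le> A * u powr \<alpha>"
      using A V False c(2) \<alpha> by (intro mult_mono powr_mono2) auto
    finally show ?thesis .
  qed
  thus ?thesis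
    using A(1) by blast
qed

section \<open>The choice of exponents at each level\<close>

text \<open>In the logarithmic variable \<open>\<sigma> = ln t\<close>, the left-hand side is the sum of two exponents. The first
belongs to \<open>e\<close> times the contribution \<open>(u / (p\<^sup>d \<psi>(p)))\<^sup>p\<close> of \<open>p\<close> to the supremum, at \<open>u = e\<^bsup>m+1-c\<^esup>\<close>
and with \<open>L = ln (\<psi> p)\<close>; the second belongs to \<open>(2 B q\<^sup>d t / e\<^sup>m)\<^sup>q\<close>, the weak type estimate at height
\<open>e\<^sup>m\<close>. For \<open>q = p\<close> the terms \<open>p m\<close> and \<open>p d ln p\<close> cancel and \<open>1 + p (\<sigma> - L) - p\<close> remains, where \<open>- p\<close>
is due to the shift \<open>c\<close>. Moving \<open>q\<close> away from \<open>p\<close> by at least 2, to the side determined by the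
sign of \<open>m - \<sigma>\<close>, gains \<open>\<bar>m - \<sigma>\<bar>\<close>; it costs at most \<open>4 (d + ln (2 B) + d ln (p + 4))\<close>, which the
surplus \<open>- p\<close> absorbs up to a constant.\<close>

lemma high_level_exponent_bound:
  fixes p q d B \<sigma> m L :: real
  assumes p: "6 \<le> p" and d: "1 \<le> d" and B: "1 \<le> B"
    and q: "if m < \<sigma> then p - 4 \<le> q \<and> q \<le> p - 2 else p + 2 \<le> q \<and> q \<le> p + 4"
  defines "c \<equiv> 2 + ln (2 * B)"
  defines "C \<equiv> 9 + 4 * d + 4 * ln (2 * B) + 4 * d * ln (4 * d)"
  shows "p * (m + 1 - c - d * ln p - L) + 1 + q * (ln (2 * B) + d * ln q - m + \<sigma>)
    \<le> C + p * (\<sigma> - L) - \<bar>m - \<sigma>\<bar>"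
proof -
  define l where "l = ln (2 * B)"
  have l: "0 \<le> l"
    using B by (simp add: l_def)
  have C: "C = 9 + 4 * d + 4 * l + 4 * (d * ln (4 * d))"
    by (simp add: C_def l_def)
  have lq: "p * d * (ln q - ln p) \<le> (q - p) * d"
  proof -
    have "0 < q" using q p by (auto split: if_splits)
    hence "ln q - ln p = ln (q / p)"
      using p by (simp add: ln_div)
    also have "\<dots> \<le> q / p - 1"
      using \<open>0 < q\<close> p by (intro ln_le_minus_one) auto
    finally have "p * (ln q - ln p) \<le> p * (q / p - 1)"
      using p by (intro mult_left_mono) auto
    also have "\<dots> = q - p"
      using p by (simp add: field_simps)
    finally show ?thesis
      using d mult_right_mono[of "p * (ln q - ln p)" "q - p" d] by (simp add: mult_ac)
  qed
  have lnd: "0 \<le> d * ln (4 * d)"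
    using d by simp
  have split: "p * (m + 1 - c - d * ln p - L) + 1 + q * (l + d * ln q - m + \<sigma>)
      = 1 - p + p * (\<sigma> - L) + p * d * (ln q - ln p) + (q - p) * (l + d * ln q) - (q - p) * (m - \<sigma>)"
  proof -
    have "c = 2 + l"
      by (simp add: c_def l_def)
    thus ?thesis
      by (simp add: algebra_simps)
  qed
  show ?thesis
  proof (cases "m < \<sigma>")
    case True
    hence q: "p - 4 \<le> q" "q \<le> p - 2"
      using q by auto
    have "(q - p) * d \<le> 0" "(q - p) * (l + d * ln q) \<le> 0"
      using q p d l by (auto intro!: mult_nonpos_nonneg add_nonneg_nonneg mult_nonneg_nonneg)
    moreover have "- ((q - p) * (m - \<sigma>)) \<le> - \<bar>m - \<sigma>\<bar>"
      using True q mult_right_mono[of 1 "p - q" "\<sigma> - m"] by (simp add: algebra_simps)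
    moreover have "1 - p \<le> C"
      using p d l lnd unfolding C by linarith
    ultimately show ?thesis
      using lq unfolding l_def[symmetric] split by linarith
  next
    case False
    hence q: "p + 2 \<le> q" "q \<le> p + 4"
      using q by auto
    have "(q - p) * d \<le> 4 * d"
      using q d by (intro mult_right_mono) auto
    moreover have "(q - p) * (l + d * ln q) \<le> 4 * (l + d * ln (p + 4))"
      using q p d l by (intro mult_mono add_left_mono mult_left_mono) (auto intro!: add_nonneg_nonneg mult_nonneg_nonneg)
    moreover have "4 * d * ln (p + 4) \<le> p + 4 + 4 * d * ln (4 * d)"
    proof -
      have "ln (p + 4) - ln (4 * d) = ln ((p + 4) / (4 * d))"
        using p d by (simp add: ln_div)
      also have "\<dots> \<le> (p + 4) / (4 * d)"
        using ln_le_minus_one[of "(p + 4) / (4 * d)"] p d by simp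
      finally have "4 * d * (ln (p + 4) - ln (4 * d)) \<le> 4 * d * ((p + 4) / (4 * d))"
        using d by (intro mult_left_mono) auto
      also have "4 * d * ((p + 4) / (4 * d)) = p + 4"
        using d by simp
      finally show ?thesis
        by (simp add: algebra_simps)
    qed
    moreover have "- ((q - p) * (m - \<sigma>)) \<le> - \<bar>m - \<sigma>\<bar>"
      using False q mult_right_mono[of 1 "q - p" "m - \<sigma>"] by (simp add: algebra_simps)
    ultimately show ?thesis
      using lq unfolding l_def[symmetric] split C by (simp add: algebra_simps)
  qed
qed

text \<open>A pair of an exponent \<open>q\<close> and the \<open>q\<close>-th power \<open>W\<close> of a bound on \<open>L\<^sub>q\<close>: either a single exponent \<open>r\<close>,
which will lie close to \<open>1\<close>, or any even integer.\<close>

definition admissible :: "real \<Rightarrow> real \<Rightarrow> nat \<Rightarrow> real \<Rightarrow> real \<Rightarrow> real \<Rightarrow> bool" where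
  "admissible r W0 d B q W \<longleftrightarrow> q = r \<and> W = W0 \<or> (\<exists>n. even n \<and> 0 < n \<and> q = real n \<and> W = (B * real n ^ d) ^ n)"

text \<open>The bound that a point with \<open>\<bar>f(x)\<bar> = t\<close> contributes to the measure of the set where \<open>\<bar>S\<^sub>M f\<bar>\<close> exceeds
\<open>b\<close>, when \<open>f\<close> is cut at height \<open>b\<close> and Chebyshev's inequality at height \<open>b / 2\<close> is applied to
both parts.\<close>

definition level_term :: "real \<Rightarrow> real \<Rightarrow> real \<Rightarrow> real \<Rightarrow> real \<Rightarrow> real \<Rightarrow> real" where
  "level_term q1 W1 q2 W2 b t = (if b < t then W1 * (2 / b * t) powr q1 else W2 * (2 / b * t) powr q2)"

lemma even_power_eq_exp:
  assumes "0 < n" "0 < B" "0 < t"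
  shows "(B * real n ^ d) ^ n * (2 / exp m * t) powr real n
    = exp (real n * (ln (2 * B) + real d * ln (real n) - m + ln t))"
proof -
  have "(B * real n ^ d) ^ n = exp (real n * (ln B + real d * ln (real n)))"
    using assms by (simp add: exp_of_nat_mult exp_add)
  moreover have "(2 / exp m * t) powr real n = exp (real n * (ln 2 - m + ln t))"
    using assms by (simp add: powr_def ln_mult ln_div)
  ultimately show ?thesis
    using assms by (simp add: mult_exp_exp ln_mult algebra_simps)
qed

text \<open>At each level \<open>m\<close> a pair of exponents is chosen for which the contribution of a point to level \<open>m\<close>
decays exponentially in the distance between \<open>m\<close> and \<open>ln t\<close>. From some level \<open>m0\<close> on these are even
integers around a nearly optimal exponent for \<open>Nd\<close>. Below \<open>m0\<close>, where \<open>Nd'\<close> is bounded by a multiple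
of \<open>u\<^sup>\<alpha>\<close>, they are \<open>r < \<alpha>\<close> and an even \<open>Q > \<alpha>\<close>.\<close>

lemma level_exponents_exist:
  assumes \<psi>: "Psi_class a \<psi>" and N: "is_N a \<psi> N" and Nd: "is_N a (psi_pow d \<psi>) Nd"
    and N': "is_N_mod \<alpha> N N'" and Nd': "is_N_mod \<alpha> Nd Nd'"
    and d: "0 < d" and B: "1 \<le> B" and r: "1 < r" "r < \<alpha>" and W0: "0 < W0"
  shows "\<exists>K>0. \<exists>C\<ge>0. \<exists>\<delta>>0. \<forall>m::int. \<exists>q1 W1 q2 W2.
    admissible r W0 d B q1 W1 \<and> admissible r W0 d B q2 W2 \<and>
    (\<forall>t>0. Nd' (exp (of_int m + 1) / K) * level_term q1 W1 q2 W2 (exp (of_int m)) t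
       \<le> C * N' t * exp (- \<delta> * \<bar>of_int m - ln t\<bar>))"
proof -
  note gf = growth_fun_Psi_class[OF \<psi>] and gfd = growth_fun_psi_pow[OF \<psi>, of d]
  have \<alpha>: "0 < \<alpha>" using r by simp
  obtain C0 where C0: "0 < C0" "\<And>t. 0 < t \<Longrightarrow> t powr \<alpha> \<le> C0 * N' t"
      "\<And>t p. 0 < t \<Longrightarrow> \<alpha> \<le> p \<Longrightarrow> a \<le> p \<Longrightarrow> exp (p * (ln t - ln (\<psi> p))) \<le> C0 * N' t"
    using N_mod_lower[OF gf N N' \<alpha>] by blast
  have N'0: "0 \<le> N' t" if "0 < t" for t
    using N' that by (rule_tac is_N_modE) (auto intro: less_imp_le)
  obtain c5 where c5: "\<And>u. c5 < u \<Longrightarrow> Nd' u = Nd u"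
    using Nd' by (rule is_N_modE) blast
  have Nd'0: "0 \<le> Nd' u" if "0 < u" for u
    using Nd' that by (rule_tac is_N_modE) (auto intro: less_imp_le)
  define c where "c = 2 + ln (2 * B)"
  define C1 where "C1 = 9 + 4 * real d + 4 * ln (2 * B) + 4 * real d * ln (4 * real d)"
  obtain s0 where s0: "\<And>s. s0 \<le> s \<Longrightarrow> \<exists>p\<ge>max 6 \<alpha>. a \<le> p \<and>
      legendre a (psi_pow d \<psi>) s \<le> p * (s - ln (psi_pow d \<psi> p)) + 1"
    using legendre_near_optimal[OF gfd, of "max 6 \<alpha>"] by blast
  \<comment> \<open>from level \<open>m0\<close> on there are near-optimal exponents \<open>p \<ge> max 6 \<alpha>\<close>, and \<open>Nd'\<close> coincides with \<open>exp\<close> of the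
    Legendre transform\<close>
  define m0 where "m0 = \<lceil>max s0 (max 2 (\<bar>c5\<bar> + 1)) + c\<rceil>"
  obtain A where A: "0 < A" "\<And>u. 0 \<le> u \<Longrightarrow> u \<le> exp (of_int m0) \<Longrightarrow> Nd' u \<le> A * u powr \<alpha>"
    using N_mod_upper[OF Nd' \<alpha>] by blast
  define Q where "Q = 2 * (nat \<lceil>\<alpha>\<rceil> + 1)"
  have Q: "even Q" "0 < Q" "\<alpha> < real Q"
    by (auto simp: Q_def) (linarith)
  define WQ where "WQ = (B * real Q ^ d) ^ Q"
  have WQ: "0 < WQ"
    using B Q by (simp add: WQ_def)
  define \<delta> where "\<delta> = Min {1, \<alpha> - r, real Q - \<alpha>}"
  have \<delta>: "0 < \<delta>" "\<delta> \<le> 1" "\<delta> \<le> \<alpha> - r" "\<delta> \<le> real Q - \<alpha>"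
    using r Q by (auto simp: \<delta>_def)
  define CL where "CL = A * exp \<alpha> * (W0 * 2 powr r + WQ * 2 powr real Q) * C0"
  define CH where "CH = exp C1 * C0"
  define C where "C = CL + CH"
  have CL: "0 \<le> CL" and CH: "0 \<le> CH"
    using A C0 W0 WQ by (auto simp: CL_def CH_def intro!: mult_nonneg_nonneg add_nonneg_nonneg)
  have c0: "0 \<le> c"
    using B by (simp add: c_def)
  have decay: "exp (- \<delta>' * \<bar>s\<bar>) \<le> exp (- \<delta> * \<bar>s\<bar>)" if "\<delta> \<le> \<delta>'" for \<delta>' s :: real
    using that by (simp add: mult_right_mono)
  have final: "D * N' t * exp (- \<delta> * s) \<le> C * N' t * exp (- \<delta> * s)" if "D \<le> C" "0 < t" for D t s :: real
    using that N'0 by (intro mult_right_mono) auto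
  have "\<exists>q1 W1 q2 W2. admissible r W0 d B q1 W1 \<and> admissible r W0 d B q2 W2 \<and>
    (\<forall>t>0. Nd' (exp (of_int m + 1) / exp c) * level_term q1 W1 q2 W2 (exp (of_int m)) t
       \<le> C * N' t * exp (- \<delta> * \<bar>of_int m - ln t\<bar>))" for m :: int
  proof (cases "m0 \<le> m")
    case True
    define s where "s = of_int m + 1 - c"
    have s: "s0 \<le> s" "2 \<le> s" "\<bar>c5\<bar> + 1 \<le> s"
      using True unfolding m0_def s_def by linarith+
    obtain p where p: "6 \<le> p" "\<alpha> \<le> p" "a \<le> p"
        "legendre a (psi_pow d \<psi>) s \<le> p * (s - ln (psi_pow d \<psi> p)) + 1"
      using s0[OF s(1)] by auto
    have "s + 1 \<le> exp s"
      using exp_ge_add_one_self[of s] by linarith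
    hence "c5 < exp s" "exp 2 \<le> exp s"
      using s by auto
    hence "Nd' (exp s) = exp (legendre a (psi_pow d \<psi>) s)"
      using c5 is_N_eq_exp_legendre[OF Nd] by simp
    hence Nd_le: "Nd' (exp s) \<le> exp (p * (s - ln (psi_pow d \<psi> p)) + 1)"
      using p(4) by simp
    have \<psi>p: "0 < \<psi> p"
      using \<psi> p(3) by (simp add: Psi_class_def)
    have lnp: "ln (psi_pow d \<psi> p) = real d * ln p + ln (\<psi> p)"
      using p(1) \<psi>p by (simp add: psi_pow_def ln_mult ln_realpow)
    \<comment> \<open>the even integers \<open>n1\<close> and \<open>n2\<close> have distance between 2 and 4 from \<open>p\<close>\<close>
    define j where "j = nat \<lfloor>p / 2\<rfloor>"
    have j: "2 * real j \<le> p" "p < 2 * real j + 2" "3 \<le> j"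
      using p(1) unfolding j_def by linarith+
    define n1 where "n1 = 2 * (j - 1)"
    define n2 where "n2 = 2 * (j + 2)"
    have n: "even n1" "0 < n1" "even n2" "0 < n2" "p - 4 \<le> real n1" "real n1 \<le> p - 2"
        "p + 2 \<le> real n2" "real n2 \<le> p + 4"
      using j by (auto simp: n1_def n2_def of_nat_diff)
    have main: "Nd' (exp (of_int m + 1) / exp c) * ((B * real n ^ d) ^ n * (2 / exp (of_int m) * t) powr real n)
        \<le> C * N' t * exp (- \<delta> * \<bar>of_int m - ln t\<bar>)"
      if t: "0 < t" and n: "0 < n" "if of_int m < ln t then p - 4 \<le> real n \<and> real n \<le> p - 2
        else p + 2 \<le> real n \<and> real n \<le> p + 4" for n :: nat and t :: real
    proof -
      have "Nd' (exp (of_int m + 1) / exp c) * ((B * real n ^ d) ^ n * (2 / exp (of_int m) * t) powr real n)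
          \<le> exp (p * (s - ln (psi_pow d \<psi> p)) + 1)
            * exp (real n * (ln (2 * B) + real d * ln (real n) - of_int m + ln t))"
        using Nd_le B t n even_power_eq_exp[of n B t d "of_int m"]
        by (simp add: s_def exp_diff)
      also have "\<dots> = exp (p * (of_int m + 1 - c - real d * ln p - ln (\<psi> p)) + 1
            + real n * (ln (2 * B) + real d * ln (real n) - of_int m + ln t))"
        by (simp add: lnp s_def mult_exp_exp algebra_simps)
      also have "\<dots> \<le> exp (C1 + p * (ln t - ln (\<psi> p)) - \<bar>of_int m - ln t\<bar>)"
        using high_level_exponent_bound[OF p(1) _ B n(2), of "real d" "ln (\<psi> p)"] d
        by (simp add: C1_def c_def)
      also have "\<dots> = exp C1 * exp (p * (ln t - ln (\<psi> p))) * exp (- 1 * \<bar>of_int m - ln t\<bar>)"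
        by (simp add: mult_exp_exp)
      also have "\<dots> \<le> exp C1 * (C0 * N' t) * exp (- \<delta> * \<bar>of_int m - ln t\<bar>)"
        using C0(1) C0(3)[OF t p(2,3)] decay[OF \<delta>(2)] N'0[OF t]
        by (intro mult_mono mult_nonneg_nonneg) auto
      also have "\<dots> = CH * N' t * exp (- \<delta> * \<bar>of_int m - ln t\<bar>)"
        by (simp add: CH_def)
      also have "\<dots> \<le> C * N' t * exp (- \<delta> * \<bar>of_int m - ln t\<bar>)"
        using CL t by (intro final) (auto simp: C_def)
      finally show ?thesis .
    qed
    have "Nd' (exp (of_int m + 1) / exp c) * level_term (real n1) ((B * real n1 ^ d) ^ n1)
        (real n2) ((B * real n2 ^ d) ^ n2) (exp (of_int m)) t
       \<le> C * N' t * exp (- \<delta> * \<bar>of_int m - ln t\<bar>)" if t: "0 < t" for t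
    proof (cases "of_int m < ln t")
      case True
      hence "exp (of_int m) < t"
        using t by (metis exp_less_mono exp_ln)
      thus ?thesis
        unfolding level_term_def using main[OF t, of n1] n True by simp
    next
      case False
      hence "\<not> exp (of_int m) < t"
        using t by (simp add: not_less ln_le_cancel_iff[symmetric] del: ln_le_cancel_iff)
      thus ?thesis
        unfolding level_term_def using main[OF t, of n2] n False by simp
    qed
    thus ?thesis
      using n unfolding admissible_def by blast
  next
    case False
    have small: "Nd' (exp (of_int m + 1) / exp c) \<le> A * exp \<alpha> * exp (\<alpha> * of_int m)"
    proof -
      have "exp (of_int m + 1) / exp c \<le> exp (of_int m0)"
        using False c0 by (simp flip: exp_diff)
      hence "Nd' (exp (of_int m + 1) / exp c) \<le> A * (exp (of_int m + 1) / exp c) powr \<alpha>"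
        by (intro A) auto
      also have "\<dots> \<le> A * exp (of_int m + 1) powr \<alpha>"
      proof -
        have "exp (of_int m + 1) / exp c \<le> exp (of_int m + 1)"
          using c0 by (simp flip: exp_diff)
        thus ?thesis
          using A \<alpha> by (intro mult_left_mono powr_mono2) auto
      qed
      also have "\<dots> = A * exp \<alpha> * exp (\<alpha> * of_int m)"
        by (simp add: powr_def mult_exp_exp algebra_simps)
      finally show ?thesis .
    qed
    have main: "Nd' (exp (of_int m + 1) / exp c) * (W * (2 / exp (of_int m) * t) powr q)
        \<le> C * N' t * exp (- \<delta> * \<bar>of_int m - ln t\<bar>)"
      if t: "0 < t" and W: "0 \<le> W" "W * 2 powr q \<le> W0 * 2 powr r + WQ * 2 powr real Q"
        and q: "(q - \<alpha>) * (ln t - of_int m) \<le> - \<delta> * \<bar>of_int m - ln t\<bar>" for t W q :: real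
    proof -
      have pw: "(2 / exp (of_int m) * t) powr q = 2 powr q * exp (q * (ln t - of_int m))"
        using t by (simp add: powr_def ln_mult ln_div mult_exp_exp algebra_simps)
      have "Nd' (exp (of_int m + 1) / exp c) * (W * (2 / exp (of_int m) * t) powr q)
          = Nd' (exp (of_int m + 1) / exp c) * ((W * 2 powr q) * exp (q * (ln t - of_int m)))"
        unfolding pw by simp
      also have "\<dots> \<le> (A * exp \<alpha> * exp (\<alpha> * of_int m)) * ((W * 2 powr q) * exp (q * (ln t - of_int m)))"
        using small W by (intro mult_right_mono) auto
      also have "\<dots> = A * exp \<alpha> * (W * 2 powr q) * (exp (\<alpha> * ln t) * exp ((q - \<alpha>) * (ln t - of_int m)))"
        by (simp add: mult_exp_exp algebra_simps)
      also have "\<dots> \<le> A * exp \<alpha> * (W0 * 2 powr r + WQ * 2 powr real Q) *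
          ((C0 * N' t) * exp (- \<delta> * \<bar>of_int m - ln t\<bar>))"
      proof -
        have "exp (\<alpha> * ln t) \<le> C0 * N' t"
          using C0(2)[OF t] t by (simp add: powr_def)
        moreover have "0 \<le> C0 * N' t" "0 \<le> W0 * 2 powr r + WQ * 2 powr real Q"
          using C0(1) N'0[OF t] W0 WQ by (auto intro!: add_nonneg_nonneg)
        moreover have "exp ((q - \<alpha>) * (ln t - of_int m)) \<le> exp (- \<delta> * \<bar>of_int m - ln t\<bar>)"
          using q by simp
        ultimately show ?thesis
          using A W C0(1) N'0[OF t] by (intro mult_mono mult_nonneg_nonneg) auto
      qed
      also have "\<dots> = CL * N' t * exp (- \<delta> * \<bar>of_int m - ln t\<bar>)"
        by (simp add: CL_def)
      also have "\<dots> \<le> C * N' t * exp (- \<delta> * \<bar>of_int m - ln t\<bar>)"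
        using CH t by (intro final) (auto simp: C_def)
      finally show ?thesis .
    qed
    have "Nd' (exp (of_int m + 1) / exp c) * level_term r W0 (real Q) WQ (exp (of_int m)) t
       \<le> C * N' t * exp (- \<delta> * \<bar>of_int m - ln t\<bar>)" if t: "0 < t" for t
    proof (cases "of_int m < ln t")
      case True
      hence "exp (of_int m) < t"
        using t by (metis exp_less_mono exp_ln)
      moreover have "\<delta> * (ln t - of_int m) \<le> (\<alpha> - r) * (ln t - of_int m)"
        using \<delta> True by (intro mult_right_mono) auto
      ultimately show ?thesis
        unfolding level_term_def using main[OF t, of W0 r] W0 WQ True by (simp add: algebra_simps)
    next
      case False
      hence "\<not> exp (of_int m) < t"
        using t by (simp add: not_less ln_le_cancel_iff[symmetric] del: ln_le_cancel_iff)
      moreover have "\<delta> * (of_int m - ln t) \<le> (real Q - \<alpha>) * (of_int m - ln t)"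
        using \<delta> False by (intro mult_right_mono) auto
      ultimately show ?thesis
        unfolding level_term_def using main[OF t, of WQ "real Q"] W0 WQ False by (simp add: algebra_simps)
    qed
    thus ?thesis
      using Q unfolding admissible_def WQ_def by blast
  qed
  thus ?thesis
    using \<delta>(1) CL CH by (intro exI[of _ "exp c"] exI[of _ C] exI[of _ \<delta>] conjI) (auto simp: C_def)
qed

section \<open>Complex-valued functions and the decomposition into levels\<close>

definition complex_conv :: "('a::euclidean_space \<Rightarrow> real) \<Rightarrow> ('a \<Rightarrow> complex) \<Rightarrow> 'a \<Rightarrow> complex" where
  "complex_conv k f x = (\<integral>y. complex_of_real (k y) * f (x - y) \<partial>lborel)"

text \<open>The integral of a non-integrable function is zero by convention, so that additivity of the
convolution in \<open>f\<close> depends on this condition.\<close>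

definition conv_defined :: "('a::euclidean_space \<Rightarrow> real) \<Rightarrow> ('a \<Rightarrow> complex) \<Rightarrow> bool" where
  "conv_defined k f \<longleftrightarrow> (\<forall>x. integrable lborel (\<lambda>y. complex_of_real (k y) * f (x - y)))"

lemma borel_measurable_complex_conv [measurable]:
  assumes [measurable]: "k \<in> borel_measurable borel" "f \<in> borel_measurable borel"
  shows "complex_conv k f \<in> borel_measurable borel"
  unfolding complex_conv_def[abs_def] by measurable

lemma complex_conv_bound:
  fixes k :: "'a::euclidean_space \<Rightarrow> real"
  assumes k [measurable]: "k \<in> borel_measurable borel" and f [measurable]: "f \<in> borel_measurable borel"
    and st: "strong_type k q W" and q: "1 < q" and W: "0 \<le> W" and def: "conv_defined k f"
  shows "(\<integral>\<^sup>+x. ennreal (cmod (complex_conv k f x) powr q) \<partial>lborel)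
    \<le> ennreal (4 powr q * W) * (\<integral>\<^sup>+x. ennreal (cmod (f x) powr q) \<partial>lborel)"
proof -
  define u where "u x = Re (f x)" for x
  define v where "v x = Im (f x)" for x
  have [measurable]: "u \<in> borel_measurable borel" "v \<in> borel_measurable borel"
    unfolding u_def v_def by measurable
  have int: "integrable lborel (\<lambda>y. complex_of_real (k y) * f (x - y))" for x
    using def by (simp add: conv_defined_def)
  have parts: "Re (complex_conv k f x) = conv k u x" "Im (complex_conv k f x) = conv k v x" for x
    unfolding complex_conv_def conv_def u_def v_def
    using integral_Re[OF int[of x]] integral_Im[OF int[of x]] by simp_all
  have intu: "integrable lborel (\<lambda>y. k y * u (x - y))" and intv: "integrable lborel (\<lambda>y. k y * v (x - y))" for x
    using integrable_Re[OF int[of x]] integrable_Im[OF int[of x]] by (simp_all add: u_def v_def)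
  let ?F = "\<integral>\<^sup>+x. ennreal (cmod (f x) powr q) \<partial>lborel"
  have Bu: "(\<integral>\<^sup>+x. ennreal (\<bar>conv k u x\<bar> powr q) \<partial>lborel) \<le> ennreal W * ?F"
  proof -
    have "(\<integral>\<^sup>+x. ennreal (\<bar>conv k u x\<bar> powr q) \<partial>lborel) \<le> ennreal W * (\<integral>\<^sup>+x. ennreal (\<bar>u x\<bar> powr q) \<partial>lborel)"
      using q by (intro strong_type_extend[OF st] intu) auto
    also have "\<dots> \<le> ennreal W * ?F"
      using q unfolding u_def
      by (intro mult_left_mono nn_integral_mono ennreal_leI powr_mono2 abs_Re_le_cmod) auto
    finally show ?thesis .
  qed
  have Bv: "(\<integral>\<^sup>+x. ennreal (\<bar>conv k v x\<bar> powr q) \<partial>lborel) \<le> ennreal W * ?F"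
  proof -
    have "(\<integral>\<^sup>+x. ennreal (\<bar>conv k v x\<bar> powr q) \<partial>lborel) \<le> ennreal W * (\<integral>\<^sup>+x. ennreal (\<bar>v x\<bar> powr q) \<partial>lborel)"
      using q by (intro strong_type_extend[OF st] intv) auto
    also have "\<dots> \<le> ennreal W * ?F"
      using q unfolding v_def
      by (intro mult_left_mono nn_integral_mono ennreal_leI powr_mono2 abs_Im_le_cmod) auto
    finally show ?thesis .
  qed
  have pt: "cmod (complex_conv k f x) powr q \<le> 2 powr q * (\<bar>conv k u x\<bar> powr q + \<bar>conv k v x\<bar> powr q)" for x
  proof -
    let ?m = "max \<bar>conv k u x\<bar> \<bar>conv k v x\<bar>"
    have "cmod (complex_conv k f x) \<le> 2 * ?m"
      using cmod_le[of "complex_conv k f x"] unfolding parts by linarith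
    hence "cmod (complex_conv k f x) powr q \<le> (2 * ?m) powr q"
      using q by (intro powr_mono2) auto
    also have "\<dots> = 2 powr q * ?m powr q"
      by (simp add: powr_mult)
    also have "\<dots> \<le> 2 powr q * (\<bar>conv k u x\<bar> powr q + \<bar>conv k v x\<bar> powr q)"
      by (intro mult_left_mono) (auto simp: max_def)
    finally show ?thesis .
  qed
  have "(\<integral>\<^sup>+x. ennreal (cmod (complex_conv k f x) powr q) \<partial>lborel)
      \<le> (\<integral>\<^sup>+x. ennreal (2 powr q) * (ennreal (\<bar>conv k u x\<bar> powr q) + ennreal (\<bar>conv k v x\<bar> powr q)) \<partial>lborel)"
    using pt by (intro nn_integral_mono) (simp flip: ennreal_plus ennreal_mult)
  also have "\<dots> = ennreal (2 powr q) * ((\<integral>\<^sup>+x. ennreal (\<bar>conv k u x\<bar> powr q) \<partial>lborel)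
      + (\<integral>\<^sup>+x. ennreal (\<bar>conv k v x\<bar> powr q) \<partial>lborel))"
    by (simp add: nn_integral_cmult nn_integral_add)
  also have "\<dots> \<le> ennreal (2 powr q) * (ennreal W * ?F + ennreal W * ?F)"
    by (intro mult_left_mono add_mono Bu Bv) auto
  also have "\<dots> = ennreal (2 powr q * 2 * W) * ?F"
    using W by (simp add: ennreal_mult mult.assoc mult_2[symmetric] mult.left_commute)
  also have "\<dots> \<le> ennreal (4 powr q * W) * ?F"
  proof (rule mult_right_mono[OF ennreal_leI])
    have "(2::real) powr 1 \<le> 2 powr q"
      using q by (intro powr_mono) auto
    hence "2 powr q * 2 \<le> 2 powr q * (2::real) powr q"
      by (intro mult_left_mono) auto
    also have "\<dots> = 4 powr q"
      by (simp flip: powr_mult)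
    finally show "2 powr q * 2 * W \<le> 4 powr q * W"
      using W by (intro mult_right_mono)
  qed auto
  finally show ?thesis .
qed

definition complex_type :: "('a::euclidean_space \<Rightarrow> real) \<Rightarrow> real \<Rightarrow> real \<Rightarrow> bool" where
  "complex_type k q W \<longleftrightarrow> 0 < q \<and> 0 \<le> W \<and> (\<forall>f. f \<in> borel_measurable borel \<longrightarrow> conv_defined k f \<longrightarrow>
     (\<integral>\<^sup>+x. ennreal (cmod (complex_conv k f x) powr q) \<partial>lborel)
       \<le> ennreal W * (\<integral>\<^sup>+x. ennreal (cmod (f x) powr q) \<partial>lborel))"

text \<open>If \<open>e\<^sup>m < \<bar>k * f\<bar> \<le> e\<^sup>m\<^sup>+\<^sup>1\<close> and \<open>f = f1 + f2\<close> is cut at height \<open>e\<^sup>m\<close>, then one of \<open>\<bar>k * f1\<bar>\<close>, \<open>\<bar>k * f2\<bar>\<close> exceeds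
\<open>e\<^sup>m / 2\<close>, so \<open>\<Phi>(\<bar>k * f\<bar>)\<close> is at most \<open>\<Phi>(e\<^sup>m\<^sup>+\<^sup>1)\<close> times the sum of the powers of
\<open>2 \<bar>k * f1\<bar> / e\<^sup>m\<close> and \<open>2 \<bar>k * f2\<bar> / e\<^sup>m\<close>. Integrating and inserting the bounds on \<open>L\<^sub>q\<close> yields the claim. The
exponents may change freely from level to level.\<close>

lemma level_decomposition:
  fixes k :: "'a::euclidean_space \<Rightarrow> real" and f :: "'a \<Rightarrow> complex" and q1 W1 q2 W2 :: "int \<Rightarrow> real"
  assumes k [measurable]: "k \<in> borel_measurable borel" and f [measurable]: "f \<in> borel_measurable borel"
    and def: "conv_defined k f"
    and ct: "\<And>m. complex_type k (q1 m) (W1 m)" "\<And>m. complex_type k (q2 m) (W2 m)"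
    and \<Phi>: "\<Phi> 0 = 0" "\<And>s t. 0 \<le> s \<Longrightarrow> s \<le> t \<Longrightarrow> \<Phi> s \<le> \<Phi> t"
  shows "(\<integral>\<^sup>+x. ennreal (\<Phi> (cmod (complex_conv k f x))) \<partial>lborel)
    \<le> (\<integral>\<^sup>+x. \<integral>\<^sup>+m. ennreal (\<Phi> (exp (of_int m + 1)) * level_term (q1 m) (W1 m) (q2 m) (W2 m) (exp (of_int m)) (cmod (f x)))
        \<partial>count_space UNIV \<partial>lborel)"
proof -
  define f1 where "f1 m x = indicator {x. exp (real_of_int m) < cmod (f x)} x *\<^sub>R f x" for m x
  define f2 where "f2 m x = indicator {x. cmod (f x) \<le> exp (real_of_int m)} x *\<^sub>R f x" for m x
  have [measurable]: "f1 m \<in> borel_measurable borel" "f2 m \<in> borel_measurable borel" for m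
    unfolding f1_def f2_def by measurable
  have int: "integrable lborel (\<lambda>y. complex_of_real (k y) * f (x - y))" for x
    using def by (simp add: conv_defined_def)
  have def': "conv_defined k g"
    if [measurable]: "g \<in> borel_measurable borel" and le: "\<And>x. cmod (g x) \<le> cmod (f x)" for g
    unfolding conv_defined_def
  proof
    show "integrable lborel (\<lambda>y. complex_of_real (k y) * g (x - y))" for x
      by (rule Bochner_Integration.integrable_bound[OF int[of x]])
         (auto simp: norm_mult intro!: mult_left_mono le)
  qed
  have def1: "conv_defined k (f1 m)" and def2: "conv_defined k (f2 m)" for m
    by (rule def'; auto simp: f1_def f2_def split: split_indicator)+
  have sum: "complex_conv k f x = complex_conv k (f1 m) x + complex_conv k (f2 m) x" for m x
  proof -
    have "f y = f1 m y + f2 m y" for y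
      by (auto simp: f1_def f2_def split: split_indicator)
    thus ?thesis
      using def1[of m] def2[of m] unfolding complex_conv_def conv_defined_def
      by (simp add: distrib_left)
  qed
  define \<beta> where "\<beta> m = 2 / exp (real_of_int m)" for m
  have \<beta>: "0 < \<beta> m" for m
    by (simp add: \<beta>_def)
  have \<Phi>0: "0 \<le> \<Phi> s" if "0 \<le> s" for s
    using \<Phi>(2)[of 0 s] \<Phi>(1) that by simp
  have q: "0 < q1 m" "0 < q2 m" "0 \<le> W1 m" "0 \<le> W2 m" for m
    using ct by (auto simp: complex_type_def)
  let ?G = "\<lambda>m x. ennreal (\<Phi> (exp (of_int m + 1))) * (ennreal (\<beta> m powr q1 m) * ennreal (cmod (complex_conv k (f1 m) x) powr q1 m)
      + ennreal (\<beta> m powr q2 m) * ennreal (cmod (complex_conv k (f2 m) x) powr q2 m))"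
  have pt: "ennreal (\<Phi> (cmod (complex_conv k f x))) \<le> (\<integral>\<^sup>+m. ?G m x \<partial>count_space UNIV)" for x
  proof (cases "complex_conv k f x = 0")
    case True
    thus ?thesis by (simp add: \<Phi>)
  next
    case False
    define T where "T = cmod (complex_conv k f x)"
    have T: "0 < T"
      using False by (simp add: T_def)
    \<comment> \<open>the level of \<open>x\<close>: then \<open>e\<^sup>m < T \<le> e\<^sup>m\<^sup>+\<^sup>1\<close>\<close>
    define m where "m = \<lceil>ln T\<rceil> - 1"
    have "of_int m < ln T" "ln T \<le> of_int m + 1"
      unfolding m_def by linarith+
    hence m: "exp (of_int m) < T" "T \<le> exp (of_int m + 1)"
      using T by (metis exp_less_mono exp_ln, metis exp_le_cancel_iff exp_ln)
    have "T \<le> cmod (complex_conv k (f1 m) x) + cmod (complex_conv k (f2 m) x)"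
      unfolding T_def sum[of x m] by (rule norm_triangle_ineq)
    hence "exp (of_int m) / 2 \<le> cmod (complex_conv k (f1 m) x) \<or> exp (of_int m) / 2 \<le> cmod (complex_conv k (f2 m) x)"
      using m by linarith
    hence "1 \<le> \<beta> m * cmod (complex_conv k (f1 m) x) \<or> 1 \<le> \<beta> m * cmod (complex_conv k (f2 m) x)"
      by (auto simp: \<beta>_def field_simps)
    hence "1 \<le> (\<beta> m * cmod (complex_conv k (f1 m) x)) powr q1 m + (\<beta> m * cmod (complex_conv k (f2 m) x)) powr q2 m"
    proof (elim disjE)
      assume "1 \<le> \<beta> m * cmod (complex_conv k (f1 m) x)"
      hence "1 \<le> (\<beta> m * cmod (complex_conv k (f1 m) x)) powr q1 m"
        using q[of m] by (intro ge_one_powr_ge_zero) auto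
      thus ?thesis
        by (rule order_trans) simp
    next
      assume "1 \<le> \<beta> m * cmod (complex_conv k (f2 m) x)"
      hence "1 \<le> (\<beta> m * cmod (complex_conv k (f2 m) x)) powr q2 m"
        using q[of m] by (intro ge_one_powr_ge_zero) auto
      thus ?thesis
        by (rule order_trans) simp
    qed
    hence "1 * \<Phi> T \<le> (\<beta> m powr q1 m * cmod (complex_conv k (f1 m) x) powr q1 m
        + \<beta> m powr q2 m * cmod (complex_conv k (f2 m) x) powr q2 m) * \<Phi> (exp (of_int m + 1))"
      using T m(2) \<Phi>(2)[of T] \<Phi>0[of T] by (intro mult_mono) (auto simp: powr_mult)
    hence "ennreal (\<Phi> T) \<le> ?G m x"
      using \<Phi>0 by (simp add: mult.commute flip: ennreal_plus ennreal_mult)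
    also have "\<dots> \<le> (\<integral>\<^sup>+m. ?G m x \<partial>count_space UNIV)"
      by (rule nn_integral_ge_point) simp
    finally show ?thesis
      by (simp add: T_def)
  qed
  have one: "(\<integral>\<^sup>+x. ?G m x \<partial>lborel)
      \<le> (\<integral>\<^sup>+x. ennreal (\<Phi> (exp (of_int m + 1)) * level_term (q1 m) (W1 m) (q2 m) (W2 m) (exp (of_int m)) (cmod (f x))) \<partial>lborel)" for m
  proof -
    have "(\<integral>\<^sup>+x. ?G m x \<partial>lborel) = ennreal (\<Phi> (exp (of_int m + 1))) *
        (ennreal (\<beta> m powr q1 m) * (\<integral>\<^sup>+x. ennreal (cmod (complex_conv k (f1 m) x) powr q1 m) \<partial>lborel)
        + ennreal (\<beta> m powr q2 m) * (\<integral>\<^sup>+x. ennreal (cmod (complex_conv k (f2 m) x) powr q2 m) \<partial>lborel))"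
      by (simp add: nn_integral_cmult nn_integral_add)
    also have "\<dots> \<le> ennreal (\<Phi> (exp (of_int m + 1))) *
        (ennreal (\<beta> m powr q1 m) * (ennreal (W1 m) * (\<integral>\<^sup>+x. ennreal (cmod (f1 m x) powr q1 m) \<partial>lborel))
        + ennreal (\<beta> m powr q2 m) * (ennreal (W2 m) * (\<integral>\<^sup>+x. ennreal (cmod (f2 m x) powr q2 m) \<partial>lborel)))"
      using ct def1 def2 unfolding complex_type_def
      by (intro mult_left_mono add_mono) auto
    also have "\<dots> = (\<integral>\<^sup>+x. ennreal (\<Phi> (exp (of_int m + 1))) *
        (ennreal (\<beta> m powr q1 m) * (ennreal (W1 m) * ennreal (cmod (f1 m x) powr q1 m))
        + ennreal (\<beta> m powr q2 m) * (ennreal (W2 m) * ennreal (cmod (f2 m x) powr q2 m))) \<partial>lborel)"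
      by (simp add: nn_integral_cmult nn_integral_add)
    also have "\<dots> = (\<integral>\<^sup>+x. ennreal (\<Phi> (exp (of_int m + 1)) * level_term (q1 m) (W1 m) (q2 m) (W2 m) (exp (of_int m)) (cmod (f x))) \<partial>lborel)"
    proof (rule nn_integral_cong)
      fix x
      show "ennreal (\<Phi> (exp (of_int m + 1))) *
        (ennreal (\<beta> m powr q1 m) * (ennreal (W1 m) * ennreal (cmod (f1 m x) powr q1 m))
        + ennreal (\<beta> m powr q2 m) * (ennreal (W2 m) * ennreal (cmod (f2 m x) powr q2 m)))
        = ennreal (\<Phi> (exp (of_int m + 1)) * level_term (q1 m) (W1 m) (q2 m) (W2 m) (exp (of_int m)) (cmod (f x)))"
      proof (cases "exp (of_int m) < cmod (f x)")
        case True
        hence "f1 m x = f x" "f2 m x = 0"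
          by (auto simp: f1_def f2_def)
        thus ?thesis
          using True \<Phi>0 q[of m] by (simp add: level_term_def \<beta>_def[symmetric] powr_mult mult_ac flip: ennreal_mult)
      next
        case False
        hence "f1 m x = 0" "f2 m x = f x"
          by (auto simp: f1_def f2_def)
        thus ?thesis
          using False \<Phi>0 q[of m] by (simp add: level_term_def \<beta>_def[symmetric] powr_mult mult_ac flip: ennreal_mult)
      qed
    qed
    finally show ?thesis .
  qed
  have "(\<integral>\<^sup>+x. ennreal (\<Phi> (cmod (complex_conv k f x))) \<partial>lborel) \<le> (\<integral>\<^sup>+x. \<integral>\<^sup>+m. ?G m x \<partial>count_space UNIV \<partial>lborel)"
    by (intro nn_integral_mono pt)
  also have "\<dots> = (\<integral>\<^sup>+m. \<integral>\<^sup>+x. ?G m x \<partial>lborel \<partial>count_space UNIV)"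
    by (intro nn_integral_count_space_nn_integral) auto
  also have "\<dots> \<le> (\<integral>\<^sup>+m. \<integral>\<^sup>+x. ennreal (\<Phi> (exp (of_int m + 1)) *
      level_term (q1 m) (W1 m) (q2 m) (W2 m) (exp (of_int m)) (cmod (f x))) \<partial>lborel \<partial>count_space UNIV)"
    by (intro nn_integral_mono one)
  also have "\<dots> = (\<integral>\<^sup>+x. \<integral>\<^sup>+m. ennreal (\<Phi> (exp (of_int m + 1)) *
      level_term (q1 m) (W1 m) (q2 m) (W2 m) (exp (of_int m)) (cmod (f x))) \<partial>count_space UNIV \<partial>lborel)"
    by (intro nn_integral_count_space_nn_integral[symmetric]) (auto simp: level_term_def)
  finally show ?thesis .
qed

text \<open>What matters is the uniformity in \<open>\<sigma>\<close>, which follows by translating by the integer part of \<open>\<sigma>\<close>.\<close>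

lemma nn_integral_exp_int:
  assumes \<delta>: "0 < (\<delta>::real)"
  shows "\<exists>C\<ge>0. \<forall>\<sigma>. (\<integral>\<^sup>+m. ennreal (exp (- \<delta> * \<bar>of_int m - \<sigma>\<bar>)) \<partial>count_space (UNIV :: int set)) \<le> ennreal C"
proof -
  define e where "e m = ennreal (exp (- \<delta> * \<bar>real_of_int m\<bar>))" for m :: int
  define G where "G = (\<Sum>n. exp (- \<delta>) ^ n)"
  have sm: "summable (\<lambda>n. exp (- \<delta>) ^ n)"
    using \<delta> by (intro summable_geometric) simp
  have half: "(\<integral>\<^sup>+m. e m * indicator (range h) m \<partial>count_space UNIV) = ennreal G"
    if h: "inj h" "\<And>n. \<bar>h n\<bar> = int n" for h :: "nat \<Rightarrow> int"
  proof -
    have "(\<integral>\<^sup>+m. e m * indicator (range h) m \<partial>count_space UNIV) = (\<integral>\<^sup>+m. e m \<partial>count_space (range h))"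
      by (simp add: nn_integral_count_space_indicator)
    also have "\<dots> = (\<integral>\<^sup>+n. e (h n) \<partial>count_space UNIV)"
      using h by (intro nn_integral_bij_count_space[symmetric]) (simp add: bij_betw_def)
    also have "\<dots> = (\<Sum>n. ennreal (exp (- \<delta>) ^ n))"
    proof -
      have "e (h n) = ennreal (exp (- \<delta>) ^ n)" for n
      proof -
        have "\<bar>real_of_int (h n)\<bar> = real n"
          using h(2)[of n] by (metis of_int_abs of_int_of_nat_eq)
        thus ?thesis
          by (simp add: e_def flip: exp_of_nat_mult)
      qed
      thus ?thesis
        by (simp add: nn_integral_count_space_nat)
    qed
    also have "\<dots> = ennreal G"
      unfolding G_def using sm by (intro suminf_ennreal2) auto
    finally show ?thesis .
  qed
  have G0: "0 \<le> G"
    unfolding G_def using sm by (intro suminf_nonneg) auto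
  have total: "(\<integral>\<^sup>+m. e m \<partial>count_space UNIV) \<le> ennreal (2 * G)"
  proof -
    have "(\<integral>\<^sup>+m. e m \<partial>count_space UNIV)
        \<le> (\<integral>\<^sup>+m. e m * indicator (range int) m + e m * indicator (range (\<lambda>n. - int n)) m \<partial>count_space UNIV)"
    proof (rule nn_integral_mono)
      fix m :: int
      have "m \<in> range int \<or> m \<in> range (\<lambda>n. - int n)"
        by (cases m rule: int_cases2) auto
      thus "e m \<le> e m * indicator (range int) m + e m * indicator (range (\<lambda>n. - int n)) m"
        by (auto split: split_indicator)
    qed
    also have "\<dots> = ennreal G + ennreal G"
      by (subst nn_integral_add) (simp_all add: half inj_on_def)
    also have "\<dots> = ennreal (2 * G)"
      using G0 by (simp flip: ennreal_plus)
    finally show ?thesis .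
  qed
  have "(\<integral>\<^sup>+m. ennreal (exp (- \<delta> * \<bar>of_int m - \<sigma>\<bar>)) \<partial>count_space (UNIV :: int set)) \<le> ennreal (exp \<delta> * (2 * G))" for \<sigma>
  proof -
    have "(\<integral>\<^sup>+m. ennreal (exp (- \<delta> * \<bar>of_int m - \<sigma>\<bar>)) \<partial>count_space (UNIV :: int set))
        \<le> (\<integral>\<^sup>+m. ennreal (exp \<delta>) * e (m - \<lfloor>\<sigma>\<rfloor>) \<partial>count_space UNIV)"
    proof (rule nn_integral_mono)
      fix m :: int
      have "\<bar>real_of_int (m - \<lfloor>\<sigma>\<rfloor>)\<bar> \<le> \<bar>of_int m - \<sigma>\<bar> + 1"
        by linarith
      hence "\<delta> * \<bar>real_of_int (m - \<lfloor>\<sigma>\<rfloor>)\<bar> \<le> \<delta> * (\<bar>of_int m - \<sigma>\<bar> + 1)"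
        using \<delta> by (intro mult_left_mono) auto
      hence "exp (- \<delta> * \<bar>of_int m - \<sigma>\<bar>) \<le> exp \<delta> * exp (- \<delta> * \<bar>real_of_int (m - \<lfloor>\<sigma>\<rfloor>)\<bar>)"
        by (simp add: mult_exp_exp algebra_simps)
      thus "ennreal (exp (- \<delta> * \<bar>of_int m - \<sigma>\<bar>)) \<le> ennreal (exp \<delta>) * e (m - \<lfloor>\<sigma>\<rfloor>)"
        unfolding e_def by (subst ennreal_mult[symmetric]) (auto intro: ennreal_leI)
    qed
    also have "\<dots> = ennreal (exp \<delta>) * (\<integral>\<^sup>+m. e (m - \<lfloor>\<sigma>\<rfloor>) \<partial>count_space UNIV)"
      by (rule nn_integral_cmult) simp
    also have "(\<integral>\<^sup>+m. e (m - \<lfloor>\<sigma>\<rfloor>) \<partial>count_space UNIV) = (\<integral>\<^sup>+m. e m \<partial>count_space UNIV)"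
      by (intro nn_integral_bij_count_space bij_betwI[of _ _ _ "\<lambda>m. m + \<lfloor>\<sigma>\<rfloor>"]) auto
    also have "ennreal (exp \<delta>) * \<dots> \<le> ennreal (exp \<delta>) * ennreal (2 * G)"
      by (intro mult_left_mono total) auto
    also have "\<dots> = ennreal (exp \<delta> * (2 * G))"
      using G0 by (simp add: ennreal_mult)
    finally show ?thesis .
  qed
  thus ?thesis
    using G0 by (intro exI[of _ "exp \<delta> * (2 * G)"]) auto
qed

lemma complex_type_dirichlet:
  assumes M: "0 < M" and n: "even n" "0 < n"
  shows "complex_type (dirichlet_kernel M :: real ^ 'n \<Rightarrow> real) (real n) ((4 * 18 ^ CARD('n) * real n ^ CARD('n)) ^ n)"
    and "complex_type (dirichlet_kernel M :: real ^ 'n \<Rightarrow> real) (real n / (real n - 1))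
      (4 powr (real n / (real n - 1)) * (((18 * real n) ^ n) powr (1 / (real n - 1))) ^ CARD('n))"
proof -
  have n1: "1 < real n" "1 < real n / (real n - 1)"
    using n by (cases "n = 1"; auto simp: field_simps)+
  have W: "4 powr real n * ((18 * real n) ^ n) ^ CARD('n) = (4 * 18 ^ CARD('n) * real n ^ CARD('n)) ^ n"
    using n by (simp add: powr_realpow power_mult_distrib flip: power_mult) (simp add: mult.commute)
  show "complex_type (dirichlet_kernel M :: real ^ 'n \<Rightarrow> real) (real n) ((4 * 18 ^ CARD('n) * real n ^ CARD('n)) ^ n)"
    unfolding complex_type_def W[symmetric] using n1
    by (intro conjI allI impI complex_conv_bound strong_type_dirichlet_exponents(1)[OF M n]) auto
  show "complex_type (dirichlet_kernel M :: real ^ 'n \<Rightarrow> real) (real n / (real n - 1))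
      (4 powr (real n / (real n - 1)) * (((18 * real n) ^ n) powr (1 / (real n - 1))) ^ CARD('n))"
    unfolding complex_type_def using n1
    by (intro conjI allI impI complex_conv_bound strong_type_dirichlet_exponents(2)[OF M n]) auto
qed

text \<open>Since \<open>N'\<close> dominates a multiple of \<open>t\<^sup>\<alpha>\<close>, a function with finite right-hand side lies in \<open>L\<^sub>\<alpha>\<close>, so its
convolution with the kernel converges everywhere. The decomposition into levels bounds the
left-hand side by the integral of a sum over \<open>m\<close>, which is at most a multiple of \<open>N'(\<bar>f(x)\<bar>)\<close> at each
point, by the exponential decay away from \<open>m = ln \<bar>f(x)\<bar>\<close>.\<close>

lemma modular_inequality:
  fixes N' Nd' :: "real \<Rightarrow> real"
  assumes \<alpha>: "1 < \<alpha>" and \<psi>: "Psi_class a \<psi>" and N: "is_N a \<psi> N"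
    and Nd: "is_N a (psi_pow CARD('n::finite) \<psi>) Nd"
    and N': "is_N_mod \<alpha> N N'" and Nd': "is_N_mod \<alpha> Nd Nd'"
  shows "\<exists>K>0. \<exists>C\<ge>1. \<forall>M>0. \<forall>f \<in> borel_measurable (borel :: (real ^ 'n) measure).
    (\<integral>\<^sup>+x. ennreal (Nd' (cmod (complex_conv (dirichlet_kernel M) f x) / K)) \<partial>lborel)
      \<le> ennreal C * (\<integral>\<^sup>+x. ennreal (N' (cmod (f x))) \<partial>lborel)"
proof -
  \<comment> \<open>an even exponent above the conjugate exponent of \<open>\<alpha>\<close>, so that its own conjugate \<open>r\<close> is
    below \<open>\<alpha>\<close>\<close>
  define n where "n = 2 * (nat \<lceil>\<alpha> / (\<alpha> - 1)\<rceil> + 1)"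
  have n: "even n" "0 < n" "\<alpha> / (\<alpha> - 1) < real n" "1 < real n"
    by (auto simp: n_def) linarith
  define r where "r = real n / (real n - 1)"
  have r: "1 < r" "r < \<alpha>"
    using n(3,4) \<alpha> by (auto simp: r_def field_simps)
  define W0 where "W0 = 4 powr r * (((18 * real n) ^ n) powr (1 / (real n - 1))) ^ CARD('n)"
  define B where "B = (4 * 18 ^ CARD('n) :: real)"
  have W0: "0 < W0"
    using n by (simp add: W0_def)
  have B: "1 \<le> B"
    using one_le_power[of "18::real" "CARD('n)"] unfolding B_def by linarith
  have ct: "complex_type (dirichlet_kernel M :: real ^ 'n \<Rightarrow> real) q W"
    if "0 < M" "admissible r W0 CARD('n) B q W" for M q W
    using that complex_type_dirichlet[where 'n = 'n, OF that(1)] n(1,2)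
    unfolding admissible_def W0_def B_def r_def by blast
  obtain K C0 \<delta> where K: "0 < K" and C0: "0 \<le> C0" and \<delta>: "0 < \<delta>"
    and "\<forall>m::int. \<exists>q1 W1 q2 W2. admissible r W0 CARD('n) B q1 W1 \<and> admissible r W0 CARD('n) B q2 W2 \<and>
    (\<forall>t>0. Nd' (exp (of_int m + 1) / K) * level_term q1 W1 q2 W2 (exp (of_int m)) t
       \<le> C0 * N' t * exp (- \<delta> * \<bar>of_int m - ln t\<bar>))"
    using level_exponents_exist[OF \<psi> N Nd N' Nd' _ B r W0] by auto
  then obtain q1 W1 q2 W2 :: "int \<Rightarrow> real" where
      adm: "\<And>m. admissible r W0 CARD('n) B (q1 m) (W1 m)" "\<And>m. admissible r W0 CARD('n) B (q2 m) (W2 m)"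
    and lev: "\<And>m t. 0 < t \<Longrightarrow> Nd' (exp (of_int m + 1) / K) * level_term (q1 m) (W1 m) (q2 m) (W2 m) (exp (of_int m)) t
       \<le> C0 * N' t * exp (- \<delta> * \<bar>of_int m - ln t\<bar>)"
    by metis
  obtain S where S: "0 \<le> S"
      "\<And>\<sigma>. (\<integral>\<^sup>+m. ennreal (exp (- \<delta> * \<bar>of_int m - \<sigma>\<bar>)) \<partial>count_space (UNIV :: int set)) \<le> ennreal S"
    using nn_integral_exp_int[OF \<delta>] by blast
  obtain c where c: "0 < c" "\<And>t. 0 < t \<Longrightarrow> t powr \<alpha> \<le> c * N' t"
    using N_mod_lower[OF growth_fun_Psi_class[OF \<psi>] N N'] \<alpha> by auto
  obtain N'0: "N' 0 = 0" and "\<And>s t. 0 \<le> s \<Longrightarrow> s \<le> t \<Longrightarrow> N' s \<le> N' t"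
    using N' by (rule is_N_modE) blast
  from this(2)[of 0] this(1) have N'0: "N' 0 = 0" "\<And>t. 0 \<le> t \<Longrightarrow> 0 \<le> N' t"
    by auto
  obtain Nd'0: "Nd' 0 = 0" "\<And>s t. 0 \<le> s \<Longrightarrow> s \<le> t \<Longrightarrow> Nd' s \<le> Nd' t"
    using Nd' by (rule is_N_modE) blast
  have "continuous_on UNIV N'"
    using N' by (simp add: is_N_mod_def)
  hence [measurable]: "N' \<in> borel_measurable borel"
    by (rule borel_measurable_continuous_onI)
  define C where "C = max 1 (C0 * S)"
  have "(\<integral>\<^sup>+x. ennreal (Nd' (cmod (complex_conv (dirichlet_kernel M) f x) / K)) \<partial>lborel)
      \<le> ennreal C * (\<integral>\<^sup>+x. ennreal (N' (cmod (f x))) \<partial>lborel)"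
    if M: "0 < M" and f [measurable]: "f \<in> borel_measurable (borel :: (real ^ 'n) measure)" for M f
  proof (cases "(\<integral>\<^sup>+x. ennreal (N' (cmod (f x))) \<partial>lborel) = \<infinity>")
    case True
    thus ?thesis
      by (simp add: ennreal_mult_top C_def)
  next
    case False
    have "(\<integral>\<^sup>+x. ennreal (cmod (f x) powr \<alpha>) \<partial>lborel) \<le> (\<integral>\<^sup>+x. ennreal c * ennreal (N' (cmod (f x))) \<partial>lborel)"
    proof (rule nn_integral_mono)
      fix x
      have "cmod (f x) powr \<alpha> \<le> c * N' (cmod (f x))"
        using c(2)[of "cmod (f x)"] N'0(1) by (cases "f x = 0") auto
      thus "ennreal (cmod (f x) powr \<alpha>) \<le> ennreal c * ennreal (N' (cmod (f x)))"
        using c(1) N'0(2) by (simp flip: ennreal_mult)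
    qed
    also have "\<dots> = ennreal c * (\<integral>\<^sup>+x. ennreal (N' (cmod (f x))) \<partial>lborel)"
      by (rule nn_integral_cmult) measurable
    also have "\<dots> < \<infinity>"
      using False by (simp add: ennreal_mult_less_top less_top)
    finally have f\<alpha>: "(\<integral>\<^sup>+x. ennreal (norm (f x) powr \<alpha>) \<partial>lborel) < \<infinity>"
      by simp
    have dual: "1 < \<alpha> / (\<alpha> - 1)" "1 / (\<alpha> / (\<alpha> - 1)) + 1 / \<alpha> = 1"
      using \<alpha> by (auto simp: field_simps)
    have def: "conv_defined (dirichlet_kernel M) f"
      unfolding conv_defined_def
      using integrable_kernel_mult[OF borel_measurable_dirichlet f dual(1) \<alpha> dual(2)
          nn_integral_dirichlet_powr[OF M dual(1)] f\<alpha>]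
      by (simp add: scaleR_conv_of_real)
    have sum: "(\<integral>\<^sup>+m. ennreal (Nd' (exp (of_int m + 1) / K) * level_term (q1 m) (W1 m) (q2 m) (W2 m) (exp (of_int m)) t)
        \<partial>count_space UNIV) \<le> ennreal C * ennreal (N' t)" if t: "0 \<le> t" for t
    proof (cases "t = 0")
      case True
      thus ?thesis
        by (simp add: level_term_def)
    next
      case False
      hence t: "0 < t"
        using t by simp
      have "(\<integral>\<^sup>+m. ennreal (Nd' (exp (of_int m + 1) / K) * level_term (q1 m) (W1 m) (q2 m) (W2 m) (exp (of_int m)) t)
          \<partial>count_space UNIV)
        \<le> (\<integral>\<^sup>+m. ennreal (C0 * N' t) * ennreal (exp (- \<delta> * \<bar>of_int m - ln t\<bar>)) \<partial>count_space UNIV)"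
        using lev[OF t] C0 N'0(2)[of t] t by (intro nn_integral_mono) (simp add: ennreal_leI flip: ennreal_mult)
      also have "\<dots> = ennreal (C0 * N' t) * (\<integral>\<^sup>+m. ennreal (exp (- \<delta> * \<bar>of_int m - ln t\<bar>)) \<partial>count_space UNIV)"
        by (rule nn_integral_cmult) simp
      also have "\<dots> \<le> ennreal (C0 * N' t) * ennreal S"
        by (intro mult_left_mono S) auto
      also have "\<dots> = ennreal (C0 * S) * ennreal (N' t)"
        using C0 S(1) N'0(2)[of t] t by (simp add: mult_ac flip: ennreal_mult)
      also have "\<dots> \<le> ennreal C * ennreal (N' t)"
        by (intro mult_right_mono ennreal_leI) (auto simp: C_def)
      finally show ?thesis .
    qed
    have "(\<integral>\<^sup>+x. ennreal (Nd' (cmod (complex_conv (dirichlet_kernel M) f x) / K)) \<partial>lborel)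
      \<le> (\<integral>\<^sup>+x. \<integral>\<^sup>+m. ennreal (Nd' (exp (of_int m + 1) / K) * level_term (q1 m) (W1 m) (q2 m) (W2 m) (exp (of_int m)) (cmod (f x)))
        \<partial>count_space UNIV \<partial>lborel)"
      by (rule level_decomposition[where \<Phi> = "\<lambda>u. Nd' (u / K)", OF borel_measurable_dirichlet f def ct[OF M adm(1)] ct[OF M adm(2)]])
         (use K in \<open>auto intro!: Nd'0 divide_right_mono\<close>)
    also have "\<dots> \<le> (\<integral>\<^sup>+x. ennreal C * ennreal (N' (cmod (f x))) \<partial>lborel)"
      by (intro nn_integral_mono sum) auto
    also have "\<dots> = ennreal C * (\<integral>\<^sup>+x. ennreal (N' (cmod (f x))) \<partial>lborel)"
      by (rule nn_integral_cmult) measurable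
    finally show ?thesis .
  qed
  thus ?thesis
    using K by (intro exI[of _ K] conjI exI[of _ C]) (auto simp: C_def)
qed

section \<open>Lebesgue measurable functions, and the inequality of norms\<close>

lemma AE_lborel_reflect:
  fixes x :: "'a::euclidean_space"
  assumes "AE y in lborel. P y"
  shows "AE y in lborel. P (x - y)"
proof -
  obtain N where "{y \<in> space lborel. \<not> P y} \<subseteq> N" "emeasure lborel N = 0" "N \<in> sets lborel"
    using assms by (rule AE_E)
  hence N: "{y. \<not> P y} \<subseteq> N" "N \<in> sets borel" "emeasure lborel N = 0"
    by simp_all
  have [measurable]: "(\<lambda>y. x - y) \<in> borel \<rightarrow>\<^sub>M borel"
    by measurable
  have "emeasure lborel ((\<lambda>y. x - y) -` N) = emeasure (distr lborel borel (\<lambda>y. x - y)) N"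
    using N(2) by (subst emeasure_distr) auto
  also have "\<dots> = 0"
    using N(3) by (simp add: lborel_distr_reflect)
  finally have "emeasure lborel ((\<lambda>y. x - y) -` N) = 0" .
  moreover have "(\<lambda>y. x - y) -` N \<in> sets borel"
    using measurable_sets[of "\<lambda>y. x - y" borel borel N] N(2) by simp
  ultimately have "(\<lambda>y. x - y) -` N \<in> null_sets lborel"
    by (simp add: null_sets_def)
  thus ?thesis
    by (rule AE_I') (use N(1) in auto)
qed

lemma lebesgue_reflect_measurable: "(\<lambda>y. x - y) \<in> lebesgue \<rightarrow>\<^sub>M (lebesgue :: 'a::euclidean_space measure)"
proof -
  have "(\<lambda>y. x + (\<Sum>j\<in>Basis. (- 1 * (y \<bullet> j)) *\<^sub>R j)) \<in> lebesgue \<rightarrow>\<^sub>M (lebesgue :: 'a measure)"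
    by (rule lebesgue_affine_measurable) simp
  moreover have "(\<Sum>j\<in>Basis. (- 1 * (y \<bullet> j)) *\<^sub>R j) = - y" for y :: 'a
    by (simp add: sum_negf euclidean_representation)
  ultimately show ?thesis
    by simp
qed

lemma lebesgue_borel_representative:
  fixes f :: "'a::euclidean_space \<Rightarrow> complex"
  assumes "f \<in> borel_measurable lebesgue"
  obtains g where "g \<in> borel_measurable borel" "AE x in lborel. f x = g x"
proof -
  have "(\<lambda>x. Re (f x)) \<in> borel_measurable lebesgue"
    using assms by measurable
  from completion_ex_borel_measurable_real[OF this] obtain u
    where u: "u \<in> borel_measurable lborel" "AE x in lborel. Re (f x) = u x"
    by blast
  have "(\<lambda>x. Im (f x)) \<in> borel_measurable lebesgue"
    using assms by measurable
  from completion_ex_borel_measurable_real[OF this] obtain v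
    where v: "v \<in> borel_measurable lborel" "AE x in lborel. Im (f x) = v x"
    by blast
  show ?thesis
  proof (rule that)
    have [measurable]: "u \<in> borel_measurable borel" "v \<in> borel_measurable borel"
      using u v by auto
    have "(\<lambda>x. complex_of_real (u x) + \<i> * complex_of_real (v x)) \<in> borel_measurable borel"
      by measurable
    thus "(\<lambda>x. Complex (u x) (v x)) \<in> borel_measurable borel"
      by (simp add: Complex_eq)
    show "AE x in lborel. f x = Complex (u x) (v x)"
      using u(2) v(2) by eventually_elim (simp add: complex_eq_iff)
  qed
qed

lemma fourier_partial_eq_complex_conv:
  fixes f :: "real ^ 'n \<Rightarrow> complex"
  assumes f: "f \<in> borel_measurable lebesgue" and g [measurable]: "g \<in> borel_measurable borel"
    and fg: "AE x in lborel. f x = g x"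
  shows "fourier_partial M f x = complex_conv (dirichlet_kernel M) g x"
proof -
  have [measurable]: "(\<lambda>y. complex_of_real (dirichlet_kernel M y)) \<in> borel_measurable (lebesgue :: (real ^ 'n) measure)"
    by (rule measurable_completion) measurable
  have [measurable]: "(\<lambda>y. f (x - y)) \<in> borel_measurable lebesgue"
    by (rule measurable_compose[OF lebesgue_reflect_measurable f])
  have [measurable]: "(\<lambda>y. g (x - y)) \<in> borel_measurable lebesgue"
    by (rule measurable_completion) measurable
  have "fourier_partial M f x = (\<integral>y. complex_of_real (dirichlet_kernel M y) * g (x - y) \<partial>lebesgue)"
    unfolding fourier_partial_def
  proof (rule integral_cong_AE)
    show "AE y in lebesgue. complex_of_real (dirichlet_kernel M y) * f (x - y)
        = complex_of_real (dirichlet_kernel M y) * g (x - y)"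
      using AE_completion[OF AE_lborel_reflect[OF fg, of x]] by eventually_elim simp
  qed measurable
  also have "\<dots> = complex_conv (dirichlet_kernel M) g x"
    unfolding complex_conv_def by (rule integral_completion) measurable
  finally show ?thesis .
qed

theorem theorem2:
  fixes \<alpha> a :: real
    and \<psi> N N\<^sub>d N\<^sub>\<alpha> N\<^sub>d\<^sub>\<alpha> :: "real \<Rightarrow> real"
  assumes "1 < \<alpha>"
    and "Psi_class a \<psi>"
    and "is_N a \<psi> N"
    and "is_N a (psi_pow CARD('n::finite) \<psi>) N\<^sub>d"
    and "is_N_mod \<alpha> N N\<^sub>\<alpha>"
    and "is_N_mod \<alpha> N\<^sub>d N\<^sub>d\<^sub>\<alpha>"
  shows "\<exists>C::real. 0 \<le> C \<and>
    (\<forall>f \<in> orlicz_space (lebesgue :: (real ^ 'n) measure) N\<^sub>\<alpha>.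
       (\<forall>M\<ge>1. fourier_partial M f \<in> orlicz_space lebesgue N\<^sub>d\<^sub>\<alpha>) \<and>
       (SUP M\<in>{1..}. orlicz_norm lebesgue N\<^sub>d\<^sub>\<alpha> (fourier_partial M f))
         \<le> ennreal C * orlicz_norm lebesgue N\<^sub>\<alpha> f)"
proof -
  obtain K C where K: "0 < K" and C: "1 \<le> C"
    and modular: "\<And>M (f :: real ^ 'n \<Rightarrow> complex). 0 < M \<Longrightarrow> f \<in> borel_measurable borel \<Longrightarrow>
      (\<integral>\<^sup>+x. ennreal (N\<^sub>d\<^sub>\<alpha> (cmod (complex_conv (dirichlet_kernel M) f x) / K)) \<partial>lborel)
      \<le> ennreal C * (\<integral>\<^sup>+x. ennreal (N\<^sub>\<alpha> (cmod (f x))) \<partial>lborel)"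
    using modular_inequality[where 'n = 'n, OF assms] by blast
  have bound: "orlicz_norm lebesgue N\<^sub>d\<^sub>\<alpha> (fourier_partial M f) \<le> ennreal (K * C) * orlicz_norm lebesgue N\<^sub>\<alpha> f"
    and meas: "fourier_partial M f \<in> borel_measurable lebesgue"
    if M: "1 \<le> M" and f: "f \<in> borel_measurable lebesgue" for M and f :: "real ^ 'n \<Rightarrow> complex"
  proof -
    obtain g where g [measurable]: "g \<in> borel_measurable borel" and fg: "AE x in lborel. f x = g x"
      using lebesgue_borel_representative[OF f] by blast
    let ?S = "complex_conv (dirichlet_kernel M) g"
    have S: "fourier_partial M f = ?S"
      using fourier_partial_eq_complex_conv[OF f g fg] by blast
    show "fourier_partial M f \<in> borel_measurable lebesgue"
      unfolding S by (rule measurable_completion) measurable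
    have each: "orlicz_norm lebesgue N\<^sub>d\<^sub>\<alpha> (fourier_partial M f)
        \<le> ennreal (K * C) * (ennreal (1 / v) * (1 + (\<integral>\<^sup>+x. ennreal (N\<^sub>\<alpha> (v * cmod (f x))) \<partial>lebesgue)))"
      if v: "0 < v" for v
    proof -
      let ?I = "\<integral>\<^sup>+x. ennreal (N\<^sub>\<alpha> (v * cmod (f x))) \<partial>lebesgue"
      have I: "?I = (\<integral>\<^sup>+x. ennreal (N\<^sub>\<alpha> (cmod (complex_of_real v * g x))) \<partial>lborel)"
        unfolding nn_integral_completion using fg v
        by (intro nn_integral_cong_AE) (auto simp: norm_mult elim!: eventually_mono)
      have Sv: "complex_conv (dirichlet_kernel M) (\<lambda>x. complex_of_real v * g x) x = complex_of_real v * ?S x" for x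
        unfolding complex_conv_def by (simp add: mult.left_commute)
      have J: "(\<integral>\<^sup>+x. ennreal (N\<^sub>d\<^sub>\<alpha> (v / K * cmod (?S x))) \<partial>lborel) \<le> ennreal C * ?I"
        using modular[of M "\<lambda>x. complex_of_real v * g x"] M v
        unfolding I Sv by (simp add: norm_mult mult.commute)
      have "orlicz_norm lebesgue N\<^sub>d\<^sub>\<alpha> (fourier_partial M f)
          \<le> ennreal (1 / (v / K)) * (1 + (\<integral>\<^sup>+x. ennreal (N\<^sub>d\<^sub>\<alpha> (v / K * cmod (?S x))) \<partial>lebesgue))"
        unfolding orlicz_norm_def S using v K by (intro INF_lower) auto
      also have "\<dots> \<le> ennreal (K * (1 / v)) * (ennreal C * 1 + ennreal C * ?I)"
      proof (intro mult_mono add_mono)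
        show "1 \<le> ennreal C * 1"
          using C by simp
      qed (use J v K in \<open>auto simp: nn_integral_completion\<close>)
      also have "\<dots> = ennreal (K * C) * (ennreal (1 / v) * (1 + ?I))"
      proof -
        have "ennreal (K * (1 / v)) = ennreal K * ennreal (1 / v)" "ennreal (K * C) = ennreal K * ennreal C"
          using K v C by (intro ennreal_mult; simp)+
        thus ?thesis
          by (simp only: distrib_left mult_1_right mult_ac)
      qed
      finally show ?thesis .
    qed
    have KC: "0 < ennreal (K * C)" "ennreal (K * C) < \<infinity>"
      using K C by auto
    have "orlicz_norm lebesgue N\<^sub>d\<^sub>\<alpha> (fourier_partial M f) / ennreal (K * C) \<le> orlicz_norm lebesgue N\<^sub>\<alpha> f"
      unfolding orlicz_norm_def[of _ N\<^sub>\<alpha>]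
      using each by (intro INF_greatest divide_le_posI_ennreal KC) auto
    hence *: "ennreal (K * C) * (orlicz_norm lebesgue N\<^sub>d\<^sub>\<alpha> (fourier_partial M f) / ennreal (K * C))
        \<le> ennreal (K * C) * orlicz_norm lebesgue N\<^sub>\<alpha> f"
      by (intro mult_left_mono) auto
    show "orlicz_norm lebesgue N\<^sub>d\<^sub>\<alpha> (fourier_partial M f) \<le> ennreal (K * C) * orlicz_norm lebesgue N\<^sub>\<alpha> f"
    proof -
      have "ennreal (K * C) * (z / ennreal (K * C)) = z" for z
        using KC by (subst ennreal_times_divide, subst mult.commute, intro mult_divide_eq_ennreal) auto
      thus ?thesis
        using * by simp
    qed
  qed
  show ?thesis
  proof (intro exI[of _ "K * C"] conjI ballI allI impI)
    show "0 \<le> K * C"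
      using K C by simp
  next
    fix f :: "real ^ 'n \<Rightarrow> complex" and M :: real
    assume f: "f \<in> orlicz_space lebesgue N\<^sub>\<alpha>" and M: "1 \<le> M"
    have "ennreal (K * C) * orlicz_norm lebesgue N\<^sub>\<alpha> f < \<infinity>"
      using f by (simp add: orlicz_space_def ennreal_mult_less_top)
    thus "fourier_partial M f \<in> orlicz_space lebesgue N\<^sub>d\<^sub>\<alpha>"
      using bound[OF M, of f] meas[OF M, of f] f by (auto simp: orlicz_space_def)
  next
    fix f :: "real ^ 'n \<Rightarrow> complex"
    assume "f \<in> orlicz_space lebesgue N\<^sub>\<alpha>"
    thus "(SUP M\<in>{1..}. orlicz_norm lebesgue N\<^sub>d\<^sub>\<alpha> (fourier_partial M f))
         \<le> ennreal (K * C) * orlicz_norm lebesgue N\<^sub>\<alpha> f"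
      by (intro SUP_least bound) (auto simp: orlicz_space_def)
  qed
qed

end
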